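(* Let $(M,g)$ be a Riemannian manifold of dimension $n\ge 3$, let $TM$ be its tangent bundle, and let $a,b,c\in\mathbb{R}$ be constants with $a>0$ and $a(a+c)-b^2>0$. Let $G=a\,g^s+b\,g^h+c\,g^v$ be the Riemannian metric on $TM$ determined, at every $(x,y)\in TM$ and for all vector fields $X,Y$ on $M$, by $$G_{(x,y)}(X^h,Y^h)=(a+c)\,g_x(X,Y),\quad G_{(x,y)}(X^h,Y^v)=G_{(x,y)}(X^v,Y^h)=b\,g_x(X,Y),\quad G_{(x,y)}(X^v,Y^v)=a\,g_x(X,Y).$$ Then $(TM,G)$ is weakly symmetric if and only if $(M,g)$ is flat. Hence, in this case, $(TM,G)$ is flat.
   Context: Lifts. Let $\nabla$ be the Levi-Civita connection of $g$, with Christoffel symbols $\Gamma_{ij}^k$ in local coordinates $(x^i)$ on $M$, and let $(x^i,y^i)$ be the induced coordinates on $TM$. Put $\frac{\delta}{\delta x^i}=\frac{\partial}{\partial x^i}-y^a\Gamma_{ai}^j\frac{\partial}{\partial y^j}$. For a vector field $X=X^i\frac{\partial}{\partial x^i}$ on $M$, its horizontal lift is $X^h=X^i\frac{\delta}{\delta x^i}$ and its vertical lift is $X^v=X^i\frac{\partial}{\partial y^i}$; both are vector fields on $TM$, and at each point of $TM$ such lifts span the tangent space of $TM$. The Sasaki lift $g^s$, the horizontal lift $g^h$ and the vertical lift $g^v$ of $g$ are the symmetric $(0,2)$-tensor fields on $TM$ given by: $g^s(X^h,Y^h)=g^s(X^v,Y^v)=g(X,Y)$, $g^s(X^h,Y^v)=0$;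 $g^h(X^h,Y^h)=g^h(X^v,Y^v)=0$, $g^h(X^h,Y^v)=g(X,Y)$; $g^v(X^h,Y^h)=g(X,Y)$, $g^v(X^h,Y^v)=g^v(X^v,Y^v)=0$. The metric $G$ is Riemannian if and only if $a>0$ and $a(a+c)-b^2>0$. Curvature convention: $R(X,Y)Z=\nabla_X\nabla_YZ-\nabla_Y\nabla_XZ-\nabla_{[X,Y]}Z$. Flat means that the Riemannian curvature tensor vanishes identically. Weak symmetry. A Riemannian manifold $(N,k)$ with Levi-Civita connection $\nabla$ and curvature tensor $R$ is called weakly symmetric if there exist 1-forms $\alpha_1,\alpha_2,\alpha_3,\alpha_4$ and a vector field $A$ on $N$ such that for all vector fields $W,X,Y,Z$ on $N$ $$(\nabla_WR)(X,Y,Z)=\alpha_1(W)R(X,Y)Z+\alpha_2(X)R(W,Y)Z+\alpha_3(Y)R(X,W)Z+\alpha_4(Z)R(X,Y)W+k(R(X,Y)Z,W)A,$$ where $(\nabla_WR)(X,Y,Z)$ denotes $(\nabla_WR)(X,Y)Z$. (The paper uses the characterization, quoted from the literature, that one may take $\alpha_2=\alpha_3=\alpha_4$ and $A=(\alpha_2)^\sharp$, where $\sharp$ denotes the metric dual with respect to $k$.) The 1-forms and the vector field are allowed to be zero. *)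

theory Defs
  imports "HOL-Analysis.Analysis"
begin

section \<open>Smooth maps between Euclidean spaces\<close>

(* Only used on open sets S. *)
fun times_differentiable_on ::
    "nat \<Rightarrow> 'e::euclidean_space set \<Rightarrow> ('e \<Rightarrow> 'f::real_normed_vector) \<Rightarrow> bool" where
  "times_differentiable_on 0 S f \<longleftrightarrow> continuous_on S f"
| "times_differentiable_on (Suc k) S f \<longleftrightarrow>
     (\<forall>x\<in>S. f differentiable (at x)) \<and>
     (\<forall>v. times_differentiable_on k S (\<lambda>x. frechet_derivative f (at x) v))"

definition smooth_on :: "'e::euclidean_space set \<Rightarrow> ('e \<Rightarrow> 'f::real_normed_vector) \<Rightarrow> bool" where
  "smooth_on S f \<longleftrightarrow> (\<forall>k. times_differentiable_on k S f)"

section \<open>Smooth manifolds\<close>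

(* An atlas is a family of charts indexed by a set of labels, with values in a Euclidean
   space 'e; the dimension of the manifold is DIM('e). The atlas need not be maximal: smoothness
   of fields in its charts implies smoothness in all compatible charts. *)
record ('a, 'i, 'e) atlas =
  labels :: "'i set"
  cdom :: "'i \<Rightarrow> 'a set"
  cmap :: "'i \<Rightarrow> 'a \<Rightarrow> 'e"

definition points :: "('a, 'i, 'e) atlas \<Rightarrow> 'a set" where
  "points M = (\<Union>i\<in>labels M. cdom M i)"

definition charts_at :: "('a, 'i, 'e) atlas \<Rightarrow> 'a \<Rightarrow> 'i set" where
  "charts_at M p = {i \<in> labels M. p \<in> cdom M i}"

definition cran :: "('a, 'i, 'e) atlas \<Rightarrow> 'i \<Rightarrow> 'e set" where
  "cran M i = cmap M i ` cdom M i"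

definition cinv :: "('a, 'i, 'e) atlas \<Rightarrow> 'i \<Rightarrow> 'e \<Rightarrow> 'a" where
  "cinv M i = inv_into (cdom M i) (cmap M i)"

definition transition :: "('a, 'i, 'e) atlas \<Rightarrow> 'i \<Rightarrow> 'i \<Rightarrow> 'e \<Rightarrow> 'e" where
  "transition M i j = cmap M j \<circ> cinv M i"

definition smooth_atlas :: "('a, 'i, 'e::euclidean_space) atlas \<Rightarrow> bool" where
  "smooth_atlas M \<longleftrightarrow>
     (\<forall>i\<in>labels M. inj_on (cmap M i) (cdom M i) \<and> open (cran M i)) \<and>
     (\<forall>i\<in>labels M. \<forall>j\<in>labels M.
        open (cmap M i ` (cdom M i \<inter> cdom M j)) \<and>
        smooth_on (cmap M i ` (cdom M i \<inter> cdom M j)) (transition M i j))"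

(* The unique topology for which the charts are homeomorphisms of open sets. *)
definition atlas_topology :: "('a, 'i, 'e::euclidean_space) atlas \<Rightarrow> 'a topology" where
  "atlas_topology M =
     topology (\<lambda>S. S \<subseteq> points M \<and> (\<forall>i\<in>labels M. open (cmap M i ` (cdom M i \<inter> S))))"

definition smooth_manifold :: "('a, 'i, 'e::euclidean_space) atlas \<Rightarrow> bool" where
  "smooth_manifold M \<longleftrightarrow>
     smooth_atlas M \<and> Hausdorff_space (atlas_topology M) \<and> second_countable (atlas_topology M)"

lemma openin_atlas_topology:
  assumes "smooth_atlas M"
  shows "openin (atlas_topology M) S \<longleftrightarrow>
     S \<subseteq> points M \<and> (\<forall>i\<in>labels M. open (cmap M i ` (cdom M i \<inter> S)))"
proof -
  have inj: "inj_on (cmap M i) (cdom M i)" if "i \<in> labels M" for i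
    using assms that by (simp add: smooth_atlas_def)
  have "istopology (\<lambda>S. S \<subseteq> points M \<and> (\<forall>i\<in>labels M. open (cmap M i ` (cdom M i \<inter> S))))"
    unfolding istopology_def
  proof (intro conjI allI impI ballI)
    fix S T i
    assume S: "S \<subseteq> points M \<and> (\<forall>i\<in>labels M. open (cmap M i ` (cdom M i \<inter> S)))"
      and T: "T \<subseteq> points M \<and> (\<forall>i\<in>labels M. open (cmap M i ` (cdom M i \<inter> T)))"
    show "S \<inter> T \<subseteq> points M" using S by blast
    assume i: "i \<in> labels M"
    have "cmap M i ` (cdom M i \<inter> (S \<inter> T)) =
        cmap M i ` (cdom M i \<inter> S) \<inter> cmap M i ` (cdom M i \<inter> T)"
      using inj[OF i] unfolding inj_on_def by blast
    then show "open (cmap M i ` (cdom M i \<inter> (S \<inter> T)))"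
      using S T i by (simp add: open_Int)
  next
    fix K i
    assume K: "\<forall>S\<in>K. S \<subseteq> points M \<and> (\<forall>i\<in>labels M. open (cmap M i ` (cdom M i \<inter> S)))"
    show "\<Union>K \<subseteq> points M" using K by blast
    assume i: "i \<in> labels M"
    have "cmap M i ` (cdom M i \<inter> \<Union>K) = (\<Union>S\<in>K. cmap M i ` (cdom M i \<inter> S))"
      by blast
    then show "open (cmap M i ` (cdom M i \<inter> \<Union>K))"
      using K i by auto
  qed
  then show ?thesis
    by (simp add: atlas_topology_def topology_inverse')
qed

section \<open>Tangent vectors, vector fields and 1-forms\<close>

(* A tangent vector at p is the family of its components in the charts around p, related by the
   derivatives of the transition maps; components in the other charts are 0 by convention. *)
type_synonym ('i, 'e) tvec = "'i \<Rightarrow> 'e"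

definition tangent_space :: "('a, 'i, 'e::euclidean_space) atlas \<Rightarrow> 'a \<Rightarrow> ('i, 'e) tvec set" where
  "tangent_space M p =
     {v. (\<forall>i. i \<notin> charts_at M p \<longrightarrow> v i = 0) \<and>
         (\<forall>i\<in>charts_at M p. \<forall>j\<in>charts_at M p.
            v j = frechet_derivative (transition M i j) (at (cmap M i p)) (v i))}"

(* The tangent vector at p whose component in the chart i is u. *)
definition tvec_of :: "('a, 'i, 'e::euclidean_space) atlas \<Rightarrow> 'i \<Rightarrow> 'a \<Rightarrow> 'e \<Rightarrow> ('i, 'e) tvec" where
  "tvec_of M i p u =
     (\<lambda>j. if j \<in> charts_at M p
          then frechet_derivative (transition M i j) (at (cmap M i p)) u else 0)"

type_synonym ('a, 'i, 'e) vfield = "'a \<Rightarrow> ('i, 'e) tvec"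
type_synonym ('a, 'i, 'e) oneform = "'a \<Rightarrow> ('i, 'e) tvec \<Rightarrow> real"
type_synonym ('a, 'i, 'e) tensor2 = "'a \<Rightarrow> ('i, 'e) tvec \<Rightarrow> ('i, 'e) tvec \<Rightarrow> real"

definition vf_comp :: "('a, 'i, 'e) atlas \<Rightarrow> ('a, 'i, 'e) vfield \<Rightarrow> 'i \<Rightarrow> 'e \<Rightarrow> 'e" where
  "vf_comp M X i x = X (cinv M i x) i"

definition vector_field :: "('a, 'i, 'e::euclidean_space) atlas \<Rightarrow> ('a, 'i, 'e) vfield \<Rightarrow> bool" where
  "vector_field M X \<longleftrightarrow>
     (\<forall>p\<in>points M. X p \<in> tangent_space M p) \<and>
     (\<forall>i\<in>labels M. smooth_on (cran M i) (vf_comp M X i))"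

definition one_form :: "('a, 'i, 'e::euclidean_space) atlas \<Rightarrow> ('a, 'i, 'e) oneform \<Rightarrow> bool" where
  "one_form M \<alpha> \<longleftrightarrow>
     (\<forall>i\<in>labels M.
        (\<forall>p\<in>cdom M i. linear (\<lambda>u. \<alpha> p (tvec_of M i p u))) \<and>
        (\<forall>u. smooth_on (cran M i) (\<lambda>x. \<alpha> (cinv M i x) (tvec_of M i (cinv M i x) u))))"

section \<open>Riemannian metrics\<close>

definition metric_comp ::
    "('a, 'i, 'e::euclidean_space) atlas \<Rightarrow> ('a, 'i, 'e) tensor2 \<Rightarrow> 'i \<Rightarrow> 'e \<Rightarrow> 'e \<Rightarrow> 'e \<Rightarrow> real" where
  "metric_comp M g i x u v = g (cinv M i x) (tvec_of M i (cinv M i x) u) (tvec_of M i (cinv M i x) v)"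

definition riemannian_metric ::
    "('a, 'i, 'e::euclidean_space) atlas \<Rightarrow> ('a, 'i, 'e) tensor2 \<Rightarrow> bool" where
  "riemannian_metric M g \<longleftrightarrow>
     (\<forall>i\<in>labels M.
        (\<forall>x\<in>cran M i. bilinear (metric_comp M g i x) \<and>
           (\<forall>u v. metric_comp M g i x u v = metric_comp M g i x v u) \<and>
           (\<forall>u. u \<noteq> 0 \<longrightarrow> metric_comp M g i x u u > 0)) \<and>
        (\<forall>u v. smooth_on (cran M i) (\<lambda>x. metric_comp M g i x u v)))"

definition riemannian_manifold ::
    "('a, 'i, 'e::euclidean_space) atlas \<Rightarrow> ('a, 'i, 'e) tensor2 \<Rightarrow> bool" where
  "riemannian_manifold M g \<longleftrightarrow> smooth_manifold M \<and> riemannian_metric M g"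

section \<open>The Levi-Civita connection and its curvature\<close>

(* The Christoffel symbols in the chart i as a bilinear map: for u = u^i e_i and v = v^j e_j the
   value is Gamma^k_ij u^i v^j e_k. This is the Koszul formula for constant-coefficient fields;
   existence and uniqueness of w is shown in the proof of christoffel_koszul. *)
definition christoffel ::
    "('a, 'i, 'e::euclidean_space) atlas \<Rightarrow> ('a, 'i, 'e) tensor2 \<Rightarrow> 'i \<Rightarrow> 'e \<Rightarrow> 'e \<Rightarrow> 'e \<Rightarrow> 'e" where
  "christoffel M g i x u v =
     (THE w. \<forall>z. metric_comp M g i x w z =
        (frechet_derivative (\<lambda>y. metric_comp M g i y v z) (at x) u
         + frechet_derivative (\<lambda>y. metric_comp M g i y u z) (at x) v
         - frechet_derivative (\<lambda>y. metric_comp M g i y u v) (at x) z) / 2)"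

(* All operators on vector fields are computed chartwise, with component 0 in charts not
   containing the point, as in tangent_space. *)
definition nabla ::
    "('a, 'i, 'e::euclidean_space) atlas \<Rightarrow> ('a, 'i, 'e) tensor2 \<Rightarrow>
     ('a, 'i, 'e) vfield \<Rightarrow> ('a, 'i, 'e) vfield \<Rightarrow> ('a, 'i, 'e) vfield" where
  "nabla M g X Y = (\<lambda>p i. if i \<in> charts_at M p then
       frechet_derivative (vf_comp M Y i) (at (cmap M i p)) (X p i)
       + christoffel M g i (cmap M i p) (X p i) (Y p i)
     else 0)"

definition lie_bracket ::
    "('a, 'i, 'e::euclidean_space) atlas \<Rightarrow>
     ('a, 'i, 'e) vfield \<Rightarrow> ('a, 'i, 'e) vfield \<Rightarrow> ('a, 'i, 'e) vfield" where
  "lie_bracket M X Y = (\<lambda>p i. if i \<in> charts_at M p then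
       frechet_derivative (vf_comp M Y i) (at (cmap M i p)) (X p i)
       - frechet_derivative (vf_comp M X i) (at (cmap M i p)) (Y p i)
     else 0)"

definition curvature ::
    "('a, 'i, 'e::euclidean_space) atlas \<Rightarrow> ('a, 'i, 'e) tensor2 \<Rightarrow>
     ('a, 'i, 'e) vfield \<Rightarrow> ('a, 'i, 'e) vfield \<Rightarrow> ('a, 'i, 'e) vfield \<Rightarrow> ('a, 'i, 'e) vfield" where
  "curvature M g X Y Z = (\<lambda>p i.
       nabla M g X (nabla M g Y Z) p i - nabla M g Y (nabla M g X Z) p i
       - nabla M g (lie_bracket M X Y) Z p i)"

definition nabla_curvature ::
    "('a, 'i, 'e::euclidean_space) atlas \<Rightarrow> ('a, 'i, 'e) tensor2 \<Rightarrow> ('a, 'i, 'e) vfield \<Rightarrow>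
     ('a, 'i, 'e) vfield \<Rightarrow> ('a, 'i, 'e) vfield \<Rightarrow> ('a, 'i, 'e) vfield \<Rightarrow> ('a, 'i, 'e) vfield" where
  "nabla_curvature M g W X Y Z = (\<lambda>p i.
       nabla M g W (curvature M g X Y Z) p i
       - curvature M g (nabla M g W X) Y Z p i
       - curvature M g X (nabla M g W Y) Z p i
       - curvature M g X Y (nabla M g W Z) p i)"

definition flat :: "('a, 'i, 'e::euclidean_space) atlas \<Rightarrow> ('a, 'i, 'e) tensor2 \<Rightarrow> bool" where
  "flat M g \<longleftrightarrow>
     (\<forall>X Y Z. vector_field M X \<longrightarrow> vector_field M Y \<longrightarrow> vector_field M Z \<longrightarrow>
        (\<forall>p\<in>points M. curvature M g X Y Z p = (\<lambda>i. 0)))"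

definition weakly_symmetric ::
    "('a, 'i, 'e::euclidean_space) atlas \<Rightarrow> ('a, 'i, 'e) tensor2 \<Rightarrow> bool" where
  "weakly_symmetric N k \<longleftrightarrow>
     (\<exists>\<alpha>1 \<alpha>2 \<alpha>3 \<alpha>4 A.
        one_form N \<alpha>1 \<and> one_form N \<alpha>2 \<and> one_form N \<alpha>3 \<and> one_form N \<alpha>4 \<and> vector_field N A \<and>
        (\<forall>W X Y Z. vector_field N W \<longrightarrow> vector_field N X \<longrightarrow> vector_field N Y \<longrightarrow> vector_field N Z \<longrightarrow>
          (\<forall>p\<in>points N. nabla_curvature N k W X Y Z p = (\<lambda>i.
              \<alpha>1 p (W p) *\<^sub>R curvature N k X Y Z p i
            + \<alpha>2 p (X p) *\<^sub>R curvature N k W Y Z p i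
            + \<alpha>3 p (Y p) *\<^sub>R curvature N k X W Z p i
            + \<alpha>4 p (Z p) *\<^sub>R curvature N k X Y W p i
            + k p (curvature N k X Y Z p) (W p) *\<^sub>R A p i))))"

section \<open>The tangent bundle\<close>

(* Charts are the induced coordinates (x, y); a tangent vector of TM thus has components in
   'e * 'e, the first for d/dx and the second for d/dy. *)
definition tangent_bundle ::
    "('a, 'i, 'e::euclidean_space) atlas \<Rightarrow> ('a \<times> ('i, 'e) tvec, 'i, 'e \<times> 'e) atlas" where
  "tangent_bundle M =
     \<lparr> labels = labels M,
       cdom = (\<lambda>i. {(p, y). p \<in> cdom M i \<and> y \<in> tangent_space M p}),
       cmap = (\<lambda>i (p, y). (cmap M i p, y i)) \<rparr>"

definition hlift ::
    "('a, 'i, 'e::euclidean_space) atlas \<Rightarrow> ('a, 'i, 'e) tensor2 \<Rightarrow>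
     ('a, 'i, 'e) vfield \<Rightarrow> ('a \<times> ('i, 'e) tvec, 'i, 'e \<times> 'e) vfield" where
  "hlift M g X = (\<lambda>(p, y) i. if i \<in> charts_at M p
     then (X p i, - christoffel M g i (cmap M i p) (y i) (X p i)) else 0)"

definition vlift ::
    "('a, 'i, 'e::euclidean_space) atlas \<Rightarrow>
     ('a, 'i, 'e) vfield \<Rightarrow> ('a \<times> ('i, 'e) tvec, 'i, 'e \<times> 'e) vfield" where
  "vlift M X = (\<lambda>(p, y) i. if i \<in> charts_at M p then (0, X p i) else 0)"

(* A tangent vector of TM at (p, y) is the sum of the horizontal lift of hpart and the vertical
   lift of vpart (lemma lift_decomposition); hpart is the differential of the projection TM -> M
   and vpart is the connection map. *)
definition hpart :: "('i, 'e::euclidean_space \<times> 'e) tvec \<Rightarrow> ('i, 'e) tvec" where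
  "hpart \<xi> = (\<lambda>i. fst (\<xi> i))"

definition vpart ::
    "('a, 'i, 'e::euclidean_space) atlas \<Rightarrow> ('a, 'i, 'e) tensor2 \<Rightarrow>
     'a \<times> ('i, 'e) tvec \<Rightarrow> ('i, 'e \<times> 'e) tvec \<Rightarrow> ('i, 'e) tvec" where
  "vpart M g = (\<lambda>(p, y) \<xi> i. if i \<in> charts_at M p
     then snd (\<xi> i) + christoffel M g i (cmap M i p) (y i) (fst (\<xi> i)) else 0)"

definition sasaki_lift ::
    "('a, 'i, 'e::euclidean_space) atlas \<Rightarrow> ('a, 'i, 'e) tensor2 \<Rightarrow>
     ('a \<times> ('i, 'e) tvec, 'i, 'e \<times> 'e) tensor2" where
  "sasaki_lift M g q \<xi> \<eta> =
     g (fst q) (hpart \<xi>) (hpart \<eta>) + g (fst q) (vpart M g q \<xi>) (vpart M g q \<eta>)"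

definition horizontal_lift ::
    "('a, 'i, 'e::euclidean_space) atlas \<Rightarrow> ('a, 'i, 'e) tensor2 \<Rightarrow>
     ('a \<times> ('i, 'e) tvec, 'i, 'e \<times> 'e) tensor2" where
  "horizontal_lift M g q \<xi> \<eta> =
     g (fst q) (hpart \<xi>) (vpart M g q \<eta>) + g (fst q) (vpart M g q \<xi>) (hpart \<eta>)"

definition vertical_lift ::
    "('a, 'i, 'e::euclidean_space) atlas \<Rightarrow> ('a, 'i, 'e) tensor2 \<Rightarrow>
     ('a \<times> ('i, 'e) tvec, 'i, 'e \<times> 'e) tensor2" where
  "vertical_lift M g q \<xi> \<eta> = g (fst q) (hpart \<xi>) (hpart \<eta>)"

definition lift_metric ::
    "real \<Rightarrow> real \<Rightarrow> real \<Rightarrow> ('a, 'i, 'e::euclidean_space) atlas \<Rightarrow> ('a, 'i, 'e) tensor2 \<Rightarrow>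
     ('a \<times> ('i, 'e) tvec, 'i, 'e \<times> 'e) tensor2" where
  "lift_metric a b c M g q \<xi> \<eta> =
     a * sasaki_lift M g q \<xi> \<eta> + b * horizontal_lift M g q \<xi> \<eta> + c * vertical_lift M g q \<xi> \<eta>"

section \<open>Consistency of the definitions\<close>

lemma cinv_cmap:
  "smooth_atlas M \<Longrightarrow> i \<in> charts_at M p \<Longrightarrow> cinv M i (cmap M i p) = p"
  by (auto simp: smooth_atlas_def charts_at_def cinv_def)

lemma linear_transition:
  assumes "smooth_atlas M" "i \<in> charts_at M p" "j \<in> charts_at M p"
  shows "linear (frechet_derivative (transition M i j) (at (cmap M i p)))"
proof (rule linear_frechet_derivative)
  have "times_differentiable_on (Suc 0) (cmap M i ` (cdom M i \<inter> cdom M j)) (transition M i j)"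
    using assms unfolding smooth_atlas_def smooth_on_def charts_at_def by blast
  then show "transition M i j differentiable at (cmap M i p)"
    using assms by (auto simp: charts_at_def)
qed

lemma tangent_space_outside: "v \<in> tangent_space M p \<Longrightarrow> i \<notin> charts_at M p \<Longrightarrow> v i = 0"
  unfolding tangent_space_def by blast

lemma tvec_of_component:
  assumes "v \<in> tangent_space M p" "i \<in> charts_at M p"
  shows "tvec_of M i p (v i) = v"
proof
  fix j
  have "v j = frechet_derivative (transition M i j) (at (cmap M i p)) (v i)"
    if "j \<in> charts_at M p"
    using assms that unfolding tangent_space_def by blast
  then show "tvec_of M i p (v i) j = v j"
    using tangent_space_outside[OF assms(1)] by (metis tvec_of_def)
qed

lemma metric_eq_metric_comp:
  assumes "smooth_atlas M" "i \<in> charts_at M p" "u \<in> tangent_space M p" "v \<in> tangent_space M p"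
  shows "g p u v = metric_comp M g i (cmap M i p) (u i) (v i)"
  using assms by (simp add: metric_comp_def cinv_cmap tvec_of_component)

lemma metric_zero:
  assumes "smooth_atlas M" "riemannian_metric M g" "p \<in> points M" "u \<in> tangent_space M p"
  shows "g p u (\<lambda>i. 0) = 0" "g p (\<lambda>i. 0) u = 0" "g p (\<lambda>i. 0) (\<lambda>i. 0) = 0"
proof -
  obtain i where i: "i \<in> charts_at M p"
    using assms(3) by (auto simp: points_def charts_at_def)
  have bl: "bilinear (metric_comp M g i (cmap M i p))"
    using assms(2) i unfolding riemannian_metric_def charts_at_def cran_def by blast
  have z: "(\<lambda>i. 0) \<in> tangent_space M p"
    using linear_0[OF linear_transition[OF assms(1)]] by (auto simp: tangent_space_def)
  note eq = metric_eq_metric_comp[OF assms(1) i, where g = g]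
  show "g p u (\<lambda>i. 0) = 0" "g p (\<lambda>i. 0) u = 0" "g p (\<lambda>i. 0) (\<lambda>i. 0) = 0"
    using bilinear_rzero[OF bl] bilinear_lzero[OF bl] z assms(4) by (simp_all add: eq)
qed

subsection \<open>The Christoffel symbols\<close>

lemma nondegenerate_representation:
  fixes B :: "'e::euclidean_space \<Rightarrow> 'e \<Rightarrow> real"
  assumes B: "bilinear B" and pos: "\<And>u. u \<noteq> 0 \<Longrightarrow> B u u > 0" and f: "linear f"
  shows "\<exists>!w. \<forall>z. B w z = f z"
proof -
  define L where "L w = (\<Sum>b\<in>Basis. B w b *\<^sub>R b)" for w
  have L: "linear L"
    unfolding L_def
    by (rule linearI)
       (simp_all add: bilinear_ladd[OF B] bilinear_lmul[OF B] scaleR_add_left sum.distrib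
         scaleR_sum_right)
  have Lb: "L w \<bullet> b = B w b" if "b \<in> Basis" for w b
    using that by (simp add: L_def inner_sum_left inner_Basis if_distrib sum.delta cong: if_cong)
  have lin: "linear (B w)" for w
    using B by (simp add: bilinear_def)
  have ext: "(\<forall>z. B w z = h z) \<longleftrightarrow> (\<forall>b\<in>Basis. B w b = h b)" if "linear h" for w h
    using linear_eq_stdbasis[OF lin that] by blast
  have inj: "inj L"
  proof (subst linear_injective_0[OF L], intro allI impI)
    fix w assume "L w = 0"
    then have "\<forall>b\<in>Basis. B w b = 0" using Lb by (metis inner_zero_left)
    then have "B w w = 0" using ext[of "\<lambda>_. 0" w] by (simp add: linear_iff)
    then show "w = 0" using pos[of w] by fastforce
  qed
  have "surj L" using linear_injective_imp_surjective[OF L inj] by simp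
  then obtain w where w: "L w = (\<Sum>b\<in>Basis. f b *\<^sub>R b)" by (metis surjD)
  have "B w b = f b" if "b \<in> Basis" for b
    using Lb[OF that, of w] w that
    by (simp add: inner_sum_left inner_Basis if_distrib sum.delta cong: if_cong)
  then have ex: "\<forall>z. B w z = f z" using ext[OF f] by blast
  show ?thesis
  proof (rule ex1I[where a = w], rule ex)
    fix w' assume "\<forall>z. B w' z = f z"
    then have "L w' = L w" using ex by (simp add: L_def)
    then show "w' = w" using inj by (simp add: inj_eq)
  qed
qed

lemma metric_comp_differentiable:
  assumes "riemannian_metric M g" "i \<in> labels M" "x \<in> cran M i"
  shows "(\<lambda>y. metric_comp M g i y u v) differentiable (at x)"
proof -
  have "times_differentiable_on (Suc 0) (cran M i) (\<lambda>y. metric_comp M g i y u v)"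
    using assms by (simp only: riemannian_metric_def smooth_on_def)
  then show ?thesis using assms(3) by simp
qed

lemma linear_deriv_metric_comp:
  assumes M: "smooth_atlas M" and g: "riemannian_metric M g"
    and i: "i \<in> labels M" and x: "x \<in> cran M i"
  shows "linear (\<lambda>z. frechet_derivative (\<lambda>y. metric_comp M g i y v z) (at x) u)"
proof (rule linearI)
  note d = metric_comp_differentiable[OF g i x, unfolded frechet_derivative_works]
  have op: "open (cran M i)" using M i by (simp add: smooth_atlas_def)
  have bl: "bilinear (metric_comp M g i y)" if "y \<in> cran M i" for y
    using g i that by (simp add: riemannian_metric_def)
  fix z z' :: 'c and r :: real
  have "((\<lambda>y. metric_comp M g i y v (z + z')) has_derivative
      (\<lambda>u. frechet_derivative (\<lambda>y. metric_comp M g i y v z) (at x) u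
         + frechet_derivative (\<lambda>y. metric_comp M g i y v z') (at x) u)) (at x)"
    by (rule has_derivative_transform_within_open[OF has_derivative_add[OF d d] op x])
       (simp add: bilinear_radd[OF bl])
  from frechet_derivative_at[OF this, symmetric]
  show "frechet_derivative (\<lambda>y. metric_comp M g i y v (z + z')) (at x) u =
      frechet_derivative (\<lambda>y. metric_comp M g i y v z) (at x) u
      + frechet_derivative (\<lambda>y. metric_comp M g i y v z') (at x) u" by simp
  have "((\<lambda>y. metric_comp M g i y v (r *\<^sub>R z)) has_derivative
      (\<lambda>u. r *\<^sub>R frechet_derivative (\<lambda>y. metric_comp M g i y v z) (at x) u)) (at x)"
    by (rule has_derivative_transform_within_open[OF has_derivative_scaleR_right[OF d] op x])
       (simp add: bilinear_rmul[OF bl])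
  from frechet_derivative_at[OF this, symmetric]
  show "frechet_derivative (\<lambda>y. metric_comp M g i y v (r *\<^sub>R z)) (at x) u =
      r *\<^sub>R frechet_derivative (\<lambda>y. metric_comp M g i y v z) (at x) u" by simp
qed

lemma christoffel_koszul:
  assumes M: "smooth_atlas M" and g: "riemannian_metric M g"
    and i: "i \<in> labels M" and x: "x \<in> cran M i"
  shows "metric_comp M g i x (christoffel M g i x u v) z =
        (frechet_derivative (\<lambda>y. metric_comp M g i y v z) (at x) u
         + frechet_derivative (\<lambda>y. metric_comp M g i y u z) (at x) v
         - frechet_derivative (\<lambda>y. metric_comp M g i y u v) (at x) z) / 2"
proof -
  let ?f = "\<lambda>z. (frechet_derivative (\<lambda>y. metric_comp M g i y v z) (at x) u
         + frechet_derivative (\<lambda>y. metric_comp M g i y u z) (at x) v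
         - frechet_derivative (\<lambda>y. metric_comp M g i y u v) (at x) z) / 2"
  have "linear ?f"
    using linear_compose_scale_right[OF linear_compose_sub[OF linear_compose_add[OF
        linear_deriv_metric_comp[OF assms, of v u] linear_deriv_metric_comp[OF assms, of u v]]
        linear_frechet_derivative[OF metric_comp_differentiable[OF g i x, of u v]]], of "1/2"]
    by simp
  then have "\<exists>!w. \<forall>z. metric_comp M g i x w z = ?f z"
    using g i x by (intro nondegenerate_representation) (auto simp: riemannian_metric_def)
  from theI'[OF this] show ?thesis
    unfolding christoffel_def by blast
qed

lemma deriv_metric_comp_sym:
  assumes M: "smooth_atlas M" and g: "riemannian_metric M g"
    and i: "i \<in> labels M" and x: "x \<in> cran M i"
  shows "frechet_derivative (\<lambda>y. metric_comp M g i y u v) (at x) =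
     frechet_derivative (\<lambda>y. metric_comp M g i y v u) (at x)"
proof (rule frechet_derivative_transform_within_open[OF metric_comp_differentiable[OF g i x] _ x])
  show "open (cran M i)" using M i by (simp add: smooth_atlas_def)
  show "metric_comp M g i y u v = metric_comp M g i y v u" if "y \<in> cran M i" for y
    using g i that unfolding riemannian_metric_def by blast
qed

lemma christoffel_sym:
  assumes "smooth_atlas M" "riemannian_metric M g" "i \<in> labels M" "x \<in> cran M i"
  shows "christoffel M g i x u v = christoffel M g i x v u"
proof -
  let ?B = "metric_comp M g i x"
  have bl: "bilinear ?B" and pos: "\<And>u. u \<noteq> 0 \<Longrightarrow> ?B u u > 0"
    using assms unfolding riemannian_metric_def by blast+
  have "frechet_derivative (\<lambda>y. metric_comp M g i y u v) (at x) =
      frechet_derivative (\<lambda>y. metric_comp M g i y v u) (at x)"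
    by (rule deriv_metric_comp_sym[OF assms])
  then have "?B (christoffel M g i x u v) z = ?B (christoffel M g i x v u) z" for z
    by (simp add: christoffel_koszul[OF assms])
  then have "?B (christoffel M g i x u v - christoffel M g i x v u)
      (christoffel M g i x u v - christoffel M g i x v u) = 0"
    by (simp add: bilinear_lsub[OF bl])
  then show ?thesis
    using pos[of "christoffel M g i x u v - christoffel M g i x v u"] by auto
qed

lemma nabla_torsion_free:
  assumes "smooth_atlas M" "riemannian_metric M g"
  shows "nabla M g X Y p i - nabla M g Y X p i = lie_bracket M X Y p i"
proof (cases "i \<in> charts_at M p")
  case True
  then have "i \<in> labels M" "cmap M i p \<in> cran M i" by (auto simp: charts_at_def cran_def)
  then show ?thesis
    using christoffel_sym[OF assms] by (simp add: nabla_def lie_bracket_def)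
qed (simp add: nabla_def lie_bracket_def)

lemma christoffel_metric_compatible:
  assumes "smooth_atlas M" "riemannian_metric M g" "i \<in> labels M" "x \<in> cran M i"
  shows "frechet_derivative (\<lambda>y. metric_comp M g i y u v) (at x) w =
     metric_comp M g i x (christoffel M g i x w u) v + metric_comp M g i x u (christoffel M g i x w v)"
proof -
  have s: "metric_comp M g i x u z = metric_comp M g i x z u" for u z
    using assms unfolding riemannian_metric_def by blast
  have ds: "frechet_derivative (\<lambda>y. metric_comp M g i y u v) (at x) =
      frechet_derivative (\<lambda>y. metric_comp M g i y v u) (at x)" for u v
    by (rule deriv_metric_comp_sym[OF assms])
  have "metric_comp M g i x u (christoffel M g i x w v) =
      metric_comp M g i x (christoffel M g i x w v) u"
    by (rule s)
  also note christoffel_koszul[OF assms]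
  finally show ?thesis
    using christoffel_koszul[OF assms, of w u v] ds[of v u] ds[of w v] ds[of w u]
    by (simp add: field_simps)
qed

subsection \<open>The lifted metric on horizontal and vertical lifts\<close>

lemma lift_decomposition:
  assumes "\<xi> \<in> tangent_space (tangent_bundle M) (p, y)"
  shows "\<xi> i = hlift M g (\<lambda>_. hpart \<xi>) (p, y) i + vlift M (\<lambda>_. vpart M g (p, y) \<xi>) (p, y) i"
proof (cases "i \<in> charts_at M p")
  case False
  then have "i \<notin> charts_at (tangent_bundle M) (p, y)"
    by (auto simp: charts_at_def tangent_bundle_def)
  then show ?thesis
    using False tangent_space_outside[OF assms(1)] by (simp add: hlift_def vlift_def)
qed (simp add: hlift_def vlift_def hpart_def vpart_def prod_eq_iff)

lemma hpart_hlift: "X p \<in> tangent_space M p \<Longrightarrow> hpart (hlift M g X (p, y)) = X p"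
  by (auto simp: hpart_def hlift_def tangent_space_outside)

lemma hpart_vlift: "hpart (vlift M X (p, y)) = (\<lambda>i. 0)"
  by (auto simp: hpart_def vlift_def)

lemma vpart_hlift: "vpart M g (p, y) (hlift M g X (p, y)) = (\<lambda>i. 0)"
  by (auto simp: vpart_def hlift_def)

lemma christoffel_zero:
  assumes "smooth_atlas M" "riemannian_metric M g" "i \<in> labels M" "x \<in> cran M i"
  shows "christoffel M g i x u 0 = 0"
proof -
  let ?B = "metric_comp M g i x"
  have bl: "bilinear ?B" and pos: "\<And>u. u \<noteq> 0 \<Longrightarrow> ?B u u > 0"
    using assms unfolding riemannian_metric_def by blast+
  have sd: "frechet_derivative (\<lambda>y. metric_comp M g i y z 0) (at x) w = 0" for z w
    using linear_0[OF linear_deriv_metric_comp[OF assms, of z w]] by simp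
  have "frechet_derivative (\<lambda>y. metric_comp M g i y 0 z) (at x) =
      frechet_derivative (\<lambda>y. metric_comp M g i y z 0) (at x)" for z
    by (rule deriv_metric_comp_sym[OF assms])
  moreover have "frechet_derivative (\<lambda>y. metric_comp M g i y u z) (at x) 0 = 0" for z
    using linear_0[OF linear_frechet_derivative[OF metric_comp_differentiable[OF assms(2-)]]] by blast
  ultimately have "?B (christoffel M g i x u 0) z = 0" for z
    using sd by (simp add: christoffel_koszul[OF assms])
  then show ?thesis
    using pos[of "christoffel M g i x u 0"] by fastforce
qed

lemma vpart_vlift:
  assumes "smooth_atlas M" "riemannian_metric M g" "X p \<in> tangent_space M p"
  shows "vpart M g (p, y) (vlift M X (p, y)) = X p"
proof
  fix i
  show "vpart M g (p, y) (vlift M X (p, y)) i = X p i"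
  proof (cases "i \<in> charts_at M p")
    case True
    then have "i \<in> labels M" "cmap M i p \<in> cran M i" by (auto simp: charts_at_def cran_def)
    then show ?thesis
      using True christoffel_zero[OF assms(1,2)] by (simp add: vpart_def vlift_def)
  qed (simp add: vpart_def tangent_space_outside[OF assms(3)])
qed

lemma lift_metric_on_lifts:
  assumes M: "riemannian_manifold M g" and p: "(p, y) \<in> points (tangent_bundle M)"
    and X: "vector_field M X" and Y: "vector_field M Y"
  shows "lift_metric a b c M g (p, y) (hlift M g X (p, y)) (hlift M g Y (p, y)) = (a + c) * g p (X p) (Y p)"
    and "lift_metric a b c M g (p, y) (hlift M g X (p, y)) (vlift M Y (p, y)) = b * g p (X p) (Y p)"
    and "lift_metric a b c M g (p, y) (vlift M X (p, y)) (hlift M g Y (p, y)) = b * g p (X p) (Y p)"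
    and "lift_metric a b c M g (p, y) (vlift M X (p, y)) (vlift M Y (p, y)) = a * g p (X p) (Y p)"
proof -
  have M': "smooth_atlas M" "riemannian_metric M g"
    using M by (auto simp: riemannian_manifold_def smooth_manifold_def)
  have p': "p \<in> points M" using p by (auto simp: points_def tangent_bundle_def)
  have XY: "X p \<in> tangent_space M p" "Y p \<in> tangent_space M p"
    using X Y p' by (auto simp: vector_field_def)
  note simps = lift_metric_def sasaki_lift_def horizontal_lift_def vertical_lift_def hpart_hlift
    hpart_vlift vpart_hlift vpart_vlift[OF M'] XY metric_zero[OF M' p' XY(1)]
    metric_zero[OF M' p' XY(2)] algebra_simps
  show "lift_metric a b c M g (p, y) (hlift M g X (p, y)) (hlift M g Y (p, y)) = (a + c) * g p (X p) (Y p)"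
    by (simp add: simps)
  show "lift_metric a b c M g (p, y) (hlift M g X (p, y)) (vlift M Y (p, y)) = b * g p (X p) (Y p)"
    by (simp add: simps)
  show "lift_metric a b c M g (p, y) (vlift M X (p, y)) (hlift M g Y (p, y)) = b * g p (X p) (Y p)"
    by (simp add: simps)
  show "lift_metric a b c M g (p, y) (vlift M X (p, y)) (vlift M Y (p, y)) = a * g p (X p) (Y p)"
    by (simp add: simps)
qed

end

theory Submission
  imports Defs
begin

text \<open>The connection \<open>\<nabla> + (b/a) id\<close> splits \<open>T(TM)\<close> into the vertical bundle and its
  \<open>G\<close>-orthogonal complement, and in this splitting the curvature of \<open>G\<close> is explicit. With
  \<open>\<rho> = a\<^sup>2 / (2 (a (a + c) - b\<^sup>2))\<close>, evaluate weak symmetry on \<open>W\<^sup>h\<close>, \<open>X\<^sup>v\<close>, \<open>Y\<^sup>v\<close>, \<open>Y\<^sup>v\<close> at the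
  point \<open>t X\<close> of \<open>TM\<close>. Writing \<open>r = R(X, Y)\<close>, the horizontal part reads
  \<open>- 3 \<rho>\<^sup>2 t r\<^sup>2 W = - \<alpha>\<^sub>2 \<rho>\<^sup>2 t\<^sup>2 r\<^sup>2 W + (\<alpha>\<^sub>3 + 2 \<alpha>\<^sub>4) \<rho> r W\<close>, with \<open>\<alpha>\<^sub>2, \<alpha>\<^sub>3, \<alpha>\<^sub>4\<close> evaluated on
  \<open>X\<^sup>v\<close>, \<open>Y\<^sup>v\<close>, \<open>Y\<^sup>v\<close>. Since \<open>r\<close> is skew, pairing with \<open>W\<close> gives \<open>t \<alpha>\<^sub>2(X\<^sup>v) = 3\<close> for all
  \<open>t \<noteq> 0\<close> unless \<open>r W = 0\<close>; letting \<open>t \<rightarrow> 0\<close> contradicts the continuity of \<open>\<alpha>\<^sub>2\<close>.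
  Conversely, if \<open>R = 0\<close> then the connection of \<open>G\<close> is in this splitting the pull-back of
  \<open>\<nabla> \<oplus> \<nabla>\<close>, hence flat.\<close>

section \<open>Calculus of smooth maps\<close>

text \<open>The arguments are chosen so that few unknowns survive. The curvature of \<open>G\<close>
  vanishes identically on three vertical lifts, which removes the \<alpha>1 term and the
  \<open>A\<close> term; at a point y = t X every R(y, X) is zero. Two vertical arguments also keep
  covariant derivatives of R out of the horizontal parts: differentiating along a fibre only
  replaces y by the direction of differentiation. The ray t X meets the zero section at t = 0, and
  that is where continuity of the 1-form is tested. Weak symmetry and flatness quantify over global
  fields, while the computation lives in charts. Hence connections and their curvature are treated
  once for an arbitrary chart metric and then used both for M and for TM. Two analytic tools come
  from this setting: Christoffel symbols are defined by a description operator, so their smoothness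
  is a statement about solutions of linear systems; and passing from \<open>flat\<close> to a
  vanishing curvature tensor requires global fields with prescribed values at a point, hence bump
  functions and the Hausdorff property.\<close>

abbreviation FD :: "('e::real_normed_vector \<Rightarrow> 'f::real_normed_vector) \<Rightarrow> 'e \<Rightarrow> 'e \<Rightarrow> 'f" where
  "FD f x \<equiv> frechet_derivative f (at x)"

lemma FD_unique: "(f has_derivative f') (at x) \<Longrightarrow> FD f x = f'"
  by (rule frechet_derivative_at[symmetric])

lemma FD_works: "f differentiable (at x) \<Longrightarrow> (f has_derivative FD f x) (at x)"
  by (simp add: frechet_derivative_works)

lemma linear_FD: "f differentiable (at x) \<Longrightarrow> linear (FD f x)"
  by (rule linear_frechet_derivative)

lemma has_derivative_cong_open:
  assumes "open S" "x \<in> S" "\<And>y. y \<in> S \<Longrightarrow> f y = g y"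
  shows "(f has_derivative f') (at x) \<longleftrightarrow> (g has_derivative f') (at x)"
proof
  assume "(f has_derivative f') (at x)"
  then show "(g has_derivative f') (at x)"
    by (rule has_derivative_transform_within_open[OF _ assms(1,2)]) (simp add: assms(3))
next
  assume "(g has_derivative f') (at x)"
  then show "(f has_derivative f') (at x)"
    by (rule has_derivative_transform_within_open[OF _ assms(1,2)]) (simp add: assms(3))
qed

lemma differentiable_cong_open:
  assumes "open S" "x \<in> S" "\<And>y. y \<in> S \<Longrightarrow> f y = g y"
  shows "f differentiable (at x) \<longleftrightarrow> g differentiable (at x)"
  unfolding differentiable_def by (simp add: has_derivative_cong_open[of S x f g, OF assms])

lemma FD_cong_open:
  assumes "open S" "x \<in> S" "\<And>y. y \<in> S \<Longrightarrow> f y = g y"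
  shows "FD f x = FD g x"
  unfolding frechet_derivative_def by (simp add: has_derivative_cong_open[of S x f g, OF assms])

lemma times_differentiable_on_cong:
  assumes "open S" "\<And>x. x \<in> S \<Longrightarrow> f x = g x"
  shows "times_differentiable_on k S f \<longleftrightarrow> times_differentiable_on k S g"
  using assms
proof (induction k arbitrary: f g)
  case 0
  then show ?case using continuous_on_cong[of S S f g] by simp
next
  case (Suc k)
  have "times_differentiable_on k S (\<lambda>x. FD f x v) \<longleftrightarrow> times_differentiable_on k S (\<lambda>x. FD g x v)" for v
    by (rule Suc.IH[OF Suc.prems(1)]) (rule fun_cong[OF FD_cong_open[OF Suc.prems(1) _ Suc.prems(2)]])
  then show ?case using Suc.prems differentiable_cong_open[of S _ f g] by auto
qed

lemma smooth_on_cong: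
  "open S \<Longrightarrow> (\<And>x. x \<in> S \<Longrightarrow> f x = g x) \<Longrightarrow> smooth_on S f \<longleftrightarrow> smooth_on S g"
  unfolding smooth_on_def using times_differentiable_on_cong by blast

lemma times_differentiable_on_Suc_imp:
  "times_differentiable_on (Suc k) S f \<Longrightarrow> times_differentiable_on k S f"
proof (induction k arbitrary: f)
  case 0
  then show ?case
    by (auto intro!: differentiable_imp_continuous_on differentiable_at_imp_differentiable_on)
next
  case (Suc k)
  then show ?case by auto
qed

lemma times_differentiable_on_Un:
  assumes "open S" "open T" "times_differentiable_on k S f" "times_differentiable_on k T f"
  shows "times_differentiable_on k (S \<union> T) f"
  using assms by (induction k arbitrary: f) (auto intro: continuous_on_open_Un)

lemma smooth_on_Un:
  "open S \<Longrightarrow> open T \<Longrightarrow> smooth_on S f \<Longrightarrow> smooth_on T f \<Longrightarrow> smooth_on (S \<union> T) f"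
  unfolding smooth_on_def using times_differentiable_on_Un by blast

lemma smooth_on_differentiable: "smooth_on S f \<Longrightarrow> x \<in> S \<Longrightarrow> f differentiable (at x)"
  unfolding smooth_on_def by (metis times_differentiable_on.simps(2))

lemma smooth_on_FD: "smooth_on S f \<Longrightarrow> smooth_on S (\<lambda>x. FD f x v)"
  unfolding smooth_on_def by (metis times_differentiable_on.simps(2))

lemma smooth_on_continuous: "smooth_on S f \<Longrightarrow> continuous_on S f"
  unfolding smooth_on_def by (metis times_differentiable_on.simps(1))

lemma times_differentiable_on_const: "times_differentiable_on k S (\<lambda>x. c)"
  by (induction k arbitrary: c) auto

lemma times_differentiable_on_linear:
  assumes "bounded_linear f" shows "times_differentiable_on k S f"
proof (cases k)
  case 0
  then show ?thesis using assms by (simp add: linear_continuous_on)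
next
  case (Suc n)
  have "FD f x = f" for x
    using bounded_linear_imp_has_derivative[OF assms] by (rule FD_unique)
  then show ?thesis
    using Suc assms by (simp add: times_differentiable_on_const bounded_linear_imp_differentiable)
qed

lemma times_differentiable_on_add:
  assumes "open S" "times_differentiable_on k S f" "times_differentiable_on k S g"
  shows "times_differentiable_on k S (\<lambda>x. f x + g x)"
  using assms
proof (induction k arbitrary: f g)
  case 0
  then show ?case by (simp add: continuous_on_add)
next
  case (Suc k)
  have "FD (\<lambda>x. f x + g x) x v = FD f x v + FD g x v" if "x \<in> S" for x v
    using Suc.prems that
    by (intro fun_cong[OF FD_unique] has_derivative_add FD_works) auto
  then have "times_differentiable_on k S (\<lambda>x. FD (\<lambda>x. f x + g x) x v)" for v
    using Suc.prems
    by (subst times_differentiable_on_cong[OF Suc.prems(1), where g = "\<lambda>x. FD f x v + FD g x v"])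
       (auto intro!: Suc.IH)
  then show ?case using Suc.prems by auto
qed

lemma times_differentiable_on_sum:
  assumes "open S" "\<And>i. i \<in> I \<Longrightarrow> times_differentiable_on k S (f i)"
  shows "times_differentiable_on k S (\<lambda>x. \<Sum>i\<in>I. f i x)"
  using assms(2)
  by (induction I rule: infinite_finite_induct)
     (auto intro: times_differentiable_on_const times_differentiable_on_add[OF assms(1)])

lemma times_differentiable_on_bilinear:
  assumes B: "bounded_bilinear B" and "open S"
    and "times_differentiable_on k S f" "times_differentiable_on k S g"
  shows "times_differentiable_on k S (\<lambda>x. B (f x) (g x))"
  using assms(2-)
proof (induction k arbitrary: f g)
  case 0
  then show ?case by (simp add: bounded_bilinear.continuous_on[OF B])
next
  case (Suc k)
  have fk: "times_differentiable_on k S f" and gk: "times_differentiable_on k S g"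
    using Suc.prems times_differentiable_on_Suc_imp by blast+
  have d: "((\<lambda>x. B (f x) (g x)) has_derivative (\<lambda>v. B (f x) (FD g x v) + B (FD f x v) (g x))) (at x)"
    if "x \<in> S" for x
    using Suc.prems that by (intro bounded_bilinear.FDERIV[OF B] FD_works) auto
  then have "times_differentiable_on k S (\<lambda>x. FD (\<lambda>x. B (f x) (g x)) x v)" for v
    using Suc.prems
    by (subst times_differentiable_on_cong[OF Suc.prems(1),
          where g = "\<lambda>x. B (f x) (FD g x v) + B (FD f x v) (g x)"])
       (auto intro!: Suc.IH times_differentiable_on_add fk gk simp: FD_unique[OF d])
  then show ?case using d by (auto simp: differentiable_def)
qed

lemma times_differentiable_on_bounded_linear:
  assumes B: "bounded_linear B" and "open S" and "times_differentiable_on k S f"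
  shows "times_differentiable_on k S (\<lambda>x. B (f x))"
  using assms(2-)
proof (induction k arbitrary: f)
  case 0
  then show ?case by (simp add: bounded_linear.continuous_on[OF B])
next
  case (Suc k)
  have d: "((\<lambda>x. B (f x)) has_derivative (\<lambda>v. B (FD f x v))) (at x)" if "x \<in> S" for x
    using Suc.prems that by (intro bounded_linear.has_derivative[OF B] FD_works) auto
  then have "times_differentiable_on k S (\<lambda>x. FD (\<lambda>x. B (f x)) x v)" for v
    using Suc.prems
    by (subst times_differentiable_on_cong[OF Suc.prems(1), where g = "\<lambda>x. B (FD f x v)"])
       (auto intro!: Suc.IH simp: FD_unique[OF d])
  then show ?case using d by (auto simp: differentiable_def)
qed

section \<open>Linear and bilinear maps that depend on a point\<close>

lemma linear_euclidean_expand: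
  fixes A :: "'a::euclidean_space \<Rightarrow> 'b::real_vector"
  assumes "linear A" shows "A w = (\<Sum>b\<in>Basis. (w \<bullet> b) *\<^sub>R A b)"
proof -
  have "A w = A (\<Sum>b\<in>Basis. (w \<bullet> b) *\<^sub>R b)" by (simp add: euclidean_representation)
  also have "\<dots> = (\<Sum>b\<in>Basis. (w \<bullet> b) *\<^sub>R A b)"
    using assms by (simp add: linear_sum linear_scale)
  finally show ?thesis .
qed

text \<open>Expanding \<open>f x\<close> in the standard basis turns the expression into a finite
  sum of products, so it suffices to control \<open>A x w\<close> for each fixed \<open>w\<close>;
  no norm on a space of linear maps enters. Metrics, Christoffel symbols, curvature and
  differentials are all handled as such families.\<close>

lemma times_differentiable_on_family:
  fixes f :: "'e::euclidean_space \<Rightarrow> 'b::euclidean_space"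
  assumes "open S" and lin: "\<And>x. x \<in> S \<Longrightarrow> linear (A x)"
    and A: "\<And>w. times_differentiable_on k S (\<lambda>x. A x w)" and f: "times_differentiable_on k S f"
  shows "times_differentiable_on k S (\<lambda>x. A x (f x))"
proof -
  have "times_differentiable_on k S (\<lambda>x. \<Sum>b\<in>Basis. (f x \<bullet> b) *\<^sub>R A x b)"
    by (intro times_differentiable_on_sum[OF assms(1)] A assms(1) f
        times_differentiable_on_bilinear[OF bounded_bilinear_scaleR]
        times_differentiable_on_bounded_linear[OF bounded_linear_inner_left])
  then show ?thesis
    using linear_euclidean_expand[OF lin] by (subst times_differentiable_on_cong[OF assms(1)]) auto
qed

lemma times_differentiable_on_compose:
  fixes g :: "'d::euclidean_space \<Rightarrow> 'e::euclidean_space"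
  assumes "open S" "g ` S \<subseteq> T" "times_differentiable_on k T f" "times_differentiable_on k S g"
  shows "times_differentiable_on k S (\<lambda>x. f (g x))"
  using assms(3,4)
proof (induction k arbitrary: f)
  case 0
  then show ?case using assms(2) by (auto intro: continuous_on_compose2)
next
  case (Suc k)
  have d: "((\<lambda>x. f (g x)) has_derivative (\<lambda>v. FD f (g x) (FD g x v))) (at x)" if "x \<in> S" for x
    using Suc.prems that assms(2) diff_chain_at[of g "FD g x" x f "FD f (g x)"]
    by (auto simp: frechet_derivative_works o_def image_subset_iff)
  \<comment> \<open>The chain rule gives a family of linear maps \<open>FD f (g x)\<close> applied
    to a moving vector; the induction hypothesis controls it for each fixed vector.\<close>
  have "times_differentiable_on k S (\<lambda>x. FD f (g x) (FD g x v))" for v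
  proof (rule times_differentiable_on_family[OF assms(1)])
    show "linear (FD f (g x))" if "x \<in> S" for x
      using Suc.prems that assms(2) by (intro linear_FD) auto
    show "times_differentiable_on k S (\<lambda>x. FD f (g x) w)" for w
      using Suc.prems by (intro Suc.IH times_differentiable_on_Suc_imp[OF Suc.prems(2)]) auto
  qed (use Suc.prems in auto)
  then have "times_differentiable_on k S (\<lambda>x. FD (\<lambda>x. f (g x)) x v)" for v
    by (subst times_differentiable_on_cong[OF assms(1), where g = "\<lambda>x. FD f (g x) (FD g x v)"])
       (auto simp: FD_unique[OF d])
  then show ?case using d by (auto simp: differentiable_def)
qed

lemma smooth_on_const [simp]: "smooth_on S (\<lambda>x. c)"
  by (simp add: smooth_on_def times_differentiable_on_const)

lemma smooth_on_linear: "bounded_linear f \<Longrightarrow> smooth_on S f"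
  by (simp add: smooth_on_def times_differentiable_on_linear)

lemma smooth_on_add: "open S \<Longrightarrow> smooth_on S f \<Longrightarrow> smooth_on S g \<Longrightarrow> smooth_on S (\<lambda>x. f x + g x)"
  by (simp add: smooth_on_def times_differentiable_on_add)

lemma smooth_on_sum:
  "open S \<Longrightarrow> (\<And>i. i \<in> I \<Longrightarrow> smooth_on S (f i)) \<Longrightarrow> smooth_on S (\<lambda>x. \<Sum>i\<in>I. f i x)"
  by (simp add: smooth_on_def times_differentiable_on_sum)

lemma smooth_on_bilinear:
  "bounded_bilinear B \<Longrightarrow> open S \<Longrightarrow> smooth_on S f \<Longrightarrow> smooth_on S g \<Longrightarrow> smooth_on S (\<lambda>x. B (f x) (g x))"
  by (simp add: smooth_on_def times_differentiable_on_bilinear)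

lemma smooth_on_bounded_linear:
  "bounded_linear B \<Longrightarrow> open S \<Longrightarrow> smooth_on S f \<Longrightarrow> smooth_on S (\<lambda>x. B (f x))"
  by (simp add: smooth_on_def times_differentiable_on_bounded_linear)

lemma smooth_on_scaleR:
  "open S \<Longrightarrow> smooth_on S f \<Longrightarrow> smooth_on S g \<Longrightarrow> smooth_on S (\<lambda>x. f x *\<^sub>R g x)"
  by (rule smooth_on_bilinear[OF bounded_bilinear_scaleR])

lemma smooth_on_mult:
  fixes f g :: "'e::euclidean_space \<Rightarrow> real"
  shows "open S \<Longrightarrow> smooth_on S f \<Longrightarrow> smooth_on S g \<Longrightarrow> smooth_on S (\<lambda>x. f x * g x)"
  by (rule smooth_on_bilinear[OF bounded_bilinear_mult])

lemma smooth_on_minus: "open S \<Longrightarrow> smooth_on S f \<Longrightarrow> smooth_on S (\<lambda>x. - f x)"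
  by (rule smooth_on_bounded_linear[OF bounded_linear_minus[OF bounded_linear_ident]])

lemma smooth_on_diff: "open S \<Longrightarrow> smooth_on S f \<Longrightarrow> smooth_on S g \<Longrightarrow> smooth_on S (\<lambda>x. f x - g x)"
  using smooth_on_add[of S f "\<lambda>x. - g x"] smooth_on_minus[of S g] by simp

lemma smooth_on_Pair:
  assumes "open S" "smooth_on S f" "smooth_on S g"
  shows "smooth_on S (\<lambda>x. (f x, g x))"
proof -
  have l: "bounded_linear (\<lambda>a. (a, 0))" "bounded_linear (\<lambda>a. (0, a))"
    by (intro bounded_linear_Pair bounded_linear_ident bounded_linear_zero)+
  show ?thesis
    using smooth_on_add[OF assms(1) smooth_on_bounded_linear[OF l(1) assms(1,2)]
        smooth_on_bounded_linear[OF l(2) assms(1,3)]] by simp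
qed

lemma smooth_on_family:
  fixes f :: "'e::euclidean_space \<Rightarrow> 'b::euclidean_space"
  assumes "open S" "\<And>x. x \<in> S \<Longrightarrow> linear (A x)" "\<And>w. smooth_on S (\<lambda>x. A x w)" "smooth_on S f"
  shows "smooth_on S (\<lambda>x. A x (f x))"
  using assms unfolding smooth_on_def by (blast intro: times_differentiable_on_family)

lemma smooth_on_family2:
  fixes f :: "'e::euclidean_space \<Rightarrow> 'b::euclidean_space" and h :: "'e \<Rightarrow> 'c::euclidean_space"
  assumes "open S" "\<And>x. x \<in> S \<Longrightarrow> bilinear (B x)" "\<And>u w. smooth_on S (\<lambda>x. B x u w)"
    "smooth_on S f" "smooth_on S h"
  shows "smooth_on S (\<lambda>x. B x (f x) (h x))"
proof (rule smooth_on_family[OF assms(1) _ _ assms(5)])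
  show "linear (B x (f x))" if "x \<in> S" for x using assms(2)[OF that] by (simp add: bilinear_def)
  show "smooth_on S (\<lambda>x. B x (f x) w)" for w
    by (rule smooth_on_family[OF assms(1) _ _ assms(4)]) (use assms(2,3) in \<open>auto simp: bilinear_def\<close>)
qed

lemma smooth_on_compose:
  fixes g :: "'d::euclidean_space \<Rightarrow> 'e::euclidean_space"
  assumes "open S" "g ` S \<subseteq> T" "smooth_on T f" "smooth_on S g"
  shows "smooth_on S (\<lambda>x. f (g x))"
  using assms unfolding smooth_on_def by (blast intro: times_differentiable_on_compose)

text \<open>The Leibniz rule with the argument frozen at \<open>f x\<close> in the first summand; it
  follows from the basis expansion, differentiated term by term.\<close>

lemma has_derivative_family:
  fixes f :: "'e::real_normed_vector \<Rightarrow> 'b::euclidean_space"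
  assumes S: "open S" "x \<in> S" and lin: "\<And>z. z \<in> S \<Longrightarrow> linear (A z)"
    and A: "\<And>w. (\<lambda>z. A z w) differentiable (at x)" and f: "f differentiable (at x)"
  shows "((\<lambda>z. A z (f z)) has_derivative (\<lambda>v. FD (\<lambda>z. A z (f x)) x v + A x (FD f x v))) (at x)"
proof -
  have d: "((\<lambda>z. \<Sum>b\<in>Basis. (f z \<bullet> b) *\<^sub>R A z b) has_derivative
      (\<lambda>v. \<Sum>b\<in>Basis. (f x \<bullet> b) *\<^sub>R FD (\<lambda>z. A z b) x v + (FD f x v \<bullet> b) *\<^sub>R A x b)) (at x)"
    by (intro has_derivative_sum has_derivative_scaleR has_derivative_inner_left FD_works A f)
  have c: "((\<lambda>z. \<Sum>b\<in>Basis. (f x \<bullet> b) *\<^sub>R A z b) has_derivative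
      (\<lambda>v. \<Sum>b\<in>Basis. (f x \<bullet> b) *\<^sub>R FD (\<lambda>z. A z b) x v)) (at x)"
    by (intro has_derivative_sum has_derivative_scaleR_right FD_works A)
  have e: "FD (\<lambda>z. A z (f x)) x = (\<lambda>v. \<Sum>b\<in>Basis. (f x \<bullet> b) *\<^sub>R FD (\<lambda>z. A z b) x v)"
    using linear_euclidean_expand[OF lin]
    by (intro FD_unique has_derivative_transform_within_open[OF c S]) metis
  have "((\<lambda>z. A z (f z)) has_derivative
      (\<lambda>v. \<Sum>b\<in>Basis. (f x \<bullet> b) *\<^sub>R FD (\<lambda>z. A z b) x v + (FD f x v \<bullet> b) *\<^sub>R A x b)) (at x)"
    using linear_euclidean_expand[OF lin]
    by (intro has_derivative_transform_within_open[OF d S]) metis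
  moreover have "A x (FD f x v) = (\<Sum>b\<in>Basis. (FD f x v \<bullet> b) *\<^sub>R A x b)" for v
    using linear_euclidean_expand[OF lin[OF S(2)]] .
  ultimately show ?thesis by (simp add: e sum.distrib)
qed

lemma has_derivative_family2:
  fixes f :: "'e::real_normed_vector \<Rightarrow> 'b::euclidean_space" and h :: "'e \<Rightarrow> 'c::euclidean_space"
  assumes S: "open S" "x \<in> S" and bil: "\<And>z. z \<in> S \<Longrightarrow> bilinear (B z)"
    and B: "\<And>u w. (\<lambda>z. B z u w) differentiable (at x)"
    and f: "f differentiable (at x)" and h: "h differentiable (at x)"
  shows "((\<lambda>z. B z (f z) (h z)) has_derivative
     (\<lambda>v. FD (\<lambda>z. B z (f x) (h x)) x v + B x (FD f x v) (h x) + B x (f x) (FD h x v))) (at x)"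
proof -
  have 1: "((\<lambda>z. B z u (h z)) has_derivative (\<lambda>v. FD (\<lambda>z. B z u (h x)) x v + B x u (FD h x v))) (at x)" for u
    using bil by (intro has_derivative_family[OF S _ B h]) (simp add: bilinear_def)
  have "((\<lambda>z. (\<lambda>u. B z u (h z)) (f z)) has_derivative
      (\<lambda>v. FD (\<lambda>z. B z (f x) (h z)) x v + B x (FD f x v) (h x))) (at x)"
    using bil by (intro has_derivative_family[OF S _ differentiableI[OF 1] f]) (auto simp: bilinear_def)
  then show ?thesis by (simp add: FD_unique[OF 1] add_ac)
qed

lemma linear_FD_family:
  assumes S: "open S" "x \<in> S" and lin: "\<And>z. z \<in> S \<Longrightarrow> linear (A z)"
    and A: "\<And>w. (\<lambda>z. A z w) differentiable (at x)"
  shows "linear (\<lambda>w. FD (\<lambda>z. A z w) x v)"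
proof (rule linearI)
  fix w w' and r :: real
  have "((\<lambda>z. A z (w + w')) has_derivative (\<lambda>v. FD (\<lambda>z. A z w) x v + FD (\<lambda>z. A z w') x v)) (at x)"
    by (rule has_derivative_transform_within_open[OF has_derivative_add[OF FD_works FD_works] S])
       (auto simp: A linear_add[OF lin])
  from FD_unique[OF this]
  show "FD (\<lambda>z. A z (w + w')) x v = FD (\<lambda>z. A z w) x v + FD (\<lambda>z. A z w') x v" by simp
  have "((\<lambda>z. A z (r *\<^sub>R w)) has_derivative (\<lambda>v. r *\<^sub>R FD (\<lambda>z. A z w) x v)) (at x)"
    by (rule has_derivative_transform_within_open[OF has_derivative_scaleR_right[OF FD_works] S])
       (auto simp: A linear_scale[OF lin])
  from FD_unique[OF this]
  show "FD (\<lambda>z. A z (r *\<^sub>R w)) x v = r *\<^sub>R FD (\<lambda>z. A z w) x v" by simp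
qed

subsection \<open>Solutions of linear systems with smooth coefficients\<close>

text \<open>An injective linear map is bounded below, and by continuity of the coefficients the
  bound survives near \<open>x\<close> with half the constant. The increment of \<open>w\<close> is
  then dominated by the residual \<open>F z - A z (w x)\<close>, which tends to 0.\<close>

lemma isCont_linear_solution:
  fixes A :: "'e::real_normed_vector \<Rightarrow> 'b::euclidean_space \<Rightarrow> 'b"
  assumes S: "open S" "x \<in> S" and lin: "\<And>z. z \<in> S \<Longrightarrow> linear (A z)" and inj: "inj (A x)"
    and A: "\<And>b. isCont (\<lambda>z. A z b) x" and F: "isCont F x"
    and eq: "\<And>z. z \<in> S \<Longrightarrow> A z (w z) = F z"
  shows "isCont w x"
proof -
  obtain c where c: "c > 0" "\<And>v. c * norm v \<le> norm (A x v)"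
    using linear_inj_bounded_below_pos[OF lin[OF S(2)] inj] by (metis mult.commute)
  define e where "e z = (\<Sum>b\<in>Basis. norm (A z b - A x b))" for z
  have "(e \<longlongrightarrow> (\<Sum>b\<in>(Basis::'b set). norm (A x b - A x b))) (at x)"
    unfolding e_def using A by (intro tendsto_intros) (auto simp: isCont_def)
  then have "(e \<longlongrightarrow> 0) (at x)" by simp
  then have ev: "\<forall>\<^sub>F z in at x. e z < c / 2" using c(1) by (intro order_tendstoD(2)) auto
  have diff: "norm (A z v - A x v) \<le> norm v * e z" if "z \<in> S" for z v
  proof -
    have "A z v - A x v = (\<Sum>b\<in>Basis. (v \<bullet> b) *\<^sub>R (A z b - A x b))"
      using linear_euclidean_expand[OF lin[OF that], of v] linear_euclidean_expand[OF lin[OF S(2)], of v]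
      by (simp add: scaleR_diff_right sum_subtractf)
    also have "norm \<dots> \<le> (\<Sum>b\<in>Basis. norm v * norm (A z b - A x b))"
      by (intro order_trans[OF norm_sum] sum_mono) (simp add: mult_right_mono Basis_le_norm)
    finally show ?thesis by (simp add: e_def sum_distrib_left)
  qed
  have "\<forall>\<^sub>F z in at x. z \<in> S" using S by (simp add: eventually_at_in_open')
  with ev have "\<forall>\<^sub>F z in at x. norm (w z - w x) \<le> (2 / c) * norm (F z - A z (w x))"
  proof eventually_elim
    case (elim z)
    let ?v = "w z - w x"
    have "norm ?v * e z \<le> norm ?v * (c / 2)" using elim by (intro mult_left_mono) auto
    then have "c * norm ?v \<le> norm (A z ?v) + c / 2 * norm ?v"
      using c(2)[of ?v] diff[OF elim(2), of ?v] norm_triangle_sub[of "A x ?v" "A z ?v"]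
      by (simp add: norm_minus_commute algebra_simps)
    moreover have "A z ?v = F z - A z (w x)"
      using eq[OF elim(2)] linear_diff[OF lin[OF elim(2)]] by simp
    ultimately show ?case using c(1) by (simp add: field_simps)
  qed
  moreover have "((\<lambda>z. (2 / c) * norm (F z - A z (w x))) \<longlongrightarrow> (2 / c) * norm (F x - A x (w x))) (at x)"
    using A F by (intro tendsto_intros) (auto simp: isCont_def)
  then have "((\<lambda>z. (2 / c) * norm (F z - A z (w x))) \<longlongrightarrow> 0) (at x)"
    using eq[OF S(2)] by simp
  ultimately have "((\<lambda>z. w z - w x) \<longlongrightarrow> 0) (at x)" by (rule Lim_null_comparison)
  then show ?thesis by (simp add: isCont_def LIM_zero_iff)
qed

text \<open>A product rule for a factor \<open>c\<close> that is merely continuous; this is enough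
  because the other factor vanishes at \<open>x\<close>. It breaks a circle below, where the
  solution \<open>w\<close> is known to be continuous but not yet differentiable.\<close>

lemma has_derivative_isCont_scaleR:
  assumes a: "(a has_derivative a') (at x)" and a0: "a x = 0" and c: "isCont c x"
  shows "((\<lambda>z. c z *\<^sub>R a z) has_derivative (\<lambda>v. c x *\<^sub>R a' v)) (at x)"
  unfolding has_derivative_iff_norm
proof (intro conjI)
  have bl: "bounded_linear a'" using a by (rule has_derivative_bounded_linear)
  then show "bounded_linear (\<lambda>v. c x *\<^sub>R a' v)" by (rule bounded_linear_const_scaleR)
  obtain K where K: "\<And>v. norm (a' v) \<le> norm v * K" using bounded_linear.bounded[OF bl] by blast
  have bound: "norm (norm (c y *\<^sub>R a y - c x *\<^sub>R a x - c x *\<^sub>R a' (y - x)) / norm (y - x))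
      \<le> \<bar>c y\<bar> * (norm (a y - a x - a' (y - x)) / norm (y - x)) + \<bar>c y - c x\<bar> * K" if "y \<noteq> x" for y
  proof -
    have "c y *\<^sub>R a y - c x *\<^sub>R a x - c x *\<^sub>R a' (y - x) =
        c y *\<^sub>R (a y - a x - a' (y - x)) + (c y - c x) *\<^sub>R a' (y - x)"
      by (simp add: a0 algebra_simps)
    also have "norm \<dots> \<le> \<bar>c y\<bar> * norm (a y - a x - a' (y - x)) + \<bar>c y - c x\<bar> * (norm (y - x) * K)"
      by (intro order_trans[OF norm_triangle_ineq] add_mono) (simp_all add: K mult_left_mono)
    finally show ?thesis using that by (simp add: divide_simps algebra_simps)
  qed
  have "\<forall>\<^sub>F y in at x. norm (norm (c y *\<^sub>R a y - c x *\<^sub>R a x - c x *\<^sub>R a' (y - x)) / norm (y - x))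
      \<le> \<bar>c y\<bar> * (norm (a y - a x - a' (y - x)) / norm (y - x)) + \<bar>c y - c x\<bar> * K"
    using bound unfolding eventually_at_filter by (intro always_eventually) blast
  moreover have "((\<lambda>y. \<bar>c y\<bar> * (norm (a y - a x - a' (y - x)) / norm (y - x)) + \<bar>c y - c x\<bar> * K)
      \<longlongrightarrow> \<bar>c x\<bar> * 0 + \<bar>c x - c x\<bar> * K) (at x)"
    using a c unfolding has_derivative_iff_norm isCont_def by (intro tendsto_intros) auto
  then have "((\<lambda>y. \<bar>c y\<bar> * (norm (a y - a x - a' (y - x)) / norm (y - x)) + \<bar>c y - c x\<bar> * K) \<longlongrightarrow> 0) (at x)"
    by simp
  ultimately show "((\<lambda>y. norm (c y *\<^sub>R a y - c x *\<^sub>R a x - c x *\<^sub>R a' (y - x)) / norm (y - x)) \<longlongrightarrow> 0) (at x)"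
    by (rule Lim_null_comparison)
qed

text \<open>With \<open>L\<close> a fixed left inverse of \<open>A x\<close>, the equation becomes w
  z = w x + L (F z - F x - (A z - A x) (w z)). The unknown on the right is multiplied by a factor
  vanishing at \<open>x\<close>, so continuity of \<open>w\<close> already makes the right-hand side
  differentiable.\<close>

lemma differentiable_linear_solution:
  fixes A :: "'e::real_normed_vector \<Rightarrow> 'b::euclidean_space \<Rightarrow> 'b"
  assumes S: "open S" "x \<in> S" and lin: "\<And>z. z \<in> S \<Longrightarrow> linear (A z)" and inj: "inj (A x)"
    and A: "\<And>b. (\<lambda>z. A z b) differentiable (at x)" and F: "F differentiable (at x)"
    and eq: "\<And>z. z \<in> S \<Longrightarrow> A z (w z) = F z"
  shows "w differentiable (at x)"
proof -
  have cont: "isCont w x"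
  proof (rule isCont_linear_solution[where A = A and F = F, OF S lin inj])
    show "isCont (\<lambda>z. A z b) x" for b by (rule differentiable_imp_continuous_within[OF A])
    show "isCont F x" by (rule differentiable_imp_continuous_within[OF F])
  qed (auto intro: eq)
  obtain L where L: "linear L" "\<And>v. L (A x v) = v"
    using linear_injective_left_inverse[OF lin[OF S(2)] inj] by (metis comp_apply id_apply)
  let ?H = "\<lambda>z. F z - F x - (\<Sum>b\<in>Basis. (w z \<bullet> b) *\<^sub>R (A z b - A x b))"
  have "((\<lambda>z. (w z \<bullet> b) *\<^sub>R (A z b - A x b)) has_derivative
      (\<lambda>v. (w x \<bullet> b) *\<^sub>R (FD (\<lambda>z. A z b) x v - 0))) (at x)" for b
    using cont
    by (intro has_derivative_isCont_scaleR has_derivative_diff[OF FD_works[OF A] has_derivative_const])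
      (auto intro!: continuous_intros)
  then have "(?H has_derivative (\<lambda>v. FD F x v - 0
      - (\<Sum>b\<in>Basis. (w x \<bullet> b) *\<^sub>R (FD (\<lambda>z. A z b) x v - 0)))) (at x)"
    by (intro has_derivative_diff has_derivative_sum has_derivative_const FD_works F)
  then have H: "?H differentiable (at x)" unfolding differentiable_def by blast
  have "w z = w x + L (?H z)" if "z \<in> S" for z
  proof -
    have "A x (w z - w x) = A x (w z) - F x"
      using eq[OF S(2)] linear_diff[OF lin[OF S(2)]] by simp
    also have "\<dots> = ?H z"
      using eq[OF that] linear_euclidean_expand[OF lin[OF that], of "w z"]
        linear_euclidean_expand[OF lin[OF S(2)], of "w z"]
      by (simp add: scaleR_diff_right sum_subtractf)
    finally show ?thesis using L(2)[of "w z - w x"] by simp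
  qed
  then have "(\<lambda>z. w x + L (?H z)) differentiable (at x) \<longleftrightarrow> w differentiable (at x)"
    by (intro differentiable_cong_open[OF S]) simp
  moreover have "(\<lambda>z. w x + L (?H z)) differentiable (at x)"
  proof (rule differentiable_add[OF differentiable_const])
    show "(\<lambda>z. L (?H z)) differentiable (at x)"
      using H bounded_linear.has_derivative[OF linear_conv_bounded_linear[THEN iffD1, OF L(1)]]
      unfolding differentiable_def by blast
  qed
  ultimately show ?thesis by blast
qed

text \<open>Differentiating the system shows that a derivative of the solution solves a system with
  the same \<open>A\<close> and a new right-hand side. The induction therefore runs over all pairs
  \<open>w\<close>, \<open>F\<close> at once.\<close>

lemma smooth_on_linear_solution:
  fixes A :: "'e::euclidean_space \<Rightarrow> 'b::euclidean_space \<Rightarrow> 'b"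
  assumes S: "open S" and lin: "\<And>z. z \<in> S \<Longrightarrow> linear (A z)" and inj: "\<And>z. z \<in> S \<Longrightarrow> inj (A z)"
    and A: "\<And>b. smooth_on S (\<lambda>z. A z b)" and F: "smooth_on S F"
    and eq: "\<And>z. z \<in> S \<Longrightarrow> A z (w z) = F z"
  shows "smooth_on S w"
proof -
  have "times_differentiable_on k S w"
    if "times_differentiable_on k S F" "\<And>z. z \<in> S \<Longrightarrow> A z (w z) = F z" for k w F
    using that
  proof (induction k arbitrary: w F)
    case 0
    have "isCont w x" if "x \<in> S" for x
    proof (rule isCont_linear_solution[where A = A and F = F, OF S that lin inj[OF that]])
      show "isCont (\<lambda>z. A z b) x" for b
        using smooth_on_continuous[OF A] that S by (simp add: continuous_on_eq_continuous_at)
      show "isCont F x" using 0(1) that S by (simp add: continuous_on_eq_continuous_at)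
    qed (auto intro: 0(2))
    then show ?case by (simp add: continuous_at_imp_continuous_on)
  next
    case (Suc k)
    have d: "w differentiable (at x)" if "x \<in> S" for x
    proof (rule differentiable_linear_solution[where A = A and F = F, OF S that lin inj[OF that]])
      show "(\<lambda>z. A z b) differentiable (at x)" for b by (rule smooth_on_differentiable[OF A that])
      show "F differentiable (at x)" using Suc.prems(1) that by simp
    qed (auto intro: Suc.prems(2))
    have wk: "times_differentiable_on k S w"
      by (rule Suc.IH[OF times_differentiable_on_Suc_imp[OF Suc.prems(1)] Suc.prems(2)])
    have Ad: "(\<lambda>z. A z b) differentiable (at x)" if "x \<in> S" for b x
      by (rule smooth_on_differentiable[OF A that])
    have "times_differentiable_on k S (\<lambda>x. FD w x v)" for v
    proof (rule Suc.IH)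
      have 1: "times_differentiable_on k S (\<lambda>x. FD (\<lambda>z. A z (w x)) x v)"
      proof (rule times_differentiable_on_family[OF S _ _ wk])
        show "linear (\<lambda>b. FD (\<lambda>z. A z b) x v)" if "x \<in> S" for x
          by (rule linear_FD_family[OF S that lin Ad[OF that]])
        show "times_differentiable_on k S (\<lambda>x. FD (\<lambda>z. A z b) x v)" for b
          using smooth_on_FD[OF A] by (simp add: smooth_on_def)
      qed
      show "times_differentiable_on k S (\<lambda>x. FD F x v + (- 1) *\<^sub>R FD (\<lambda>z. A z (w x)) x v)"
        using Suc.prems(1)
        by (intro times_differentiable_on_add[OF S] 1 times_differentiable_on_bounded_linear[OF bounded_linear_scaleR_right S])
          auto
      fix x assume x: "x \<in> S"
      have "((\<lambda>z. A z (w z)) has_derivative (\<lambda>v. FD (\<lambda>z. A z (w x)) x v + A x (FD w x v))) (at x)"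
        by (rule has_derivative_family[OF S x lin Ad[OF x] d[OF x]])
      moreover have "FD (\<lambda>z. A z (w z)) x = FD F x"
        by (rule FD_cong_open[OF S x Suc.prems(2)])
      ultimately have "FD F x = (\<lambda>v. FD (\<lambda>z. A z (w x)) x v + A x (FD w x v))"
        by (simp add: FD_unique)
      then show "A x (FD w x v) = FD F x v + (- 1) *\<^sub>R FD (\<lambda>z. A z (w x)) x v"
        by simp
    qed
    then show ?case using d by simp
  qed
  then show ?thesis using F eq unfolding smooth_on_def by blast
qed

subsection \<open>Symmetry of second derivatives\<close>

text \<open>Two applications of the mean value theorem: first along \<open>u\<close> to the
  difference of \<open>f\<close> on two parallel segments, then along \<open>v\<close> to
  \<open>FD f z u\<close>.\<close>

lemma second_difference_mean_value:
  fixes f :: "'e::real_normed_vector \<Rightarrow> real"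
  assumes s: "s > 0"
    and S: "\<And>t t'. 0 \<le> t \<Longrightarrow> t \<le> s \<Longrightarrow> 0 \<le> t' \<Longrightarrow> t' \<le> s \<Longrightarrow> x + t *\<^sub>R u + t' *\<^sub>R v \<in> S"
    and f: "\<And>z. z \<in> S \<Longrightarrow> f differentiable (at z)"
    and f': "\<And>z. z \<in> S \<Longrightarrow> (\<lambda>z. FD f z u) differentiable (at z)"
  obtains t t' where "0 \<le> t" "t \<le> s" "0 \<le> t'" "t' \<le> s"
    "f (x + s *\<^sub>R u + s *\<^sub>R v) - f (x + s *\<^sub>R u) - f (x + s *\<^sub>R v) + f x
     = s * s * FD (\<lambda>z. FD f z u) (x + t *\<^sub>R u + t' *\<^sub>R v) v"
proof -
  have line: "((\<lambda>t. h (y + t *\<^sub>R w)) has_real_derivative FD h (y + t *\<^sub>R w) w) (at t)"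
    if "h differentiable (at (y + t *\<^sub>R w))" for h :: "'e \<Rightarrow> real" and y w t
  proof -
    have "((\<lambda>t. y + t *\<^sub>R w) has_derivative (\<lambda>r. r *\<^sub>R w)) (at t)"
      by (auto intro!: derivative_eq_intros)
    from diff_chain_at[OF this FD_works[OF that]]
    have "((\<lambda>t. h (y + t *\<^sub>R w)) has_derivative (\<lambda>r. FD h (y + t *\<^sub>R w) (r *\<^sub>R w))) (at t)"
      by (simp add: o_def)
    then show ?thesis
      using linear_scale[OF linear_FD[OF that]]
      by (simp add: has_field_derivative_def mult.commute[of _ "FD h (y + t *\<^sub>R w) w"])
  qed
  have S': "x + s *\<^sub>R v + t *\<^sub>R u \<in> S" "x + t *\<^sub>R u \<in> S" if "0 \<le> t" "t \<le> s" for t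
    using S[of t s] S[of t 0] that s by (simp_all add: add_ac)
  have "\<exists>t>0. t < s \<and> (f (x + s *\<^sub>R v + s *\<^sub>R u) - f (x + s *\<^sub>R u)) - (f (x + s *\<^sub>R v + 0 *\<^sub>R u) - f (x + 0 *\<^sub>R u))
      = (s - 0) * (FD f (x + s *\<^sub>R v + t *\<^sub>R u) u - FD f (x + t *\<^sub>R u) u)"
    using s S' f
    by (intro MVT2[where f = "\<lambda>t. f (x + s *\<^sub>R v + t *\<^sub>R u) - f (x + t *\<^sub>R u)"] DERIV_diff line) auto
  then obtain t where t: "0 < t" "t < s" "f (x + s *\<^sub>R v + s *\<^sub>R u) - f (x + s *\<^sub>R u) - f (x + s *\<^sub>R v) + f x
      = s * (FD f (x + s *\<^sub>R v + t *\<^sub>R u) u - FD f (x + t *\<^sub>R u) u)"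
    by (auto simp: algebra_simps)
  have "\<exists>t'>0. t' < s \<and> FD f (x + t *\<^sub>R u + s *\<^sub>R v) u - FD f (x + t *\<^sub>R u + 0 *\<^sub>R v) u
      = (s - 0) * FD (\<lambda>z. FD f z u) (x + t *\<^sub>R u + t' *\<^sub>R v) v"
    using s S[of t] f' t by (intro MVT2[where f = "\<lambda>t'. FD f (x + t *\<^sub>R u + t' *\<^sub>R v) u"] line) auto
  then obtain t' where "0 < t'" "t' < s" "FD f (x + t *\<^sub>R u + s *\<^sub>R v) u - FD f (x + t *\<^sub>R u) u
      = s * FD (\<lambda>z. FD f z u) (x + t *\<^sub>R u + t' *\<^sub>R v) v" by auto
  then show ?thesis using t by (intro that[of t t']) (auto simp: add_ac)
qed

text \<open>The second difference is symmetric in \<open>u\<close> and \<open>v\<close>, so the mean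
  value form expresses it by either mixed derivative near \<open>x\<close>; continuity of both then
  excludes a gap at \<open>x\<close>.\<close>

lemma FD_FD_sym_real:
  fixes f :: "'e::euclidean_space \<Rightarrow> real"
  assumes S: "open S" "x \<in> S" and f: "times_differentiable_on 2 S f"
  shows "FD (\<lambda>z. FD f z u) x v = FD (\<lambda>z. FD f z v) x u"
proof (rule ccontr)
  let ?a = "\<lambda>z. FD (\<lambda>z. FD f z u) z v" and ?b = "\<lambda>z. FD (\<lambda>z. FD f z v) z u"
  assume ne: "?a x \<noteq> ?b x"
  define e where "e = \<bar>?a x - ?b x\<bar> / 2"
  have e: "e > 0" using ne by (simp add: e_def)
  have f1: "f differentiable (at z)" and f2: "(\<lambda>z. FD f z w) differentiable (at z)" if "z \<in> S" for z w
    using f that by (auto simp: numeral_2_eq_2)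
  have "continuous_on S ?a" "continuous_on S ?b" using f by (auto simp: numeral_2_eq_2)
  then have ca: "isCont ?a x" and cb: "isCont ?b x" using S by (auto simp: continuous_on_eq_continuous_at)
  have "\<forall>\<^sub>F z in nhds x. dist (?a z) (?a x) < e" "\<forall>\<^sub>F z in nhds x. dist (?b z) (?b x) < e"
    using tendstoD[OF ca[unfolded isCont_def tendsto_at_iff_tendsto_nhds[of ?a x]] e]
      tendstoD[OF cb[unfolded isCont_def tendsto_at_iff_tendsto_nhds[of ?b x]] e] by auto
  moreover have "\<forall>\<^sub>F z in nhds x. z \<in> S" using S by (auto simp: eventually_nhds)
  ultimately have "\<forall>\<^sub>F z in nhds x. z \<in> S \<and> dist (?a z) (?a x) < e \<and> dist (?b z) (?b x) < e"
    by eventually_elim auto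
  then obtain d where d: "d > 0" "\<And>z. dist z x < d \<Longrightarrow> z \<in> S \<and> dist (?a z) (?a x) < e \<and> dist (?b z) (?b x) < e"
    by (auto simp: eventually_nhds_metric)
  \<comment> \<open>Small enough that the parallelogram spanned by \<open>s *\<^sub>R u\<close> and
    \<open>s *\<^sub>R v\<close> stays in the \<open>d\<close>-ball; the summand 1 keeps the
    denominator positive when both vectors are 0.\<close>
  define s where "s = d / (norm u + norm v + 1)"
  have s: "s > 0" using d(1) by (simp add: s_def add_nonneg_pos)
  have near: "dist (x + t *\<^sub>R w + t' *\<^sub>R w') x < d"
    if "0 \<le> t" "t \<le> s" "0 \<le> t'" "t' \<le> s" "norm w + norm w' = norm u + norm v" for t t' w w'
  proof -
    have "dist (x + t *\<^sub>R w + t' *\<^sub>R w') x = norm (t *\<^sub>R w + t' *\<^sub>R w')" by (simp add: dist_norm)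
    also have "\<dots> \<le> t * norm w + t' * norm w'" using that norm_triangle_ineq[of "t *\<^sub>R w" "t' *\<^sub>R w'"] by simp
    also have "\<dots> \<le> s * norm w + s * norm w'" using that by (intro add_mono mult_right_mono) auto
    also have "\<dots> = s * (norm u + norm v)" using that(5) by (simp add: distrib_left[symmetric])
    also have "\<dots> < s * (norm u + norm v + 1)" using s by simp
    also have "\<dots> = d" by (simp add: s_def add_nonneg_pos less_imp_neq[symmetric])
    finally show ?thesis .
  qed
  obtain t t' where t: "0 \<le> t" "t \<le> s" "0 \<le> t'" "t' \<le> s"
    "f (x + s *\<^sub>R u + s *\<^sub>R v) - f (x + s *\<^sub>R u) - f (x + s *\<^sub>R v) + f x = s * s * ?a (x + t *\<^sub>R u + t' *\<^sub>R v)"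
    by (rule second_difference_mean_value[OF s, of x u v S f]) (use d near f1 f2 in auto)
  obtain r r' where r: "0 \<le> r" "r \<le> s" "0 \<le> r'" "r' \<le> s"
    "f (x + s *\<^sub>R v + s *\<^sub>R u) - f (x + s *\<^sub>R v) - f (x + s *\<^sub>R u) + f x = s * s * ?b (x + r *\<^sub>R v + r' *\<^sub>R u)"
    by (rule second_difference_mean_value[OF s, of x v u S f]) (use d near f1 f2 in \<open>auto simp: add.commute\<close>)
  have "s * s * ?a (x + t *\<^sub>R u + t' *\<^sub>R v) = s * s * ?b (x + r *\<^sub>R v + r' *\<^sub>R u)"
    using t(5) r(5) by (simp add: algebra_simps)
  then have "?a (x + t *\<^sub>R u + t' *\<^sub>R v) = ?b (x + r *\<^sub>R v + r' *\<^sub>R u)" using s by simp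
  moreover have "dist (?a (x + t *\<^sub>R u + t' *\<^sub>R v)) (?a x) < e" using d(2) near t by auto
  moreover have "dist (?b (x + r *\<^sub>R v + r' *\<^sub>R u)) (?b x) < e" using d(2) near r by (auto simp: add.commute)
  ultimately have "dist (?a x) (?b x) < e + e"
    using dist_triangle3[of "?a x" "?b x" "?b (x + r *\<^sub>R v + r' *\<^sub>R u)"] by simp
  then show False by (simp add: e_def dist_real_def)
qed

lemma FD_bounded_linear:
  assumes "bounded_linear L" "f differentiable (at x)"
  shows "FD (\<lambda>z. L (f z)) x v = L (FD f x v)"
  using FD_unique[OF bounded_linear.has_derivative[OF assms(1) FD_works[OF assms(2)]]] by simp

lemma FD_FD_sym:
  fixes f :: "'e::euclidean_space \<Rightarrow> 'f::euclidean_space"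
  assumes S: "open S" "x \<in> S" and f: "times_differentiable_on 2 S f"
  shows "FD (\<lambda>z. FD f z u) x v = FD (\<lambda>z. FD f z v) x u"
proof (rule euclidean_eqI)
  fix b :: 'f assume "b \<in> Basis"
  have f1: "f differentiable (at z)" and f2: "(\<lambda>z. FD f z w) differentiable (at z)" if "z \<in> S" for z w
    using f that by (auto simp: numeral_2_eq_2)
  have c: "FD (\<lambda>z. FD (\<lambda>z. f z \<bullet> b) z u) x v = FD (\<lambda>z. FD f z u) x v \<bullet> b" for u v
  proof -
    have "FD (\<lambda>z. FD (\<lambda>z. f z \<bullet> b) z u) x = FD (\<lambda>z. FD f z u \<bullet> b) x"
      using FD_bounded_linear[OF bounded_linear_inner_left f1] by (intro FD_cong_open[OF S]) auto
    then show ?thesis using FD_bounded_linear[OF bounded_linear_inner_left f2[OF S(2)]] by simp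
  qed
  have "times_differentiable_on 2 S (\<lambda>z. f z \<bullet> b)"
    by (rule times_differentiable_on_bounded_linear[OF bounded_linear_inner_left S(1) f])
  from FD_FD_sym_real[OF S this, of u v]
  show "FD (\<lambda>z. FD f z u) x v \<bullet> b = FD (\<lambda>z. FD f z v) x u \<bullet> b" by (simp add: c)
qed

subsection \<open>Bump functions\<close>

text \<open>\<open>flat_exp 0\<close> is the standard smooth function that is flat at 0. The powers
  of 1/t are included so that derivatives remain linear combinations of members of the
  family.\<close>

definition flat_exp :: "nat \<Rightarrow> real \<Rightarrow> real" where
  "flat_exp n t = (if t > 0 then (1 / t) ^ n * exp (- (1 / t)) else 0)"

text \<open>With s = 1/t this is exp s \<ge> (1 + s/(n+1))^(n+1) \<ge> (s/(n+1))^(n+1); taking the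
  exponent n+1 rather than n leaves one factor t to spare.\<close>

lemma abs_flat_exp_le: "\<bar>flat_exp n t\<bar> \<le> real (Suc n) ^ Suc n * \<bar>t\<bar>"
proof (cases "t > 0")
  case True
  have "(1 / t) ^ Suc n / real (Suc n) ^ Suc n \<le> (1 + (1 / t) / real (Suc n)) ^ Suc n"
    using True by (subst power_divide[symmetric]) (intro power_mono, auto)
  also have "\<dots> \<le> exp (1 / t)"
  proof -
    have "0 < 1 / t" using True by simp
    then have "- real (Suc n) \<le> 1 / t" by linarith
    then show ?thesis by (intro exp_ge_one_plus_x_over_n_power_n) auto
  qed
  finally have "(1 / t) ^ Suc n \<le> real (Suc n) ^ Suc n * exp (1 / t)"
    by (subst (asm) pos_divide_le_eq) (auto simp: mult.commute)
  then have "(1 / t) ^ n \<le> real (Suc n) ^ Suc n * exp (1 / t) * t"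
    using True by (simp add: field_simps)
  then have "(1 / t) ^ n * exp (- (1 / t)) \<le> real (Suc n) ^ Suc n * exp (1 / t) * t * exp (- (1 / t))"
    by (intro mult_right_mono) auto
  also have "\<dots> = real (Suc n) ^ Suc n * t * (exp (1 / t) * exp (- (1 / t)))" by (simp only: mult_ac)
  also have "\<dots> = real (Suc n) ^ Suc n * t" by (simp only: exp_minus_inverse mult_1_right)
  finally show ?thesis using True by (simp add: flat_exp_def abs_mult)
next
  case False
  then have "flat_exp n t = 0" by (simp add: flat_exp_def)
  then show ?thesis by (simp only: abs_zero) (intro mult_nonneg_nonneg, auto)
qed

lemma flat_exp_has_derivative:
  "(flat_exp n has_real_derivative (flat_exp (n + 2) t - real n * flat_exp (n + 1) t)) (at t)"
proof -
  consider "t > 0" | "t < 0" | "t = 0" by linarith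
  then show ?thesis
  proof cases
    case 1
    have inv: "((\<lambda>t. 1 / t) has_real_derivative - ((1 / t)\<^sup>2)) (at t)"
      using 1 by (auto intro!: derivative_eq_intros simp: power2_eq_square)
    have "((\<lambda>t. (1 / t) ^ n * exp (- (1 / t))) has_real_derivative
        (real n * ((1 / t) ^ (n - 1) * - ((1 / t)\<^sup>2))) * exp (- (1 / t))
        + (exp (- (1 / t)) * - (- ((1 / t)\<^sup>2))) * (1 / t) ^ n) (at t)"
      using DERIV_mult[OF DERIV_power[OF inv, of n] DERIV_chain2[OF DERIV_exp DERIV_minus[OF inv]]]
      by (simp add: mult_ac)
    moreover have "(real n * ((1 / t) ^ (n - 1) * - ((1 / t)\<^sup>2))) * exp (- (1 / t))
        + (exp (- (1 / t)) * - (- ((1 / t)\<^sup>2))) * (1 / t) ^ n = flat_exp (n + 2) t - real n * flat_exp (n + 1) t"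
      using 1 by (cases n) (simp_all add: flat_exp_def power2_eq_square algebra_simps)
    ultimately have "((\<lambda>t. (1 / t) ^ n * exp (- (1 / t))) has_real_derivative
        (flat_exp (n + 2) t - real n * flat_exp (n + 1) t)) (at t)" by simp
    moreover have ev: "\<forall>\<^sub>F s in nhds t. (1 / s) ^ n * exp (- (1 / s)) = flat_exp n s"
      using eventually_nhds_in_open[OF open_greaterThan, of t 0] 1
      by (auto elim!: eventually_mono simp: flat_exp_def)
    ultimately show ?thesis by (simp only: DERIV_cong_ev[OF refl ev refl])
  next
    case 2
    have "((\<lambda>t. 0) has_real_derivative 0) (at t)" by simp
    moreover have "\<forall>\<^sub>F s in nhds t. 0 = flat_exp n s"
      using eventually_nhds_in_open[OF open_lessThan, of t 0] 2
      by (auto elim!: eventually_mono simp: flat_exp_def)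
    ultimately show ?thesis using 2 DERIV_cong_ev[of t t "\<lambda>t. 0" "flat_exp n" 0 0] by (simp add: flat_exp_def)
  next
    case 3
    \<comment> \<open>Division by \<open>h\<close> raises the index by one, so the bound for
      \<open>Suc n\<close> controls the difference quotient at 0.\<close>
    have b: "norm ((flat_exp n (0 + h) - flat_exp n 0) / h) \<le> real (Suc (Suc n)) ^ Suc (Suc n) * \<bar>h\<bar>" for h
      using abs_flat_exp_le[of "Suc n" h] by (auto simp: flat_exp_def abs_mult)
    have "((\<lambda>h. real (Suc (Suc n)) ^ Suc (Suc n) * \<bar>h\<bar>) \<longlongrightarrow> real (Suc (Suc n)) ^ Suc (Suc n) * \<bar>0\<bar>) (at 0)"
      by (intro tendsto_intros)
    then have "((\<lambda>h. real (Suc (Suc n)) ^ Suc (Suc n) * \<bar>h\<bar>) \<longlongrightarrow> 0) (at 0)"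
      by (simp only: abs_zero mult_zero_right)
    then have "(\<lambda>h. (flat_exp n (0 + h) - flat_exp n 0) / h) \<midarrow>0\<rightarrow> 0"
      by (rule Lim_null_comparison[OF always_eventually[OF allI[OF b]]])
    then show ?thesis using 3 by (simp add: DERIV_def flat_exp_def)
  qed
qed

lemma smooth_on_flat_exp: "smooth_on UNIV (flat_exp n)"
proof -
  have "times_differentiable_on k UNIV (flat_exp n)" for k n
  proof (induction k arbitrary: n)
    case 0
    show ?case using flat_exp_has_derivative
      by (auto intro!: continuous_at_imp_continuous_on DERIV_isCont)
  next
    case (Suc k)
    have d: "(flat_exp n has_derivative (\<lambda>v. v * (flat_exp (n + 2) t - real n * flat_exp (n + 1) t))) (at t)" for t
      using flat_exp_has_derivative[of n t] by (simp add: has_field_derivative_def mult.commute[of _ "_ - _"])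
    have "(\<lambda>t. FD (flat_exp n) t v) = (\<lambda>t. v *\<^sub>R flat_exp (n + 2) t + (- v * real n) *\<^sub>R flat_exp (n + 1) t)" for v
      by (simp add: FD_unique[OF d] algebra_simps)
    then have "times_differentiable_on k UNIV (\<lambda>t. FD (flat_exp n) t v)" for v
      by (simp only:) (intro times_differentiable_on_add Suc.IH open_UNIV
          times_differentiable_on_bounded_linear[OF bounded_linear_scaleR_right])
    then show ?case using d by (auto simp: differentiable_def)
  qed
  then show ?thesis by (simp add: smooth_on_def)
qed

text \<open>The function is \<open>flat_exp 0\<close> of r^2 - |z - x|^2. It vanishes off a compact
  ball inside \<open>S\<close>, which later allows extension by zero over a manifold. Its value at
  the centre is not normalised.\<close>

lemma smooth_bump_exists:
  fixes x :: "'e::euclidean_space"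
  assumes "open S" "x \<in> S"
  obtains \<psi> :: "'e \<Rightarrow> real" and r where "r > 0" "cball x r \<subseteq> S" "smooth_on UNIV \<psi>" "\<psi> x \<noteq> 0"
    "\<And>z. z \<notin> cball x r \<Longrightarrow> \<psi> z = 0"
proof -
  obtain r where r: "r > 0" "cball x r \<subseteq> S" using assms open_contains_cball by blast
  define \<psi> where "\<psi> z = flat_exp 0 (r\<^sup>2 - (z - x) \<bullet> (z - x))" for z
  have "smooth_on UNIV (\<lambda>z. z - x)"
    by (intro smooth_on_diff smooth_on_const smooth_on_linear[OF bounded_linear_ident]) auto
  then have "smooth_on UNIV (\<lambda>z. r\<^sup>2 - (z - x) \<bullet> (z - x))"
    by (intro smooth_on_diff[OF open_UNIV smooth_on_const] smooth_on_bilinear[OF bounded_bilinear_inner open_UNIV])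
  then have "smooth_on UNIV \<psi>"
    unfolding \<psi>_def by (intro smooth_on_compose[OF _ _ smooth_on_flat_exp]) auto
  moreover have "\<psi> x \<noteq> 0" using r by (simp add: \<psi>_def flat_exp_def)
  moreover have "\<psi> z = 0" if "z \<notin> cball x r" for z
  proof -
    have "r < norm (z - x)" using that by (simp add: dist_norm norm_minus_commute)
    then have "r\<^sup>2 < (norm (z - x))\<^sup>2" using r by (intro power_strict_mono) auto
    then show ?thesis by (simp add: \<psi>_def flat_exp_def power2_norm_eq_inner)
  qed
  ultimately show ?thesis using r that by blast
qed

section \<open>Connections in a chart\<close>

text \<open>\<theta> is a connection form: its first vector is the direction, its second lies in the
  fibre. The fibre type is independent of the base type, so sections need not be coordinate vector
  fields; this is used for the adapted frame on TM.\<close>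

definition cov_deriv ::
    "('e::real_normed_vector \<Rightarrow> 'e \<Rightarrow> 'f::real_normed_vector \<Rightarrow> 'f) \<Rightarrow> ('e \<Rightarrow> 'e) \<Rightarrow> ('e \<Rightarrow> 'f) \<Rightarrow> 'e \<Rightarrow> 'f" where
  "cov_deriv \<theta> X s x = FD s x (X x) + \<theta> x (X x) (s x)"

definition bracket :: "('e::real_normed_vector \<Rightarrow> 'e) \<Rightarrow> ('e \<Rightarrow> 'e) \<Rightarrow> 'e \<Rightarrow> 'e" where
  "bracket X Y x = FD Y x (X x) - FD X x (Y x)"

definition curv ::
    "('e::real_normed_vector \<Rightarrow> 'e \<Rightarrow> 'f::real_normed_vector \<Rightarrow> 'f) \<Rightarrow> ('e \<Rightarrow> 'e) \<Rightarrow> ('e \<Rightarrow> 'e) \<Rightarrow> ('e \<Rightarrow> 'f) \<Rightarrow> 'e \<Rightarrow> 'f" where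
  "curv \<theta> X Y s x = cov_deriv \<theta> X (cov_deriv \<theta> Y s) x - cov_deriv \<theta> Y (cov_deriv \<theta> X s) x
     - cov_deriv \<theta> (bracket X Y) s x"

text \<open>The coordinate form of d\<theta> + \<theta> \<and> \<theta>, evaluated on constant
  fields.\<close>

definition curv_tensor ::
    "('e::real_normed_vector \<Rightarrow> 'e \<Rightarrow> 'f::real_normed_vector \<Rightarrow> 'f) \<Rightarrow> 'e \<Rightarrow> 'e \<Rightarrow> 'e \<Rightarrow> 'f \<Rightarrow> 'f" where
  "curv_tensor \<theta> x u v w =
     FD (\<lambda>z. \<theta> z v w) x u - FD (\<lambda>z. \<theta> z u w) x v + \<theta> x u (\<theta> x v w) - \<theta> x v (\<theta> x u w)"

lemma bilinear_linear:
  assumes "bilinear B"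
  shows "linear (B u)" "linear (\<lambda>u. B u w)"
  using assms by (auto simp: bilinear_def)

lemma cov_deriv_cong_open:
  assumes "open V" "x \<in> V" "\<And>z. z \<in> V \<Longrightarrow> s z = t z"
  shows "cov_deriv \<theta> X s x = cov_deriv \<theta> X t x"
  unfolding cov_deriv_def using FD_cong_open[of V x s t, OF assms] assms by simp

lemma FD_Pair:
  assumes "f differentiable (at x)" "h differentiable (at x)"
  shows "FD (\<lambda>z. (f z, h z)) x v = (FD f x v, FD h x v)"
  by (rule fun_cong[OF FD_unique[OF has_derivative_Pair[OF FD_works[OF assms(1)] FD_works[OF assms(2)]]]])

locale connection =
  fixes V :: "'e::euclidean_space set" and \<theta> :: "'e \<Rightarrow> 'e \<Rightarrow> 'f::euclidean_space \<Rightarrow> 'f"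
  assumes open_V: "open V" and bil: "\<And>x. x \<in> V \<Longrightarrow> bilinear (\<theta> x)"
    and smooth: "\<And>u w. smooth_on V (\<lambda>x. \<theta> x u w)"
begin

lemma smooth_cov_deriv:
  assumes "smooth_on V X" "smooth_on V s"
  shows "smooth_on V (cov_deriv \<theta> X s)"
proof -
  have "smooth_on V (\<lambda>x. FD s x (X x))"
    by (rule smooth_on_family[where A = "\<lambda>x. FD s x", OF open_V _ smooth_on_FD[OF assms(2)] assms(1)])
      (rule linear_FD[OF smooth_on_differentiable[OF assms(2)]])
  moreover have "smooth_on V (\<lambda>x. \<theta> x (X x) (s x))"
    by (rule smooth_on_family2[where B = \<theta>, OF open_V bil smooth assms])
  ultimately show ?thesis unfolding cov_deriv_def by (rule smooth_on_add[OF open_V])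
qed

lemma FD_cov_deriv:
  assumes x: "x \<in> V" and X: "smooth_on V X" and s: "smooth_on V s"
  shows "FD (cov_deriv \<theta> X s) x v = FD (\<lambda>z. FD s z (X x)) x v + FD s x (FD X x v)
    + (FD (\<lambda>z. \<theta> z (X x) (s x)) x v + \<theta> x (FD X x v) (s x) + \<theta> x (X x) (FD s x v))"
proof -
  note dX = smooth_on_differentiable[OF X x] and ds = smooth_on_differentiable[OF s x]
  have 1: "((\<lambda>z. FD s z (X z)) has_derivative (\<lambda>v. FD (\<lambda>z. FD s z (X x)) x v + FD s x (FD X x v))) (at x)"
    by (rule has_derivative_family[where A = "\<lambda>z. FD s z", OF open_V x _ smooth_on_differentiable[OF smooth_on_FD[OF s] x] dX])
      (rule linear_FD[OF smooth_on_differentiable[OF s]])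
  have 2: "((\<lambda>z. \<theta> z (X z) (s z)) has_derivative (\<lambda>v. FD (\<lambda>z. \<theta> z (X x) (s x)) x v
      + \<theta> x (FD X x v) (s x) + \<theta> x (X x) (FD s x v))) (at x)"
    by (rule has_derivative_family2[where B = \<theta>, OF open_V x bil smooth_on_differentiable[OF smooth x] dX ds])
  show ?thesis
    unfolding cov_deriv_def using FD_unique[OF has_derivative_add[OF 1 2]] by simp
qed

text \<open>Tensoriality: second derivatives of \<open>s\<close> cancel by symmetry, derivatives of
  \<open>X\<close> and \<open>Y\<close> cancel against the bracket term, and the mixed first-order
  terms cancel in pairs.\<close>

lemma curv_eq_tensor:
  assumes x: "x \<in> V" and X: "smooth_on V X" and Y: "smooth_on V Y" and s: "smooth_on V s"
  shows "curv \<theta> X Y s x = curv_tensor \<theta> x (X x) (Y x) (s x)"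
proof -
  have "times_differentiable_on 2 V s" using s by (simp add: smooth_on_def)
  note schwarz = FD_FD_sym[OF open_V x this, of "X x" "Y x"]
  note Fs = linear_FD[OF smooth_on_differentiable[OF s x]]
  note bl = bil[OF x]
  show ?thesis
    unfolding curv_def cov_deriv_def[of \<theta> X "cov_deriv \<theta> Y s"] cov_deriv_def[of \<theta> Y "cov_deriv \<theta> X s"]
      FD_cov_deriv[OF x X s] FD_cov_deriv[OF x Y s]
    unfolding cov_deriv_def bracket_def curv_tensor_def
    by (simp add: schwarz linear_diff[OF Fs] bilinear_lsub[OF bl] bilinear_radd[OF bl])
qed

lemma linear_curv_tensor:
  assumes x: "x \<in> V"
  shows "linear (\<lambda>u. curv_tensor \<theta> x u v w)" "linear (\<lambda>v. curv_tensor \<theta> x u v w)"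
    "linear (\<lambda>w. curv_tensor \<theta> x u v w)"
proof -
  note d = smooth_on_differentiable[OF smooth x]
  note bl = bil[OF x]
  have 1: "linear (\<lambda>v. FD (\<lambda>z. \<theta> z v w) x u)" for u w
    by (rule linear_FD_family[where A = "\<lambda>z v. \<theta> z v w", OF open_V x bilinear_linear(2)[OF bil] d])
  have 2: "linear (\<lambda>w. FD (\<lambda>z. \<theta> z v w) x u)" for u v
    by (rule linear_FD_family[where A = "\<lambda>z w. \<theta> z v w", OF open_V x bilinear_linear(1)[OF bil] d])
  have 3: "linear (FD (\<lambda>z. \<theta> z v w) x)" for v w by (rule linear_FD[OF d])
  note simps = curv_tensor_def linear_add[OF 1] linear_add[OF 2] linear_add[OF 3]
    linear_scale[OF 1] linear_scale[OF 2] linear_scale[OF 3]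
    bilinear_ladd[OF bl] bilinear_radd[OF bl] bilinear_lmul[OF bl] bilinear_rmul[OF bl] algebra_simps
  show "linear (\<lambda>u. curv_tensor \<theta> x u v w)" by (rule linearI) (simp_all add: simps)
  show "linear (\<lambda>v. curv_tensor \<theta> x u v w)" by (rule linearI) (simp_all add: simps)
  show "linear (\<lambda>w. curv_tensor \<theta> x u v w)" by (rule linearI) (simp_all add: simps)
qed

lemma bilinear_curv_tensor:
  assumes x: "x \<in> V"
  shows "bilinear (\<lambda>u v. curv_tensor \<theta> x u v w)" "bilinear (\<lambda>u w. curv_tensor \<theta> x u v w)"
    "bilinear (\<lambda>v w. curv_tensor \<theta> x u v w)"
  using linear_curv_tensor[OF x] by (auto simp: bilinear_def)

lemma smooth_curv_tensor: "smooth_on V (\<lambda>x. curv_tensor \<theta> x u v w)"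
proof -
  have "smooth_on V (\<lambda>x. \<theta> x u (\<theta> x v w))" for u v
    by (rule smooth_on_family[where A = "\<lambda>x. \<theta> x u", OF open_V bilinear_linear(1)[OF bil] smooth smooth])
  then show ?thesis
    unfolding curv_tensor_def by (intro smooth_on_diff smooth_on_add open_V smooth_on_FD[OF smooth])
qed

lemma curv_tensor_antisym: "curv_tensor \<theta> x v u w = - curv_tensor \<theta> x u v w"
  by (simp add: curv_tensor_def)

end

section \<open>The Levi-Civita connection in a chart\<close>

definition koszul :: "('e::real_normed_vector \<Rightarrow> 'e \<Rightarrow> 'e \<Rightarrow> real) \<Rightarrow> 'e \<Rightarrow> 'e \<Rightarrow> 'e \<Rightarrow> 'e \<Rightarrow> real" where
  "koszul g x u v z = (FD (\<lambda>y. g y v z) x u + FD (\<lambda>y. g y u z) x v - FD (\<lambda>y. g y u v) x z) / 2"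

text \<open>The Koszul description of \<open>christoffel\<close>, detached from atlases, so that one
  theory applies to chart metrics of M and of TM.\<close>

definition levi_civita :: "('e::real_normed_vector \<Rightarrow> 'e \<Rightarrow> 'e \<Rightarrow> real) \<Rightarrow> 'e \<Rightarrow> 'e \<Rightarrow> 'e \<Rightarrow> 'e" where
  "levi_civita g x u v = (THE w. \<forall>z. g x w z = koszul g x u v z)"

locale chart_metric =
  fixes U :: "'e::euclidean_space set" and g :: "'e \<Rightarrow> 'e \<Rightarrow> 'e \<Rightarrow> real"
  assumes open_U: "open U"
    and g_bil: "\<And>x. x \<in> U \<Longrightarrow> bilinear (g x)"
    and g_sym: "\<And>x u v. x \<in> U \<Longrightarrow> g x u v = g x v u"
    and g_pos: "\<And>x u. x \<in> U \<Longrightarrow> u \<noteq> 0 \<Longrightarrow> g x u u > 0"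
    and g_smooth: "\<And>u v. smooth_on U (\<lambda>x. g x u v)"
begin

abbreviation \<Gamma> where "\<Gamma> \<equiv> levi_civita g"

lemma g_diff: "x \<in> U \<Longrightarrow> (\<lambda>x. g x u v) differentiable (at x)"
  by (rule smooth_on_differentiable[OF g_smooth])

lemma g_eqI:
  assumes "x \<in> U" "\<And>z. g x w z = g x w' z" shows "w = w'"
proof -
  have "g x (w - w') (w - w') = 0" using assms bilinear_lsub[OF g_bil[OF assms(1)]] by simp
  then show ?thesis using g_pos[OF assms(1), of "w - w'"] by fastforce
qed

lemma FD_g_sym: "x \<in> U \<Longrightarrow> FD (\<lambda>y. g y u v) x = FD (\<lambda>y. g y v u) x"
  using g_sym by (intro FD_cong_open[OF open_U])

lemma linear_FD_g:
  assumes "x \<in> U"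
  shows "linear (\<lambda>v. FD (\<lambda>y. g y u v) x w)" "linear (\<lambda>u. FD (\<lambda>y. g y u v) x w)"
proof -
  show "linear (\<lambda>v. FD (\<lambda>y. g y u v) x w)"
    by (rule linear_FD_family[where A = "\<lambda>y v. g y u v", OF open_U assms bilinear_linear(1)[OF g_bil] g_diff[OF assms]])
  show "linear (\<lambda>u. FD (\<lambda>y. g y u v) x w)"
    by (rule linear_FD_family[where A = "\<lambda>y u. g y u v", OF open_U assms bilinear_linear(2)[OF g_bil] g_diff[OF assms]])
qed

lemma linear_koszul:
  assumes "x \<in> U"
  shows "linear (koszul g x u v)" "linear (\<lambda>u. koszul g x u v z)" "linear (\<lambda>v. koszul g x u v z)"
proof -
  note 3 = linear_FD[OF g_diff[OF assms]]
  note 1 = linear_FD_g(1)[OF assms]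
  note 2 = linear_FD_g(2)[OF assms]
  note simps = koszul_def linear_add[OF 1] linear_add[OF 2] linear_add[OF 3]
    linear_scale[OF 1] linear_scale[OF 2] linear_scale[OF 3] field_simps
  show "linear (koszul g x u v)" by (rule linearI) (simp_all add: simps)
  show "linear (\<lambda>u. koszul g x u v z)" by (rule linearI) (simp_all add: simps)
  show "linear (\<lambda>v. koszul g x u v z)" by (rule linearI) (simp_all add: simps)
qed

lemma g_\<Gamma>:
  assumes "x \<in> U" shows "g x (\<Gamma> x u v) z = koszul g x u v z"
proof -
  have "\<exists>!w. \<forall>z. g x w z = koszul g x u v z"
    by (rule nondegenerate_representation[OF g_bil[OF assms] g_pos[OF assms] linear_koszul(1)[OF assms]])
  from theI'[OF this] show ?thesis unfolding levi_civita_def by blast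
qed

text \<open>Inserting compatibility into the Koszul expression leaves, by symmetry, a single term.
  Connections are identified through this lemma twice: for \<open>G\<close> in the adapted frame,
  and for the change of charts.\<close>

lemma \<Gamma>_unique:
  assumes x: "x \<in> U" and sym: "\<And>u v. B u v = B v u"
    and compat: "\<And>u v w. FD (\<lambda>y. g y u v) x w = g x (B w u) v + g x u (B w v)"
  shows "\<Gamma> x u v = B u v"
proof (rule g_eqI[OF x])
  fix z
  show "g x (\<Gamma> x u v) z = g x (B u v) z"
    using sym[of z u] sym[of z v] sym[of v u] g_sym[OF x, of "B u z" v]
    by (simp add: g_\<Gamma>[OF x] koszul_def compat)
qed

lemma \<Gamma>_sym:
  assumes "x \<in> U" shows "\<Gamma> x u v = \<Gamma> x v u"
  using FD_g_sym[OF assms, of u v] by (intro g_eqI[OF assms]) (simp add: g_\<Gamma>[OF assms] koszul_def)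

lemma \<Gamma>_compat:
  assumes "x \<in> U" shows "FD (\<lambda>y. g y u v) x w = g x (\<Gamma> x w u) v + g x u (\<Gamma> x w v)"
  using FD_g_sym[OF assms, of v u] FD_g_sym[OF assms, of w v] FD_g_sym[OF assms, of w u]
  by (simp add: g_sym[OF assms, of u] g_\<Gamma>[OF assms] koszul_def field_simps)

lemma \<Gamma>_bil:
  assumes "x \<in> U" shows "bilinear (\<Gamma> x)"
proof -
  have "linear (\<lambda>u. \<Gamma> x u v)" for v
  proof (rule linearI; rule g_eqI[OF assms])
    fix u w z and r :: real
    show "g x (\<Gamma> x (u + w) v) z = g x (\<Gamma> x u v + \<Gamma> x w v) z"
      by (simp add: bilinear_ladd[OF g_bil[OF assms]] g_\<Gamma>[OF assms] linear_add[OF linear_koszul(2)[OF assms]])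
    show "g x (\<Gamma> x (r *\<^sub>R u) v) z = g x (r *\<^sub>R \<Gamma> x u v) z"
      by (simp add: bilinear_lmul[OF g_bil[OF assms]] g_\<Gamma>[OF assms] linear_scale[OF linear_koszul(2)[OF assms]])
  qed
  moreover from this have "linear (\<Gamma> x v)" for v
  proof -
    have "\<Gamma> x v = (\<lambda>u. \<Gamma> x u v)" using \<Gamma>_sym[OF assms] by blast
    then show ?thesis using \<open>\<And>v. linear (\<lambda>u. \<Gamma> x u v)\<close> by simp
  qed
  ultimately show ?thesis by (simp add: bilinear_def)
qed

lemma \<Gamma>_smooth: "smooth_on U (\<lambda>x. \<Gamma> x u v)"
proof (rule smooth_on_linear_solution[OF open_U])
  \<comment> \<open>The Gram system of the metric: its components are the pairings with the basis
    vectors, so the Koszul equation becomes a linear system with smooth coefficients.\<close>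
  let ?A = "\<lambda>x w. \<Sum>b\<in>Basis. g x w b *\<^sub>R b"
  let ?F = "\<lambda>x. \<Sum>b\<in>Basis. koszul g x u v b *\<^sub>R b"
  have comp: "?A x w \<bullet> b = g x w b" if "b \<in> Basis" for x w b
    using that by (simp add: inner_sum_left inner_Basis if_distrib sum.delta cong: if_cong)
  show lin: "linear (?A x)" if "x \<in> U" for x
    using that g_bil[OF that]
    by (intro linearI) (simp_all add: bilinear_ladd bilinear_lmul scaleR_add_left sum.distrib scaleR_sum_right)
  show "inj (?A x)" if "x \<in> U" for x
  proof (subst linear_injective_0[OF lin[OF that]], intro allI impI)
    fix w assume "?A x w = 0"
    then have "g x w b = 0" if "b \<in> Basis" for b using comp[OF that, of x w] by simp
    then have "g x w w = 0"
      using linear_euclidean_expand[OF bilinear_linear(1)[OF g_bil[OF that]], of w w] by simp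
    then show "w = 0" using g_pos[OF that, of w] by fastforce
  qed
  show "smooth_on U (\<lambda>x. ?A x w)" for w
    by (intro smooth_on_sum smooth_on_scaleR open_U g_smooth smooth_on_const)
  have "smooth_on U (\<lambda>x. koszul g x u v b)" for b
    unfolding koszul_def divide_inverse
    by (intro smooth_on_mult smooth_on_diff smooth_on_add open_U smooth_on_FD[OF g_smooth] smooth_on_const)
  then show "smooth_on U ?F"
    by (intro smooth_on_sum smooth_on_scaleR open_U smooth_on_const)
  show "?A x (\<Gamma> x u v) = ?F x" if "x \<in> U" for x
    by (simp add: g_\<Gamma>[OF that])
qed

sublocale LC: connection U \<Gamma>
  by unfold_locales (auto intro: open_U \<Gamma>_bil \<Gamma>_smooth)

abbreviation R where "R \<equiv> curv_tensor \<Gamma>"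

lemma R_bianchi:
  assumes x: "x \<in> U" shows "R x u v w + R x v w u + R x w u v = 0"
proof -
  have "FD (\<lambda>z. \<Gamma> z v w) x = FD (\<lambda>z. \<Gamma> z w v) x" for v w
    by (rule FD_cong_open[OF open_U x]) (rule \<Gamma>_sym)
  note s = this[of v w] this[of v u] this[of u w]
  show ?thesis
    unfolding curv_tensor_def s \<Gamma>_sym[OF x, of v w] \<Gamma>_sym[OF x, of v u] \<Gamma>_sym[OF x, of u w] by simp
qed

text \<open>Differentiating metric compatibility once more expresses second derivatives of
  \<open>g\<close> through \<Gamma>; their symmetry is exactly the asserted identity.\<close>

lemma R_skew:
  assumes x: "x \<in> U" shows "g x (R x u v w) z + g x w (R x u v z) = 0"
proof -
  note bl = g_bil[OF x]
  have d: "FD (\<lambda>y. FD (\<lambda>y. g y w z) y v) x u =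
      g x (\<Gamma> x u (\<Gamma> x v w)) z + g x (\<Gamma> x v w) (\<Gamma> x u z) + g x (FD (\<lambda>y. \<Gamma> y v w) x u) z
      + (g x (\<Gamma> x u w) (\<Gamma> x v z) + g x w (\<Gamma> x u (\<Gamma> x v z)) + g x w (FD (\<lambda>y. \<Gamma> y v z) x u))" for u v
  proof -
    have d\<Gamma>: "(\<lambda>y. \<Gamma> y v w) differentiable (at x)" for w
      by (rule smooth_on_differentiable[OF \<Gamma>_smooth x])
    have 1: "((\<lambda>y. g y (\<Gamma> y v w) z) has_derivative
        (\<lambda>u. FD (\<lambda>y. g y (\<Gamma> x v w) z) x u + g x (FD (\<lambda>y. \<Gamma> y v w) x u) z)) (at x)"
      by (rule has_derivative_family[where A = "\<lambda>y w. g y w z", OF open_U x bilinear_linear(2)[OF g_bil] g_diff[OF x] d\<Gamma>])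
    have 2: "((\<lambda>y. g y w (\<Gamma> y v z)) has_derivative
        (\<lambda>u. FD (\<lambda>y. g y w (\<Gamma> x v z)) x u + g x w (FD (\<lambda>y. \<Gamma> y v z) x u))) (at x)"
      by (rule has_derivative_family[where A = "\<lambda>y z. g y w z", OF open_U x bilinear_linear(1)[OF g_bil] g_diff[OF x] d\<Gamma>])
    have "FD (\<lambda>y. FD (\<lambda>y. g y w z) y v) x = FD (\<lambda>y. g y (\<Gamma> y v w) z + g y w (\<Gamma> y v z)) x"
      by (rule FD_cong_open[OF open_U x]) (rule \<Gamma>_compat)
    then show ?thesis
      by (simp add: FD_unique[OF has_derivative_add[OF 1 2]] \<Gamma>_compat[OF x])
  qed
  have "times_differentiable_on 2 U (\<lambda>y. g y w z)" using g_smooth by (simp add: smooth_on_def)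
  from FD_FD_sym[OF open_U x this, of v u] show ?thesis
    unfolding d curv_tensor_def
    by (simp add: bilinear_ladd[OF bl] bilinear_radd[OF bl] bilinear_lsub[OF bl] bilinear_rsub[OF bl] algebra_simps)
qed

lemma R_pair_sym:
  assumes x: "x \<in> U" shows "g x (R x u v w) z = g x (R x w z u) v"
proof -
  have b: "g x (R x u v w) z + g x (R x v w u) z + g x (R x w u v) z = 0" for u v w z
    using arg_cong[OF R_bianchi[OF x, of u v w], of "\<lambda>p. g x p z"]
    by (simp add: bilinear_ladd[OF g_bil[OF x]] bilinear_lzero[OF g_bil[OF x]])
  have s: "g x (R x u v w) z = - g x (R x u v z) w" for u v w z
    using R_skew[OF x, of u v w z] g_sym[OF x, of w] by simp
  have a: "g x (R x v u w) z = - g x (R x u v w) z" for u v w z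
    by (simp add: LC.curv_tensor_antisym[of x v u] bilinear_lneg[OF g_bil[OF x]])
  \<comment> \<open>The classical octahedron argument: four Bianchi identities for the cyclic shifts
    of \<open>u\<close>, \<open>v\<close>, \<open>w\<close>, \<open>z\<close>, with all terms
    normalised by the two skew symmetries.\<close>
  show ?thesis
    using b[of u v w z] b[of v w z u] b[of w z u v] b[of z u v w]
      s[of u v w z] s[of v w u z] s[of w u v z] s[of w z u v] s[of z u v w] s[of v z w u]
      s[of u w v z] s[of z v w u] s[of w z v u] s[of u v z w] s[of w u z v] s[of z u w v]
      a[of z v w u] a[of u w z v] a[of v z w u] a[of z u v w] a[of w u v z] a[of v w u z]
    by linarith
qed

lemma R_diag: "R x u u w = 0"
  by (simp add: curv_tensor_def)

lemma g_R_self: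
  assumes "x \<in> U" shows "g x (R x u v w) w = 0"
  using R_skew[OF assms, of u v w w] g_sym[OF assms, of w] by simp

end

section \<open>The lifted metric in an induced chart\<close>

lemma smooth_on_fst: "open U \<Longrightarrow> smooth_on U f \<Longrightarrow> smooth_on (U \<times> UNIV) (\<lambda>q. f (fst q))"
  by (rule smooth_on_compose[OF _ _ _ smooth_on_linear[OF bounded_linear_fst]]) (auto intro: open_Times)

lemma has_derivative_compose_fst:
  assumes "f differentiable (at (fst q))"
  shows "((\<lambda>q. f (fst q)) has_derivative (\<lambda>w. FD f (fst q) (fst w))) (at q)"
  using diff_chain_at[OF bounded_linear_imp_has_derivative[OF bounded_linear_fst] FD_works[OF assms]]
  by (simp add: o_def)

lemma has_derivative_snd_at: "(snd has_derivative snd) (at q)"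
  by (rule bounded_linear_imp_has_derivative[OF bounded_linear_snd])

lemma smooth_family_snd:
  fixes B :: "'e::euclidean_space \<Rightarrow> 'b::euclidean_space \<Rightarrow> 'f::euclidean_space"
  assumes U: "open U" and B: "\<And>x. x \<in> U \<Longrightarrow> linear (B x)" "\<And>u. smooth_on U (\<lambda>x. B x u)"
  shows "smooth_on (U \<times> UNIV) (\<lambda>q. B (fst q) (snd q))"
  by (rule smooth_on_family[where A = "\<lambda>q. B (fst q)", OF open_Times[OF U open_UNIV] _ smooth_on_fst[OF U B(2)]
        smooth_on_linear[OF bounded_linear_snd]]) (use B(1) in auto)

text \<open>Since \<open>B\<close> is linear in the fibre coordinate, a purely vertical direction
  simply replaces that coordinate. This is what later keeps derivatives of R out of the curvature
  formulas.\<close>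

lemma FD_family_snd:
  fixes B :: "'e::euclidean_space \<Rightarrow> 'b::euclidean_space \<Rightarrow> 'f::euclidean_space"
  assumes U: "open U" and B: "\<And>x. x \<in> U \<Longrightarrow> linear (B x)" "\<And>u. smooth_on U (\<lambda>x. B x u)"
    and q: "q \<in> U \<times> UNIV"
  shows "FD (\<lambda>q. B (fst q) (snd q)) q W = FD (\<lambda>x. B x (snd q)) (fst q) (fst W) + B (fst q) (snd W)"
proof -
  have x: "fst q \<in> U" using q by auto
  note d = has_derivative_compose_fst[OF smooth_on_differentiable[OF B(2) x]]
  have "((\<lambda>q. B (fst q) (snd q)) has_derivative
      (\<lambda>W. FD (\<lambda>z. B (fst z) (snd q)) q W + B (fst q) (FD snd q W))) (at q)"
    by (rule has_derivative_family[where A = "\<lambda>q. B (fst q)", OF open_Times[OF U open_UNIV] q _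
          differentiableI[OF d] differentiableI[OF has_derivative_snd_at]]) (use B(1) in auto)
  then show ?thesis by (simp add: FD_unique FD_unique[OF d] FD_unique[OF has_derivative_snd_at])
qed

text \<open>\<open>G_eq\<close> is the coordinate form of \<open>lift_metric\<close>: the
  combination of \<open>snd V\<close> with the Christoffel term is the vertical part of
  \<open>V\<close> for the Levi-Civita connection.\<close>

locale lifted_metric = chart_metric U g
  for U :: "'e::euclidean_space set" and g :: "'e \<Rightarrow> 'e \<Rightarrow> 'e \<Rightarrow> real" +
  fixes a b c :: real and G :: "'e \<times> 'e \<Rightarrow> 'e \<times> 'e \<Rightarrow> 'e \<times> 'e \<Rightarrow> real"
  assumes a_pos: "a > 0" and det_pos: "a * (a + c) - b\<^sup>2 > 0"
    and G_eq: "\<And>x y V W. x \<in> U \<Longrightarrow> G (x, y) V W =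
      a * (g x (fst V) (fst W) + g x (snd V + levi_civita g x y (fst V)) (snd W + levi_civita g x y (fst W)))
      + b * (g x (fst V) (snd W + levi_civita g x y (fst W)) + g x (snd V + levi_civita g x y (fst V)) (fst W))
      + c * g x (fst V) (fst W)"
begin

abbreviation "TU \<equiv> U \<times> (UNIV :: 'e set)"

lemma open_TU: "open TU" by (simp add: open_Times open_U)

text \<open>The Schur complement of the vertical block of \<open>G\<close>: the factor of
  \<open>g\<close> on the orthogonal complement of the vertical bundle.\<close>

definition "\<kappa> = (a * (a + c) - b\<^sup>2) / a"

text \<open>Chosen so that \<kappa> * \<rho> = a / 2, the balance that makes the connection below
  compatible with \<open>G\<close>.\<close>

definition "\<rho> = a / (2 * \<kappa>)"

lemma \<kappa>_pos: "\<kappa> > 0" and \<rho>_pos: "\<rho> > 0"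
  using a_pos det_pos by (simp_all add: \<kappa>_def \<rho>_def)

text \<open>The connection form of the affine connection \<open>\<nabla> + (b/a) id\<close> on \<open>TM\<close>; its kernel is the
  orthogonal complement of the vertical bundle, so that completing the square diagonalises \<open>G\<close>.\<close>

definition om :: "'e \<times> 'e \<Rightarrow> 'e \<times> 'e \<Rightarrow> 'e" where
  "om q V = snd V + \<Gamma> (fst q) (snd q) (fst V) + (b / a) *\<^sub>R fst V"

lemma om_vertical: "fst q \<in> U \<Longrightarrow> om q (0, C) = C"
  by (simp add: om_def bilinear_rzero[OF \<Gamma>_bil])

lemma G_split:
  assumes "q \<in> TU"
  shows "G q V W = \<kappa> * g (fst q) (fst V) (fst W) + a * g (fst q) (om q V) (om q W)"
proof -
  obtain x y where q: "q = (x, y)" "x \<in> U" using assms by auto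
  note bl = g_bil[OF q(2)]
  \<comment> \<open>Eliminating the quotient leaves a polynomial identity, the completed
    square.\<close>
  define s where "s = b / a"
  have b: "b = a * s" and \<kappa>: "\<kappa> = a + c - a * s * s"
    using a_pos by (simp_all add: s_def \<kappa>_def power2_eq_square field_simps)
  show ?thesis
    by (simp add: q G_eq om_def \<kappa> s_def[symmetric] bilinear_ladd[OF bl] bilinear_radd[OF bl]
        bilinear_lmul[OF bl] bilinear_rmul[OF bl]) (simp add: b algebra_simps)
qed

lemma linear_om:
  assumes "q \<in> TU" shows "linear (om q)"
  using assms
  by (intro linearI) (auto simp: om_def bilinear_radd[OF \<Gamma>_bil] bilinear_rmul[OF \<Gamma>_bil] algebra_simps)

lemma smooth_om: "smooth_on TU (\<lambda>q. om q W)"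
  unfolding om_def
  by (intro smooth_on_add open_TU smooth_on_const open_U smooth_family_snd[where B = "\<lambda>x y. \<Gamma> x y (fst W)"]
      bilinear_linear(2)[OF \<Gamma>_bil] \<Gamma>_smooth)

lemma FD_om:
  assumes q: "q \<in> TU"
  shows "FD (\<lambda>q. om q W) q V = FD (\<lambda>x. \<Gamma> x (snd q) (fst W)) (fst q) (fst V) + \<Gamma> (fst q) (snd V) (fst W)"
proof -
  note s = smooth_family_snd[where B = "\<lambda>x y. \<Gamma> x y (fst W)", OF open_U bilinear_linear(2)[OF \<Gamma>_bil] \<Gamma>_smooth]
  have "FD (\<lambda>q. om q W) q V = FD (\<lambda>q. \<Gamma> (fst q) (snd q) (fst W)) q V"
    using FD_unique[OF has_derivative_add[OF has_derivative_add[OF has_derivative_const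
            FD_works[OF smooth_on_differentiable[OF s q]]] has_derivative_const], of "snd W" "(b / a) *\<^sub>R fst W"]
    by (simp add: om_def)
  then show ?thesis
    using FD_family_snd[where B = "\<lambda>x y. \<Gamma> x y (fst W)", OF open_U bilinear_linear(2)[OF \<Gamma>_bil] \<Gamma>_smooth q] by simp
qed

lemma chart_metric_G: "chart_metric TU G"
proof
  show "open TU" by (rule open_TU)
  show "bilinear (G q)" if "q \<in> TU" for q
  proof -
    have bl: "bilinear (g (fst q))" using that by (auto intro: g_bil)
    note simps = G_split[OF that] bilinear_ladd[OF bl] bilinear_radd[OF bl] bilinear_lmul[OF bl] bilinear_rmul[OF bl]
      linear_add[OF linear_om[OF that]] linear_scale[OF linear_om[OF that]] algebra_simps
    have "linear (G q V)" for V by (rule linearI) (simp_all add: simps)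
    moreover have "linear (\<lambda>V. G q V W)" for W by (rule linearI) (simp_all add: simps)
    ultimately show ?thesis by (simp add: bilinear_def)
  qed
  show "G q V W = G q W V" if "q \<in> TU" for q V W
    using that g_sym[of "fst q"] by (auto simp: G_split)
  show "G q V V > 0" if "q \<in> TU" "V \<noteq> 0" for q V
  proof -
    have x: "fst q \<in> U" using that by auto
    have nn: "g (fst q) u u \<ge> 0" for u
      using g_pos[OF x, of u] bilinear_lzero[OF g_bil[OF x]] by (cases "u = 0") auto
    show ?thesis
    proof (cases "fst V = 0")
      case True
      then have "om q V \<noteq> 0" using that om_vertical[OF x, of "snd V"] by (metis prod.collapse zero_prod_def)
      then show ?thesis
        using g_pos[OF x] nn[of "fst V"] a_pos \<kappa>_pos by (simp add: G_split[OF that(1)] add_nonneg_pos)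
    next
      case False
      then show ?thesis
        using g_pos[OF x] nn[of "om q V"] a_pos \<kappa>_pos by (simp add: G_split[OF that(1)] add_pos_nonneg)
    qed
  qed
  show "smooth_on TU (\<lambda>q. G q V W)" for V W
  proof (subst smooth_on_cong[OF open_TU G_split])
    have "smooth_on TU (\<lambda>q. g (fst q) (om q V) (om q W))"
      by (rule smooth_on_family2[where B = "\<lambda>q. g (fst q)", OF open_TU _ smooth_on_fst[OF open_U g_smooth] smooth_om smooth_om])
        (auto intro: g_bil)
    then show "smooth_on TU (\<lambda>q. \<kappa> * g (fst q) (fst V) (fst W) + a * g (fst q) (om q V) (om q W))"
      by (intro smooth_on_add smooth_on_mult open_TU smooth_on_const smooth_on_fst[OF open_U g_smooth])
  qed
qed

section \<open>The Levi-Civita connection of G in the frame adapted to the vertical bundle\<close>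

sublocale T: chart_metric TU G by (rule chart_metric_G)

definition frame :: "'e \<times> 'e \<Rightarrow> 'e \<times> 'e \<Rightarrow> 'e \<times> 'e" where
  "frame q V = (fst V, om q V)"

text \<open>The direction \<open>V\<close> is in coordinates, while \<open>P\<close> is in the
  frame. For a = 1 and b = c = 0, where \<rho> = 1/2, these are the known formulas for the Sasaki
  metric. The coefficient -1/2 is dictated by vanishing torsion, and \<rho> by compatibility with
  \<open>G\<close>.\<close>

definition theta :: "'e \<times> 'e \<Rightarrow> 'e \<times> 'e \<Rightarrow> 'e \<times> 'e \<Rightarrow> 'e \<times> 'e" where
  "theta q V P =
     (\<Gamma> (fst q) (fst V) (fst P)
        + \<rho> *\<^sub>R (R (fst q) (snd q) (om q V) (fst P) + R (fst q) (snd q) (snd P) (fst V)),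
      \<Gamma> (fst q) (fst V) (snd P) - (1 / 2) *\<^sub>R R (fst q) (fst V) (fst P) (snd q))"

text \<open>The candidate with these two components is symmetric and compatible with
  \<open>G\<close>, hence it is the Levi-Civita connection. The derivative of \<open>om\<close>
  appears because a vector with constant coordinates has varying frame components.\<close>

lemma \<Gamma>G_frame:
  assumes q: "q \<in> TU"
  shows "fst (T.\<Gamma> q V W) = fst (theta q V (frame q W))"
    and "om q (T.\<Gamma> q V W) = FD (\<lambda>q. om q W) q V + snd (theta q V (frame q W))"
proof -
  obtain x y where xy: "q = (x, y)" and x: "x \<in> U" using q by auto
  define P where "P V W = fst (theta q V (frame q W))" for V W
  define T where "T V W = FD (\<lambda>q. om q W) q V + snd (theta q V (frame q W))" for V W
  \<comment> \<open>The second entry is solved from the requirement that the image under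
    \<open>om\<close> be \<open>T V W\<close>.\<close>
  define B where "B V W = (P V W, T V W - \<Gamma> x y (P V W) - (b / a) *\<^sub>R P V W)" for V W
  have om_B: "om q (B V W) = T V W" for V W by (simp add: om_def B_def xy)
  note bl = \<Gamma>_bil[OF x]
  have P_sym: "P V W = P W V" for V W
    by (simp add: P_def theta_def frame_def xy \<Gamma>_sym[OF x, of "fst V"] add.commute)
  have FD_\<Gamma>_sym: "FD (\<lambda>x. \<Gamma> x u v) x = FD (\<lambda>x. \<Gamma> x v u) x" for u v
    by (rule FD_cong_open[OF open_U x \<Gamma>_sym])
  have "T V W - T W V = 0" for V W
  proof -
    \<comment> \<open>Halving the curvature by hand lets the two factors 1/2 add up. The
      antisymmetrised derivative of \<open>om\<close>, together with the \<Gamma> terms of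
      \<open>theta\<close>, gives R(V, W)y, and the two halves cancel it.\<close>
    obtain r where r: "R x (fst V) (fst W) y = r + r" by (metis scaleR_half_double scaleR_right_distrib)
    have r': "R x (fst W) (fst V) y = - (r + r)"
      using LC.curv_tensor_antisym[of x "fst W" "fst V" y] r by simp
    have om: "om (x, y) V = snd V + \<Gamma> x y (fst V) + (b / a) *\<^sub>R fst V" for V by (simp add: om_def)
    have "T V W - T W V = (FD (\<lambda>x. \<Gamma> x (fst W) y) x (fst V) - FD (\<lambda>x. \<Gamma> x (fst V) y) x (fst W)
        + \<Gamma> x (fst V) (\<Gamma> x (fst W) y) - \<Gamma> x (fst W) (\<Gamma> x (fst V) y)) - R x (fst V) (fst W) y"
      unfolding T_def FD_om[OF q]
      unfolding theta_def frame_def xy fst_conv snd_conv r r' scaleR_minus_right scaleR_half_double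
      by (simp add: om bilinear_radd[OF bl] bilinear_rmul[OF bl]
          FD_\<Gamma>_sym[of y] \<Gamma>_sym[OF x, of y] \<Gamma>_sym[OF x, of "fst W" "snd V"] \<Gamma>_sym[OF x, of "fst V" "snd W"]
          \<Gamma>_sym[OF x, of "fst W" "fst V"])
    then show ?thesis by (simp add: curv_tensor_def)
  qed
  then have B_sym: "B V W = B W V" for V W using P_sym[of V W] by (simp add: B_def)
  have "FD (\<lambda>q. G q V W) q Z = G q (B Z V) W + G q V (B Z W)" for V W Z
  proof -
    note bg = g_bil[OF x]
    have dg: "((\<lambda>q. g (fst q) u v) has_derivative (\<lambda>Z. FD (\<lambda>x. g x u v) (fst q) (fst Z))) (at q)" for u v
      using x by (intro has_derivative_compose_fst g_diff) (simp add: xy)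
    note dom = smooth_on_differentiable[OF smooth_om q]
    have 1: "((\<lambda>q. g (fst q) (om q V) (om q W)) has_derivative
        (\<lambda>Z. FD (\<lambda>z. g (fst z) (om q V) (om q W)) q Z + g (fst q) (FD (\<lambda>q. om q V) q Z) (om q W)
          + g (fst q) (om q V) (FD (\<lambda>q. om q W) q Z))) (at q)"
      by (rule has_derivative_family2[where B = "\<lambda>q. g (fst q)", OF open_TU q _ differentiableI[OF dg] dom dom])
        (auto intro: g_bil)
    have 2: "((\<lambda>q. \<kappa> * g (fst q) (fst V) (fst W) + a * g (fst q) (om q V) (om q W)) has_derivative
        (\<lambda>Z. \<kappa> * FD (\<lambda>x. g x (fst V) (fst W)) (fst q) (fst Z) +
          a * (FD (\<lambda>z. g (fst z) (om q V) (om q W)) q Z + g (fst q) (FD (\<lambda>q. om q V) q Z) (om q W)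
          + g (fst q) (om q V) (FD (\<lambda>q. om q W) q Z)))) (at q)"
      by (intro has_derivative_add has_derivative_mult_right dg 1)
    have "FD (\<lambda>q. G q V W) q = FD (\<lambda>q. \<kappa> * g (fst q) (fst V) (fst W) + a * g (fst q) (om q V) (om q W)) q"
      by (rule FD_cong_open[OF open_TU q G_split])
    then have l: "FD (\<lambda>q. G q V W) q Z = \<kappa> * (g x (\<Gamma> x (fst Z) (fst V)) (fst W) + g x (\<Gamma> x (fst Z) (fst W)) (fst V))
        + a * (g x (\<Gamma> x (fst Z) (om q V)) (om q W) + g x (\<Gamma> x (fst Z) (om q W)) (om q V)
           + g x (FD (\<lambda>q. om q V) q Z) (om q W) + g x (FD (\<lambda>q. om q W) q Z) (om q V))"
      unfolding FD_unique[OF 2] FD_unique[OF dg]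
      by (simp add: xy \<Gamma>_compat[OF x] g_sym[OF x, of "fst V"] g_sym[OF x, of "om (x, y) V"])
    have k: "\<kappa> * (\<rho> * r) = a / 2 * r" for r using \<kappa>_pos by (simp add: \<rho>_def)
    \<comment> \<open>Pair symmetry moves the fibre component \<open>om q V\<close> to the second
      slot of \<open>g\<close>. The resulting term has the same form as the one coming from -1/2 R
      in \<open>gT\<close> but opposite sign, and they cancel.\<close>
    have gP: "\<kappa> * g x (P Z V) w = \<kappa> * g x (\<Gamma> x (fst Z) (fst V)) w
        + a / 2 * (g x (R x y (om q Z) (fst V)) w + g x (R x (fst Z) w y) (om q V))" for V w
      using R_pair_sym[OF x, of y "om q V" "fst Z" w]
      unfolding P_def theta_def frame_def xy fst_conv snd_conv bilinear_ladd[OF bg] bilinear_lmul[OF bg]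
        distrib_left by (simp add: k distrib_left)
    have gT: "a * g x (T Z V) w = a * (g x (\<Gamma> x (fst Z) (om q V)) w + g x (FD (\<lambda>q. om q V) q Z) w)
        - a / 2 * g x (R x (fst Z) (fst V) y) w" for V w
      unfolding T_def theta_def frame_def xy fst_conv snd_conv bilinear_ladd[OF bg] bilinear_lsub[OF bg]
        bilinear_lmul[OF bg] by (simp add: algebra_simps)
    have "G q (B Z V) W + G q V (B Z W) =
        \<kappa> * g x (P Z V) (fst W) + \<kappa> * g x (P Z W) (fst V) + (a * g x (T Z V) (om q W) + a * g x (T Z W) (om q V))"
      unfolding G_split[OF q] om_B
      by (simp add: B_def xy g_sym[OF x, of "fst V"] g_sym[OF x, of "om (x, y) V"])
    also have "\<dots> = FD (\<lambda>q. G q V W) q Z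
        + a / 2 * (g x (R x y (om q Z) (fst V)) (fst W) + g x (R x y (om q Z) (fst W)) (fst V))"
      unfolding gP gT l by (simp add: distrib_left)
    \<comment> \<open>The remaining terms come from the vertical part of the direction; they vanish
      because R(y, \<open>om q Z\<close>) is skew.\<close>
    also have "g x (R x y (om q Z) (fst V)) (fst W) + g x (R x y (om q Z) (fst W)) (fst V) = 0"
      using R_skew[OF x, of y "om q Z" "fst V" "fst W"] by (simp add: g_sym[OF x, of "fst V"])
    finally show ?thesis by simp
  qed
  then have eq: "T.\<Gamma> q V W = B V W" by (intro T.\<Gamma>_unique[OF q] B_sym)
  show "fst (T.\<Gamma> q V W) = fst (theta q V (frame q W))" unfolding eq by (simp add: B_def P_def)
  show "om q (T.\<Gamma> q V W) = FD (\<lambda>q. om q W) q V + snd (theta q V (frame q W))"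
    unfolding eq om_B by (simp add: T_def)
qed

lemma connection_theta: "connection TU theta"
proof
  show "open TU" by (rule open_TU)
  show "bilinear (theta q)" if q: "q \<in> TU" for q
  proof -
    have x: "fst q \<in> U" using q by auto
    note bl = \<Gamma>_bil[OF x] and R = LC.linear_curv_tensor[OF x]
    note simps = theta_def linear_add[OF linear_om[OF q]] linear_scale[OF linear_om[OF q]]
      bilinear_ladd[OF bl] bilinear_radd[OF bl] bilinear_lmul[OF bl] bilinear_rmul[OF bl]
      linear_add[OF R(1)] linear_add[OF R(2)] linear_add[OF R(3)]
      linear_scale[OF R(1)] linear_scale[OF R(2)] linear_scale[OF R(3)] prod_eq_iff algebra_simps
    have "linear (theta q V)" for V by (rule linearI) (simp_all add: simps)
    moreover have "linear (\<lambda>V. theta q V P)" for P by (rule linearI) (simp_all add: simps)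
    ultimately show ?thesis by (simp add: bilinear_def)
  qed
  show "smooth_on TU (\<lambda>q. theta q V P)" for V P
  proof -
    note fst_sm = smooth_on_fst[OF open_U \<Gamma>_smooth]
    note R_lin = LC.linear_curv_tensor and R_sm = LC.smooth_curv_tensor
    have "smooth_on TU (\<lambda>q. R (fst q) (snd q) (om q V) (fst P))"
      by (rule smooth_on_family2[where B = "\<lambda>q y w. R (fst q) y w (fst P)", OF open_TU _ smooth_on_fst[OF open_U R_sm]
            smooth_on_linear[OF bounded_linear_snd] smooth_om])
        (auto intro: LC.bilinear_curv_tensor)
    moreover have "smooth_on TU (\<lambda>q. R (fst q) (snd q) (snd P) (fst V))"
      by (rule smooth_family_snd[where B = "\<lambda>x y. R x y (snd P) (fst V)", OF open_U R_lin(1) R_sm])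
    moreover have "smooth_on TU (\<lambda>q. R (fst q) (fst V) (fst P) (snd q))"
      by (rule smooth_family_snd[where B = "\<lambda>x y. R x (fst V) (fst P) y", OF open_U R_lin(3) R_sm])
    ultimately show ?thesis
      unfolding theta_def
      by (intro smooth_on_Pair smooth_on_add smooth_on_diff smooth_on_scaleR open_TU smooth_on_const fst_sm)
  qed
qed

sublocale F: connection TU theta by (rule connection_theta)

lemma smooth_frame: "smooth_on TU Z \<Longrightarrow> smooth_on TU (\<lambda>q. frame q (Z q))"
  unfolding frame_def
  by (intro smooth_on_Pair smooth_on_bounded_linear[OF bounded_linear_fst]
      smooth_on_family[where A = om, OF open_TU linear_om smooth_om] open_TU)

lemma frame_diff: "q \<in> TU \<Longrightarrow> frame q (V - W) = frame q V - frame q W"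
  by (simp add: frame_def linear_diff[OF linear_om])

text \<open>\<open>frame\<close> acts as a gauge transformation from \<open>T.\<Gamma>\<close> to
  \<open>theta\<close>: the derivative of \<open>om\<close> produced by the product rule is the one
  already present in \<open>\<Gamma>G_frame\<close>.\<close>

lemma frame_cov_deriv:
  assumes q: "q \<in> TU" and Z: "smooth_on TU Z"
  shows "frame q (cov_deriv T.\<Gamma> X Z q) = cov_deriv theta X (\<lambda>q. frame q (Z q)) q"
proof -
  note dZ = smooth_on_differentiable[OF Z q]
  have d1: "((\<lambda>q. om q (Z q)) has_derivative (\<lambda>v. FD (\<lambda>z. om z (Z q)) q v + om q (FD Z q v))) (at q)"
    by (rule has_derivative_family[where A = om, OF open_TU q linear_om smooth_on_differentiable[OF smooth_om q] dZ])
  have d2: "((\<lambda>q. fst (Z q)) has_derivative (\<lambda>v. fst (FD Z q v))) (at q)"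
    by (rule bounded_linear.has_derivative[OF bounded_linear_fst FD_works[OF dZ]])
  have "FD (\<lambda>q. frame q (Z q)) q v = (fst (FD Z q v), FD (\<lambda>z. om z (Z q)) q v + om q (FD Z q v))" for v
    unfolding frame_def using FD_unique[OF has_derivative_Pair[OF d2 d1]] by simp
  then show ?thesis
    unfolding cov_deriv_def
    by (simp add: frame_def[of q "_ + _"] linear_add[OF linear_om[OF q]] \<Gamma>G_frame[OF q] prod_eq_iff)
qed

lemma frame_curv:
  assumes q: "q \<in> TU" and X: "smooth_on TU X" and Y: "smooth_on TU Y" and Z: "smooth_on TU Z"
  shows "frame q (curv T.\<Gamma> X Y Z q) = curv_tensor theta q (X q) (Y q) (frame q (Z q))"
proof -
  have "frame q (cov_deriv T.\<Gamma> X (cov_deriv T.\<Gamma> Y Z) q) =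
      cov_deriv theta X (cov_deriv theta Y (\<lambda>q. frame q (Z q))) q" if "smooth_on TU Y" for X Y
    unfolding frame_cov_deriv[OF q T.LC.smooth_cov_deriv[OF that Z]]
    by (rule cov_deriv_cong_open[OF open_TU q frame_cov_deriv[OF _ Z]])
  then have "frame q (curv T.\<Gamma> X Y Z q) = curv theta X Y (\<lambda>q. frame q (Z q)) q"
    using X Y by (simp add: curv_def frame_diff[OF q] frame_cov_deriv[OF q Z])
  then show ?thesis using F.curv_eq_tensor[OF q X Y smooth_frame[OF Z]] by simp
qed

lemma frame_eq_0: "q \<in> TU \<Longrightarrow> frame q V = 0 \<Longrightarrow> V = 0"
  by (cases V) (auto simp: frame_def om_def zero_prod_def bilinear_rzero[OF \<Gamma>_bil])

lemma curv_antisym: "curv T.\<Gamma> Y X Z q = - curv T.\<Gamma> X Y Z q" if "q \<in> TU" "smooth_on TU X" "smooth_on TU Y" "smooth_on TU Z"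
  by (simp add: T.LC.curv_eq_tensor that T.LC.curv_tensor_antisym[of q "Y q"])

lemma flat_lift:
  assumes flat: "\<And>x u v w. x \<in> U \<Longrightarrow> R x u v w = 0"
    and q: "q \<in> TU" and XYZ: "smooth_on TU X" "smooth_on TU Y" "smooth_on TU Z"
  shows "curv T.\<Gamma> X Y Z q = 0"
proof -
  have x: "fst q \<in> U" using q by auto
  let ?t = "\<lambda>q V P. (\<Gamma> (fst q) (fst V) (fst P), \<Gamma> (fst q) (fst V) (snd P))"
  \<comment> \<open>Flatness is used at every point of \<open>TU\<close>, not only at
    \<open>q\<close>, because \<open>theta\<close> is differentiated next.\<close>
  have th: "theta z V P = ?t z V P" if "z \<in> TU" for z V P
    using that by (auto simp: theta_def flat)
  have dG: "((\<lambda>q. \<Gamma> (fst q) u v) has_derivative (\<lambda>w. FD (\<lambda>x. \<Gamma> x u v) (fst q) (fst w))) (at q)" for u v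
    by (rule has_derivative_compose_fst[OF smooth_on_differentiable[OF \<Gamma>_smooth x]])
  have "FD (\<lambda>z. theta z V P) q W = (FD (\<lambda>x. \<Gamma> x (fst V) (fst P)) (fst q) (fst W), FD (\<lambda>x. \<Gamma> x (fst V) (snd P)) (fst q) (fst W))" for V P W
  proof -
    have "FD (\<lambda>z. theta z V P) q = FD (\<lambda>z. ?t z V P) q" by (rule FD_cong_open[OF open_TU q th])
    then show ?thesis using FD_unique[OF has_derivative_Pair[OF dG dG]] by simp
  qed
  then have "curv_tensor theta q V W P = (R (fst q) (fst V) (fst W) (fst P), R (fst q) (fst V) (fst W) (snd P))" for V W P
    unfolding curv_tensor_def[of theta] by (simp add: th[OF q] curv_tensor_def)
  then have "curv_tensor theta q V W P = 0" for V W P by (simp add: flat[OF x] zero_prod_def)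
  then show ?thesis by (simp add: frame_eq_0[OF q] frame_curv[OF q XYZ])
qed

section \<open>Horizontal parts of the curvature of G with vertical arguments\<close>

lemma theta_vertical:
  assumes "q \<in> TU"
  shows "theta q (0, C) P = (\<rho> *\<^sub>R R (fst q) (snd q) C (fst P), 0)"
proof -
  have x: "fst q \<in> U" using assms by auto
  show ?thesis
    using linear_0[OF LC.linear_curv_tensor(1)[OF x]] linear_0[OF LC.linear_curv_tensor(3)[OF x]]
    by (simp add: theta_def om_vertical[OF x] bilinear_lzero[OF \<Gamma>_bil[OF x]])
qed

lemma has_derivative_R_snd:
  assumes q: "q \<in> TU"
  shows "((\<lambda>q. R (fst q) (snd q) v w) has_derivative
     (\<lambda>W. FD (\<lambda>x. R x (snd q) v w) (fst q) (fst W) + R (fst q) (snd W) v w)) (at q)"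
proof -
  note lin = LC.linear_curv_tensor(1) and sm = LC.smooth_curv_tensor
  have "FD (\<lambda>q. R (fst q) (snd q) v w) q = (\<lambda>W. FD (\<lambda>x. R x (snd q) v w) (fst q) (fst W) + R (fst q) (snd W) v w)"
    using FD_family_snd[where B = "\<lambda>x y. R x y v w", OF open_U lin sm q] by blast
  then show ?thesis
    using FD_works[OF smooth_on_differentiable[OF smooth_family_snd[where B = "\<lambda>x y. R x y v w", OF open_U lin sm] q]] by simp
qed

text \<open>The form \<open>theta\<close> vanishes on two vertical arguments throughout
  \<open>TU\<close>, so only the vertical derivative of \<open>theta z V (0, D)\<close> and one
  composition remain. \<open>V\<close> is arbitrary, as the lemma is also applied to covariant
  derivatives of lifts; only its horizontal part enters.\<close>

lemma curv_theta_horizontal_vertical: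
  assumes q: "q \<in> TU"
  shows "fst (curv_tensor theta q V (0, C) (0, D)) =
    - (\<rho> *\<^sub>R (R (fst q) C D (fst V) + \<rho> *\<^sub>R R (fst q) (snd q) C (R (fst q) (snd q) D (fst V))))"
proof -
  have x: "fst q \<in> U" using q by auto
  have lin0: "R z u v 0 = 0" "\<Gamma> z u 0 = 0" "R z u 0 v = 0" if "z \<in> U" for z u v
    using linear_0[OF LC.linear_curv_tensor(3)[OF that]] linear_0[OF LC.linear_curv_tensor(2)[OF that]]
      bilinear_rzero[OF \<Gamma>_bil[OF that]] by auto
  have v0: "theta z (0, C) (0, D) = 0" if "z \<in> TU" for z
    using that lin0 by (auto simp: theta_vertical zero_prod_def)
  have 1: "FD (\<lambda>z. theta z (0, C) (0, D)) q V = 0"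
    using FD_cong_open[OF open_TU q v0] by simp
  have th: "theta z V (0, D) = (\<rho> *\<^sub>R R (fst z) (snd z) D (fst V), \<Gamma> (fst z) (fst V) D)" if "z \<in> TU" for z
    using that lin0 by (auto simp: theta_def)
  have "((\<lambda>z. (\<rho> *\<^sub>R R (fst z) (snd z) D (fst V), \<Gamma> (fst z) (fst V) D)) has_derivative
      (\<lambda>W. (\<rho> *\<^sub>R (FD (\<lambda>x. R x (snd q) D (fst V)) (fst q) (fst W) + R (fst q) (snd W) D (fst V)),
        FD (\<lambda>x. \<Gamma> x (fst V) D) (fst q) (fst W)))) (at q)"
    by (intro has_derivative_Pair has_derivative_scaleR_right has_derivative_R_snd[OF q] has_derivative_compose_fst smooth_on_differentiable[OF \<Gamma>_smooth x])
  then have "FD (\<lambda>z. theta z V (0, D)) q (0, C) =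
      (\<rho> *\<^sub>R (FD (\<lambda>x. R x (snd q) D (fst V)) (fst q) 0 + R (fst q) C D (fst V)), FD (\<lambda>x. \<Gamma> x (fst V) D) (fst q) 0)"
    using FD_cong_open[OF open_TU q th] FD_unique by force
  \<comment> \<open>The direction (0, C) has no base component, so no derivative of R
    survives.\<close>
  moreover have "FD (\<lambda>x. R x (snd q) D (fst V)) (fst q) 0 = 0"
    by (rule linear_0[OF linear_FD[OF smooth_on_differentiable[OF LC.smooth_curv_tensor x]]])
  ultimately have 2: "fst (FD (\<lambda>z. theta z V (0, D)) q (0, C)) = \<rho> *\<^sub>R R (fst q) C D (fst V)" by simp
  have 3: "theta q V 0 = 0" by (rule bilinear_rzero[OF F.bil[OF q]])
  show ?thesis
    unfolding curv_tensor_def[of theta] 1 v0[OF q] 3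
    using LC.linear_curv_tensor(3)[OF x, of "snd q" C]
    by (simp add: 2 theta_vertical[OF q] th[OF q] linear_scale scaleR_add_right)
qed

text \<open>The factor 2 arises from the two fibre derivatives R(B, C) and R(C, B), which are
  subtracted and therefore add up.\<close>

lemma curv_theta_vertical_vertical:
  assumes q: "q \<in> TU"
  shows "fst (curv_tensor theta q (0, B) (0, C) P) = \<rho> *\<^sub>R (2 *\<^sub>R R (fst q) B C (fst P)
    + \<rho> *\<^sub>R (R (fst q) (snd q) B (R (fst q) (snd q) C (fst P)) - R (fst q) (snd q) C (R (fst q) (snd q) B (fst P))))"
proof -
  have x: "fst q \<in> U" using q by auto
  have "fst (FD (\<lambda>z. theta z (0, C) P) q (0, B)) = \<rho> *\<^sub>R R (fst q) B C (fst P)" for B C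
  proof -
    have "((\<lambda>z. (\<rho> *\<^sub>R R (fst z) (snd z) C (fst P), 0::'e)) has_derivative
        (\<lambda>W. (\<rho> *\<^sub>R (FD (\<lambda>x. R x (snd q) C (fst P)) (fst q) (fst W) + R (fst q) (snd W) C (fst P)), 0))) (at q)"
      by (intro has_derivative_Pair has_derivative_scaleR_right has_derivative_R_snd[OF q] has_derivative_const)
    then have "FD (\<lambda>z. theta z (0, C) P) q (0, B) =
        (\<rho> *\<^sub>R (FD (\<lambda>x. R x (snd q) C (fst P)) (fst q) 0 + R (fst q) B C (fst P)), 0)"
      using FD_cong_open[OF open_TU q theta_vertical] FD_unique by force
    moreover have "FD (\<lambda>x. R x (snd q) C (fst P)) (fst q) 0 = 0"
      by (rule linear_0[OF linear_FD[OF smooth_on_differentiable[OF LC.smooth_curv_tensor x]]])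
    ultimately show ?thesis by simp
  qed
  then show ?thesis
    unfolding curv_tensor_def[of theta]
    using LC.linear_curv_tensor(3)[OF x, of "snd q"] LC.curv_tensor_antisym[of "fst q" C B "fst P"]
    by (simp add: theta_vertical[OF q] linear_scale algebra_simps scaleR_2)
qed

end

section \<open>Weak symmetry evaluated on lifts\<close>

definition nabla_curv ::
    "('e::real_normed_vector \<Rightarrow> 'e \<Rightarrow> 'e \<Rightarrow> 'e) \<Rightarrow> ('e \<Rightarrow> 'e) \<Rightarrow> ('e \<Rightarrow> 'e) \<Rightarrow> ('e \<Rightarrow> 'e) \<Rightarrow> ('e \<Rightarrow> 'e) \<Rightarrow> 'e \<Rightarrow> 'e" where
  "nabla_curv \<theta> W X Y Z x = cov_deriv \<theta> W (curv \<theta> X Y Z) x - curv \<theta> (cov_deriv \<theta> W X) Y Z x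
     - curv \<theta> X (cov_deriv \<theta> W Y) Z x - curv \<theta> X Y (cov_deriv \<theta> W Z) x"

context lifted_metric
begin

definition vert :: "('e \<Rightarrow> 'e) \<Rightarrow> 'e \<times> 'e \<Rightarrow> 'e \<times> 'e" where
  "vert X q = (0, X (fst q))"

definition horiz :: "('e \<Rightarrow> 'e) \<Rightarrow> 'e \<times> 'e \<Rightarrow> 'e \<times> 'e" where
  "horiz X q = (X (fst q), - \<Gamma> (fst q) (snd q) (X (fst q)))"

lemma smooth_vert: "smooth_on U X \<Longrightarrow> smooth_on TU (vert X)"
  unfolding vert_def by (intro smooth_on_Pair open_TU smooth_on_const smooth_on_fst[OF open_U])

lemma smooth_horiz:
  assumes "smooth_on U X" shows "smooth_on TU (horiz X)"
proof -
  have "smooth_on TU (\<lambda>q. \<Gamma> (fst q) (snd q) (X (fst q)))"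
    by (rule smooth_on_family2[where B = "\<lambda>q. \<Gamma> (fst q)", OF open_TU _ smooth_on_fst[OF open_U \<Gamma>_smooth]
          smooth_on_linear[OF bounded_linear_snd] smooth_on_fst[OF open_U assms]]) (auto intro: \<Gamma>_bil)
  then show ?thesis
    unfolding horiz_def by (intro smooth_on_Pair open_TU smooth_on_minus smooth_on_fst[OF open_U assms])
qed

lemma frame_vertical: "q \<in> TU \<Longrightarrow> frame q (0, C) = (0, C)"
  by (auto simp: frame_def om_vertical)

lemma fst_curv:
  assumes "q \<in> TU" "smooth_on TU X" "smooth_on TU Y" "smooth_on TU Z"
  shows "fst (curv T.\<Gamma> X Y Z q) = fst (curv_tensor theta q (X q) (Y q) (frame q (Z q)))"
  using frame_curv[OF assms] by (metis frame_def fst_conv)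

text \<open>Vertical lifts are parallel along the fibres, so the fibres are totally geodesic and
  flat.\<close>

lemma curv_vertical:
  assumes q: "q \<in> TU" and XYZ: "smooth_on U X" "smooth_on U Y" "smooth_on U Z"
  shows "curv T.\<Gamma> (vert X) (vert Y) (vert Z) q = 0"
proof (rule frame_eq_0[OF q])
  have v0: "theta z (0, C) (0, D) = 0" if "z \<in> TU" for z C D
    using that linear_0[OF LC.linear_curv_tensor(3)] by (auto simp: theta_vertical zero_prod_def)
  have "FD (\<lambda>z. theta z (0, C) (0, D)) q = (\<lambda>V. 0)" for C D
    using FD_cong_open[OF open_TU q v0] by simp
  then have "curv_tensor theta q (0, B) (0, C) (0, D) = 0" for B C D
    by (simp add: curv_tensor_def v0[OF q] bilinear_rzero[OF F.bil[OF q]])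
  then show "frame q (curv T.\<Gamma> (vert X) (vert Y) (vert Z) q) = 0"
    by (simp add: frame_curv[OF q smooth_vert smooth_vert smooth_vert] XYZ) (simp add: vert_def frame_vertical[OF q])
qed

lemma fst_cov_deriv_horiz_vert:
  assumes q: "q \<in> TU" and X: "smooth_on U X"
  shows "fst (cov_deriv T.\<Gamma> (horiz W) (vert X) q) = \<rho> *\<^sub>R R (fst q) (snd q) (X (fst q)) (W (fst q))"
proof -
  have x: "fst q \<in> U" using q by auto
  have "frame q (cov_deriv T.\<Gamma> (horiz W) (vert X) q) = cov_deriv theta (horiz W) (\<lambda>z. frame z (vert X z)) q"
    by (rule frame_cov_deriv[OF q smooth_vert[OF X]])
  also have "\<dots> = cov_deriv theta (horiz W) (\<lambda>z. (0, X (fst z))) q"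
    by (rule cov_deriv_cong_open[OF open_TU q]) (simp add: vert_def frame_vertical)
  also have "fst \<dots> = fst (theta q (horiz W q) (0, X (fst q)))"
    unfolding cov_deriv_def
    by (simp add: FD_Pair[OF differentiable_const smooth_on_differentiable[OF smooth_on_fst[OF open_U X] q]])
  also have "\<dots> = \<rho> *\<^sub>R R (fst q) (snd q) (X (fst q)) (W (fst q))"
    using linear_0[OF LC.linear_curv_tensor(3)[OF x]] bilinear_rzero[OF \<Gamma>_bil[OF x]]
    by (simp add: theta_def horiz_def)
  finally show ?thesis by (simp add: frame_def)
qed

context
  fixes x :: 'e and X Y W :: "'e \<Rightarrow> 'e" and t :: real and q :: "'e \<times> 'e" and r :: "'e \<Rightarrow> 'e"
  assumes x: "x \<in> U" and X: "smooth_on U X" and Y: "smooth_on U Y" and W: "smooth_on U W"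
    and q: "q = (x, t *\<^sub>R X x)" and r: "r = R x (X x) (Y x)"
begin

lemma R_base_point: "R x (t *\<^sub>R X x) v w = t *\<^sub>R R x (X x) v w"
  by (rule linear_scale[OF LC.linear_curv_tensor(1)[OF x]])

lemma linear_r: "linear r"
  unfolding r by (rule LC.linear_curv_tensor(3)[OF x])

text \<open>Only covariant derivatives of the two copies of \<open>vert Y\<close> contribute: the
  second slot of the curvature gives 1 and the third gives 2, whence the 3. The derivative of the
  curvature itself vanishes by \<open>curv_vertical\<close>.\<close>

lemma fst_nabla_curv:
  "fst (nabla_curv T.\<Gamma> (horiz W) (vert X) (vert Y) (vert Y) q) = - ((3 * \<rho> * \<rho> * t) *\<^sub>R r (r (W x)))"
proof -
  have qT: "q \<in> TU" using q x by simp
  note sH = smooth_horiz[OF W] and sX = smooth_vert[OF X] and sY = smooth_vert[OF Y]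
  note cX = T.LC.smooth_cov_deriv[OF sH sX] and cY = T.LC.smooth_cov_deriv[OF sH sY]
  \<comment> \<open>Here the choice of base point acts: y is a multiple of X, so R(y, X) =
    0.\<close>
  have fX: "fst (cov_deriv T.\<Gamma> (horiz W) (vert X) q) = 0"
    using fst_cov_deriv_horiz_vert[OF qT X, of W] by (simp add: q R_base_point R_diag)
  have fY: "fst (cov_deriv T.\<Gamma> (horiz W) (vert Y) q) = (\<rho> * t) *\<^sub>R r (W x)"
    using fst_cov_deriv_horiz_vert[OF qT Y, of W] by (simp add: q R_base_point r)
  have "cov_deriv T.\<Gamma> (horiz W) (curv T.\<Gamma> (vert X) (vert Y) (vert Y)) q = cov_deriv T.\<Gamma> (horiz W) (\<lambda>z. 0) q"
    by (rule cov_deriv_cong_open[OF open_TU qT curv_vertical[OF _ X Y Y]])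
  also have "\<dots> = 0" by (simp add: cov_deriv_def bilinear_rzero[OF T.\<Gamma>_bil[OF qT]])
  finally have 0: "cov_deriv T.\<Gamma> (horiz W) (curv T.\<Gamma> (vert X) (vert Y) (vert Y)) q = 0" .
  have vX: "vert X q = (0, X x)" and vY: "vert Y q = (0, Y x)" by (simp_all add: vert_def q)
  have R0: "R x u v 0 = 0" for u v by (rule linear_0[OF LC.linear_curv_tensor(3)[OF x]])
  have 1: "fst (curv T.\<Gamma> (cov_deriv T.\<Gamma> (horiz W) (vert X)) (vert Y) (vert Y) q) = 0"
    unfolding fst_curv[OF qT cX sY sY] vY frame_vertical[OF qT] curv_theta_horizontal_vertical[OF qT] fX
    by (simp add: q R0)
  have 2: "fst (curv T.\<Gamma> (vert X) (cov_deriv T.\<Gamma> (horiz W) (vert Y)) (vert Y) q) = (\<rho> * \<rho> * t) *\<^sub>R r (r (W x))"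
    unfolding curv_antisym[OF qT cY sX sY] fst_uminus fst_curv[OF qT cY sX sY] vX vY frame_vertical[OF qT]
      curv_theta_horizontal_vertical[OF qT] fY
    by (simp add: q R_base_point R_diag r[symmetric] linear_scale[OF linear_r])
  have 3: "fst (curv T.\<Gamma> (vert X) (vert Y) (cov_deriv T.\<Gamma> (horiz W) (vert Y)) q) = (2 * \<rho> * \<rho> * t) *\<^sub>R r (r (W x))"
    unfolding fst_curv[OF qT sX sY cY] vX vY curv_theta_vertical_vertical[OF qT] frame_def fst_conv fY
    by (simp add: q R_base_point R_diag R0 r[symmetric] linear_scale[OF linear_r])
  have "(3 * \<rho> * \<rho> * t) *\<^sub>R v = (\<rho> * \<rho> * t) *\<^sub>R v + (2 * \<rho> * \<rho> * t) *\<^sub>R v" for v :: 'e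
    by (simp add: scaleR_left_distrib[symmetric])
  then show ?thesis unfolding nabla_curv_def 0 fst_diff 1 2 3 by simp
qed

text \<open>Pairing the horizontal part with \<open>W x\<close> removes \<alpha>3 and \<alpha>4,
  since g(r W, W) = 0, and turns r (r W) into the nonzero number -g(r W, r W). The left side carries
  t and the \<alpha>2 term t^2, so one factor t cancels.\<close>

lemma weak_symmetry_factor:
  assumes eq: "nabla_curv T.\<Gamma> (horiz W) (vert X) (vert Y) (vert Y) q =
      \<alpha>1 *\<^sub>R curv T.\<Gamma> (vert X) (vert Y) (vert Y) q + \<alpha>2 *\<^sub>R curv T.\<Gamma> (horiz W) (vert Y) (vert Y) q
      + \<alpha>3 *\<^sub>R curv T.\<Gamma> (vert X) (horiz W) (vert Y) q + \<alpha>4 *\<^sub>R curv T.\<Gamma> (vert X) (vert Y) (horiz W) q"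
    and t: "t \<noteq> 0" and nz: "r (W x) \<noteq> 0"
  shows "\<alpha>2 * t = 3"
proof -
  have qT: "q \<in> TU" using q x by simp
  note sH = smooth_horiz[OF W] and sX = smooth_vert[OF X] and sY = smooth_vert[OF Y]
  have vX: "vert X q = (0, X x)" and vY: "vert Y q = (0, Y x)" by (simp_all add: vert_def q)
  have fH: "fst (horiz W q) = W x" by (simp add: horiz_def q)
  have R0: "R x u v 0 = 0" for u v by (rule linear_0[OF LC.linear_curv_tensor(3)[OF x]])
  have 2: "fst (curv T.\<Gamma> (horiz W) (vert Y) (vert Y) q) = - ((\<rho> * \<rho> * t * t) *\<^sub>R r (r (W x)))"
    unfolding fst_curv[OF qT sH sY sY] vY frame_vertical[OF qT] curv_theta_horizontal_vertical[OF qT] fH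
    by (simp add: q R_base_point R_diag r[symmetric] linear_scale[OF linear_r])
  have 3: "fst (curv T.\<Gamma> (vert X) (horiz W) (vert Y) q) = \<rho> *\<^sub>R r (W x)"
    unfolding curv_antisym[OF qT sH sX sY] fst_uminus fst_curv[OF qT sH sX sY] vX vY frame_vertical[OF qT]
      curv_theta_horizontal_vertical[OF qT] fH
    by (simp add: q R_base_point R_diag r[symmetric])
  have 4: "fst (curv T.\<Gamma> (vert X) (vert Y) (horiz W) q) = (2 * \<rho>) *\<^sub>R r (W x)"
    unfolding fst_curv[OF qT sX sY sH] vX vY curv_theta_vertical_vertical[OF qT] frame_def fst_conv fH
    by (simp add: q R_base_point R_diag R0 r[symmetric])
  let ?w = "r (W x)"
  have "- ((3 * \<rho> * \<rho> * t) *\<^sub>R r ?w) = \<alpha>2 *\<^sub>R - ((\<rho> * \<rho> * t * t) *\<^sub>R r ?w) + \<alpha>3 *\<^sub>R \<rho> *\<^sub>R ?w + \<alpha>4 *\<^sub>R (2 * \<rho>) *\<^sub>R ?w"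
    using arg_cong[OF eq, of fst] unfolding fst_nabla_curv curv_vertical[OF qT X Y Y]
    by (simp add: 2 3 4)
  then have "g x (- ((3 * \<rho> * \<rho> * t) *\<^sub>R r ?w)) (W x) =
      g x (\<alpha>2 *\<^sub>R - ((\<rho> * \<rho> * t * t) *\<^sub>R r ?w) + \<alpha>3 *\<^sub>R \<rho> *\<^sub>R ?w + \<alpha>4 *\<^sub>R (2 * \<rho>) *\<^sub>R ?w) (W x)"
    by simp
  moreover have "g x (r ?w) (W x) = - g x ?w ?w"
    using R_skew[OF x, of "X x" "Y x" ?w "W x"] by (simp add: r)
  moreover have "g x ?w (W x) = 0" by (simp add: r g_R_self[OF x])
  ultimately have "3 * \<rho> * \<rho> * t * g x ?w ?w = \<alpha>2 * (\<rho> * \<rho> * t * t * g x ?w ?w)"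
    by (auto simp: bilinear_ladd[OF g_bil[OF x]] bilinear_lsub[OF g_bil[OF x]] bilinear_lmul[OF g_bil[OF x]] bilinear_lneg[OF g_bil[OF x]])
  then have "(\<rho> * \<rho> * t * g x ?w ?w) * 3 = (\<rho> * \<rho> * t * g x ?w ?w) * (\<alpha>2 * t)" by (simp add: mult_ac)
  moreover have "\<rho> * \<rho> * t * g x ?w ?w \<noteq> 0" using \<rho>_pos t g_pos[OF x nz] by simp
  ultimately show ?thesis by (metis mult_cancel_left)
qed

end

end

section \<open>Fields on a manifold in charts\<close>

lemma bracket_cong_open:
  assumes "open V" "x \<in> V" "\<And>z. z \<in> V \<Longrightarrow> X z = X' z" "\<And>z. z \<in> V \<Longrightarrow> Y z = Y' z"
  shows "bracket X Y x = bracket X' Y' x"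
  unfolding bracket_def
  using FD_cong_open[of V x X X', OF assms(1-3)] FD_cong_open[of V x Y Y', OF assms(1,2,4)] assms by simp

lemma cov_deriv_cong_open2:
  assumes "open V" "x \<in> V" "X x = X' x" "\<And>z. z \<in> V \<Longrightarrow> s z = s' z"
  shows "cov_deriv \<theta> X s x = cov_deriv \<theta> X' s' x"
  unfolding cov_deriv_def using FD_cong_open[of V x s s', OF assms(1,2,4)] assms by simp

lemma curv_cong_open:
  assumes "open V" "x \<in> V" "\<And>z. z \<in> V \<Longrightarrow> X z = X' z" "\<And>z. z \<in> V \<Longrightarrow> Y z = Y' z" "\<And>z. z \<in> V \<Longrightarrow> s z = s' z"
  shows "curv \<theta> X Y s x = curv \<theta> X' Y' s' x"
proof -
  have "cov_deriv \<theta> X (cov_deriv \<theta> Y s) x = cov_deriv \<theta> X' (cov_deriv \<theta> Y' s') x"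
    using assms by (intro cov_deriv_cong_open2[OF assms(1)]) auto
  moreover have "cov_deriv \<theta> Y (cov_deriv \<theta> X s) x = cov_deriv \<theta> Y' (cov_deriv \<theta> X' s') x"
    using assms by (intro cov_deriv_cong_open2[OF assms(1)]) auto
  moreover have "cov_deriv \<theta> (bracket X Y) s x = cov_deriv \<theta> (bracket X' Y') s' x"
    using bracket_cong_open[of V x X X' Y Y', OF assms(1-4)] assms(5)
    by (intro cov_deriv_cong_open2[OF assms(1,2)]) auto
  ultimately show ?thesis by (simp add: curv_def)
qed

lemma christoffel_levi_civita: "christoffel M g i = levi_civita (metric_comp M g i)"
  by (intro ext) (simp add: christoffel_def levi_civita_def koszul_def)

lemma vf_comp_cmap: "inj_on (cmap K i) (cdom K i) \<Longrightarrow> i \<in> charts_at K p \<Longrightarrow> vf_comp K X i (cmap K i p) = X p i"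
  by (simp add: vf_comp_def cinv_def charts_at_def)

text \<open>What the chartwise computation of curvature asks of a single chart. It is instantiated
  for charts of M and for induced charts of TM.\<close>

locale chart_of =
  fixes K :: "('b, 'i, 'f::euclidean_space) atlas" and h :: "('b, 'i, 'f) tensor2" and i :: 'i
  assumes label: "i \<in> labels K" and inj: "inj_on (cmap K i) (cdom K i)" and op: "open (cran K i)"
begin

abbreviation cp where "cp X \<equiv> vf_comp K X i"

abbreviation C where "C \<equiv> levi_civita (metric_comp K h i)"

lemma cmap_cinv: "x \<in> cran K i \<Longrightarrow> cmap K i (cinv K i x) = x"
  by (auto simp: cran_def cinv_def inj)

lemma cinv_charts: "x \<in> cran K i \<Longrightarrow> i \<in> charts_at K (cinv K i x)"
  using label by (auto simp: charts_at_def cran_def cinv_def inj)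

lemma cp_nabla: "x \<in> cran K i \<Longrightarrow> cp (nabla K h X Y) x = cov_deriv C (cp X) (cp Y) x"
  using cinv_charts[of x] cmap_cinv[of x]
  by (simp add: vf_comp_def[of K _ i x] nabla_def cov_deriv_def christoffel_levi_civita)

lemma cp_lie_bracket: "x \<in> cran K i \<Longrightarrow> cp (lie_bracket K X Y) x = bracket (cp X) (cp Y) x"
  using cinv_charts[of x] cmap_cinv[of x] by (simp add: vf_comp_def[of K _ i x] lie_bracket_def bracket_def)

lemma cp_curvature:
  assumes x: "x \<in> cran K i"
  shows "cp (curvature K h X Y Z) x = curv C (cp X) (cp Y) (cp Z) x"
proof -
  have "cp (curvature K h X Y Z) x = cp (nabla K h X (nabla K h Y Z)) x - cp (nabla K h Y (nabla K h X Z)) x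
      - cp (nabla K h (lie_bracket K X Y) Z) x"
    by (simp add: vf_comp_def curvature_def)
  moreover have "cov_deriv C (cp X) (cp (nabla K h Y Z)) x = cov_deriv C (cp X) (cov_deriv C (cp Y) (cp Z)) x" for X Y
    by (rule cov_deriv_cong_open[OF op x cp_nabla])
  moreover have "cov_deriv C (cp (lie_bracket K X Y)) (cp Z) x = cov_deriv C (bracket (cp X) (cp Y)) (cp Z) x"
    using cp_lie_bracket[OF x] by (intro cov_deriv_cong_open2[OF op x]) auto
  ultimately show ?thesis by (simp add: cp_nabla[OF x] curv_def)
qed

lemma cp_nabla_curvature:
  assumes x: "x \<in> cran K i"
  shows "cp (nabla_curvature K h W X Y Z) x = nabla_curv C (cp W) (cp X) (cp Y) (cp Z) x"
proof -
  have "cp (nabla_curvature K h W X Y Z) x = cp (nabla K h W (curvature K h X Y Z)) x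
      - cp (curvature K h (nabla K h W X) Y Z) x - cp (curvature K h X (nabla K h W Y) Z) x
      - cp (curvature K h X Y (nabla K h W Z)) x"
    by (simp add: vf_comp_def nabla_curvature_def)
  moreover have "cov_deriv C (cp W) (cp (curvature K h X Y Z)) x = cov_deriv C (cp W) (curv C (cp X) (cp Y) (cp Z)) x"
    by (rule cov_deriv_cong_open[OF op x cp_curvature])
  moreover have "curv C (cp (nabla K h W X)) (cp Y) (cp Z) x = curv C (cov_deriv C (cp W) (cp X)) (cp Y) (cp Z) x"
    by (rule curv_cong_open[OF op x cp_nabla refl refl])
  moreover have "curv C (cp X) (cp (nabla K h W Y)) (cp Z) x = curv C (cp X) (cov_deriv C (cp W) (cp Y)) (cp Z) x"
    by (rule curv_cong_open[OF op x refl cp_nabla refl])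
  moreover have "curv C (cp X) (cp Y) (cp (nabla K h W Z)) x = curv C (cp X) (cp Y) (cov_deriv C (cp W) (cp Z)) x"
    by (rule curv_cong_open[OF op x refl refl cp_nabla])
  ultimately show ?thesis by (simp add: cp_nabla[OF x] cp_curvature[OF x] nabla_curv_def)
qed

end

lemma curvature_outside: "i \<notin> charts_at K p \<Longrightarrow> curvature K h X Y Z p i = 0"
  by (simp add: curvature_def nabla_def)

lemma nabla_curvature_outside: "i \<notin> charts_at K p \<Longrightarrow> nabla_curvature K h W X Y Z p i = 0"
  by (simp add: nabla_curvature_def curvature_def nabla_def)

section \<open>Changes of charts\<close>

locale riemannian_atlas =
  fixes M :: "('a, 'i, 'e::euclidean_space) atlas" and g :: "('a, 'i, 'e) tensor2"
  assumes atlas: "smooth_atlas M" and metric: "riemannian_metric M g"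
begin

abbreviation "overlap i j \<equiv> cmap M i ` (cdom M i \<inter> cdom M j)"

abbreviation "tr \<equiv> transition M"

lemma chart_of_M: "i \<in> labels M \<Longrightarrow> chart_of M i"
  using atlas by (simp add: chart_of_def smooth_atlas_def)

lemma chart_metric_M: "i \<in> labels M \<Longrightarrow> chart_metric (cran M i) (metric_comp M g i)"
  using atlas metric unfolding smooth_atlas_def riemannian_metric_def chart_metric_def by blast

lemma inj_chart: "i \<in> labels M \<Longrightarrow> inj_on (cmap M i) (cdom M i)"
  using atlas by (simp add: smooth_atlas_def)

lemma open_cran: "i \<in> labels M \<Longrightarrow> open (cran M i)"
  using atlas by (simp add: smooth_atlas_def)

lemma charts_labels: "i \<in> charts_at M p \<Longrightarrow> i \<in> labels M"
  by (simp add: charts_at_def)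

lemma charts_cran: "i \<in> charts_at M p \<Longrightarrow> cmap M i p \<in> cran M i"
  by (auto simp: charts_at_def cran_def)

lemma charts_overlap: "i \<in> charts_at M p \<Longrightarrow> j \<in> charts_at M p \<Longrightarrow> cmap M i p \<in> overlap i j"
  by (auto simp: charts_at_def)

lemma overlap_charts:
  assumes "i \<in> labels M" "j \<in> labels M" "x \<in> overlap i j"
  obtains p where "i \<in> charts_at M p" "j \<in> charts_at M p" "x = cmap M i p"
  using assms by (auto simp: charts_at_def)

lemma open_overlap: "i \<in> labels M \<Longrightarrow> j \<in> labels M \<Longrightarrow> open (overlap i j)"
  using atlas by (simp add: smooth_atlas_def)

lemma smooth_transition: "i \<in> labels M \<Longrightarrow> j \<in> labels M \<Longrightarrow> smooth_on (overlap i j) (tr i j)"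
  using atlas by (simp add: smooth_atlas_def)

lemma transition_cmap: "i \<in> charts_at M p \<Longrightarrow> tr i j (cmap M i p) = cmap M j p"
  by (simp add: transition_def cinv_cmap[OF atlas])

lemma transition_differentiable:
  "i \<in> charts_at M p \<Longrightarrow> j \<in> charts_at M p \<Longrightarrow> tr i j differentiable (at (cmap M i p))"
  by (rule smooth_on_differentiable[OF smooth_transition charts_overlap]) (auto dest: charts_labels)

lemma FD_transition_self:
  assumes "i \<in> charts_at M p" shows "FD (tr i i) (cmap M i p) u = u"
proof -
  have "FD (tr i i) (cmap M i p) = FD (\<lambda>x. x) (cmap M i p)"
  proof (rule FD_cong_open[OF open_overlap charts_overlap])
    fix x assume "x \<in> overlap i i"
    then show "tr i i x = x"
      using charts_labels[OF assms] by (auto simp: transition_def cinv_def inj_chart)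
  qed (use assms charts_labels in auto)
  then show ?thesis by simp
qed

lemma FD_transition_compose:
  assumes "i \<in> charts_at M p" "j \<in> charts_at M p" "k \<in> charts_at M p"
  shows "FD (tr j k) (cmap M j p) (FD (tr i j) (cmap M i p) u) = FD (tr i k) (cmap M i p) u"
proof -
  note l = charts_labels[OF assms(1)] charts_labels[OF assms(2)] charts_labels[OF assms(3)]
  have d: "((\<lambda>x. tr j k (tr i j x)) has_derivative
      (\<lambda>u. FD (tr j k) (cmap M j p) (FD (tr i j) (cmap M i p) u))) (at (cmap M i p))"
    using diff_chain_at[OF FD_works[OF transition_differentiable[OF assms(1,2)]], of "tr j k"]
      FD_works[OF transition_differentiable[OF assms(2,3)]]
    by (simp add: transition_cmap[OF assms(1)] o_def)
  have "FD (tr i k) (cmap M i p) = FD (\<lambda>x. tr j k (tr i j x)) (cmap M i p)"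
  proof (rule FD_cong_open[OF open_overlap[OF l(1,2)] charts_overlap[OF assms(1,2)]])
    fix x assume "x \<in> overlap i j"
    then show "tr i k x = tr j k (tr i j x)"
      by (rule overlap_charts[OF l(1,2)]) (simp add: transition_cmap)
  qed
  then show ?thesis by (simp add: FD_unique[OF d])
qed

lemma tvec_of_in: "i \<in> charts_at M p \<Longrightarrow> tvec_of M i p u \<in> tangent_space M p"
  by (simp add: tangent_space_def tvec_of_def FD_transition_compose)

lemma tvec_of_self: "i \<in> charts_at M p \<Longrightarrow> tvec_of M i p u i = u"
  by (simp add: tvec_of_def FD_transition_self)

lemma tvec_of_at: "j \<in> charts_at M p \<Longrightarrow> tvec_of M i p u j = FD (tr i j) (cmap M i p) u"
  by (simp add: tvec_of_def)

text \<open>Both sides evaluate \<open>g\<close> on the same tangent vectors, described in two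
  charts.\<close>

lemma metric_comp_transition:
  assumes "i \<in> labels M" "j \<in> labels M" "x \<in> overlap i j"
  shows "metric_comp M g i x u v = metric_comp M g j (tr i j x) (FD (tr i j) x u) (FD (tr i j) x v)"
proof (rule overlap_charts[OF assms])
  fix p assume p: "i \<in> charts_at M p" "j \<in> charts_at M p" "x = cmap M i p"
  have "tvec_of M j p (FD (tr i j) x u) = tvec_of M i p u" for u
    using tvec_of_component[OF tvec_of_in[OF p(1)] p(2), of u] by (simp add: tvec_of_at[OF p(2)] p(3))
  then show ?thesis
    using p by (simp add: metric_comp_def cinv_cmap[OF atlas] transition_cmap[OF p(1)])
qed

text \<open>The classical inhomogeneous transformation law, obtained from uniqueness: the connection
  of chart \<open>j\<close>, pulled back to chart \<open>i\<close>, is symmetric and compatible with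
  the metric there.\<close>

lemma christoffel_transition:
  assumes i: "i \<in> charts_at M p" and j: "j \<in> charts_at M p"
  shows "FD (tr i j) (cmap M i p) (christoffel M g i (cmap M i p) u v) =
    FD (\<lambda>x. FD (tr i j) x u) (cmap M i p) v
    + christoffel M g j (cmap M j p) (FD (tr i j) (cmap M i p) u) (FD (tr i j) (cmap M i p) v)"
proof -
  note l = charts_labels[OF i] charts_labels[OF j]
  interpret I: chart_metric "cran M i" "metric_comp M g i" by (rule chart_metric_M[OF l(1)])
  interpret J: chart_metric "cran M j" "metric_comp M g j" by (rule chart_metric_M[OF l(2)])
  note O = open_overlap[OF l]
  define x where "x = cmap M i p"
  define y where "y = cmap M j p"
  have xO: "x \<in> overlap i j" using charts_overlap[OF i j] by (simp add: x_def)
  have xi: "x \<in> cran M i" and yj: "y \<in> cran M j"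
    using charts_cran i j by (auto simp: x_def y_def)
  have tr_x: "tr i j x = y" using transition_cmap[OF i] by (simp add: x_def y_def)
  have trd: "tr i j differentiable (at x)" using transition_differentiable[OF i j] by (simp add: x_def)
  define D where "D = FD (tr i j) x"
  define E where "E = FD (tr j i) y"
  define H where "H u v = FD (\<lambda>x. FD (tr i j) x u) x v" for u v
  \<comment> \<open>The pulled-back connection; \<open>E\<close> inverts the differential
    \<open>D\<close>, and \<open>H\<close> is the second derivative of the transition map.\<close>
  define B where "B u v = E (H u v + J.\<Gamma> y (D u) (D v))" for u v
  have DE: "D (E u) = u" for u
    using FD_transition_compose[OF j i j] FD_transition_self[OF j] by (simp add: D_def E_def x_def y_def)
  have "times_differentiable_on 2 (overlap i j) (tr i j)"
    using smooth_transition[OF l] by (simp add: smooth_on_def)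
  then have H_sym: "H u v = H v u" for u v
    unfolding H_def by (rule FD_FD_sym[OF O xO])
  have DB: "D (B u v) = H u v + J.\<Gamma> y (D u) (D v)" for u v by (simp add: B_def DE)
  have "I.\<Gamma> x u v = B u v"
  proof (rule I.\<Gamma>_unique[OF xi])
    show "B u v = B v u" for u v by (simp add: B_def H_sym[of u v] J.\<Gamma>_sym[OF yj, of "D u"])
    fix u v w
    have dH: "(\<lambda>x. FD (tr i j) x u) differentiable (at x)" for u
      by (rule smooth_on_differentiable[OF smooth_on_FD[OF smooth_transition[OF l]] xO])
    have dg: "((\<lambda>z. metric_comp M g j (tr i j z) u v) has_derivative
        (\<lambda>w. FD (\<lambda>z. metric_comp M g j z u v) y (D w))) (at x)" for u v
      using diff_chain_at[OF FD_works[OF trd], of "\<lambda>z. metric_comp M g j z u v"] FD_works[OF J.g_diff[OF yj]]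
      by (simp add: tr_x o_def D_def)
    have tr_cran: "tr i j z \<in> cran M j" if "z \<in> overlap i j" for z
      by (rule overlap_charts[OF l that]) (simp add: transition_cmap charts_cran)
    have "((\<lambda>z. metric_comp M g j (tr i j z) (FD (tr i j) z u) (FD (tr i j) z v)) has_derivative
        (\<lambda>w. FD (\<lambda>z. metric_comp M g j (tr i j z) (D u) (D v)) x w
          + metric_comp M g j (tr i j x) (H u w) (D v) + metric_comp M g j (tr i j x) (D u) (H v w))) (at x)"
      unfolding D_def H_def
      by (rule has_derivative_family2[where B = "\<lambda>z. metric_comp M g j (tr i j z)", OF O xO J.g_bil[OF tr_cran]
            differentiableI[OF dg] dH dH])
    then have e: "FD (\<lambda>z. metric_comp M g j (tr i j z) (FD (tr i j) z u) (FD (tr i j) z v)) x w =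
        FD (\<lambda>z. metric_comp M g j z (D u) (D v)) y (D w)
          + metric_comp M g j y (H u w) (D v) + metric_comp M g j y (D u) (H v w)"
      using FD_unique[OF dg] by (simp add: FD_unique tr_x)
    have "FD (\<lambda>y. metric_comp M g i y u v) x w =
        FD (\<lambda>z. metric_comp M g j (tr i j z) (FD (tr i j) z u) (FD (tr i j) z v)) x w"
      using FD_cong_open[OF O xO metric_comp_transition[OF l]] by simp
    also have "\<dots> = metric_comp M g j y (D (B w u)) (D v) + metric_comp M g j y (D u) (D (B w v))"
      unfolding e J.\<Gamma>_compat[OF yj] DB H_sym[of w]
      by (simp add: bilinear_ladd[OF J.g_bil[OF yj]] bilinear_radd[OF J.g_bil[OF yj]])
    also have "\<dots> = metric_comp M g i x (B w u) v + metric_comp M g i x u (B w v)"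
      by (simp add: metric_comp_transition[OF l xO] tr_x D_def)
    finally show "FD (\<lambda>y. metric_comp M g i y u v) x w = metric_comp M g i x (B w u) v + metric_comp M g i x u (B w v)" .
  qed
  then have "D (I.\<Gamma> x u v) = H u v + J.\<Gamma> y (D u) (D v)" by (simp add: DB)
  then show ?thesis by (simp add: christoffel_levi_civita D_def H_def x_def y_def)
qed

end

lemma nabla_curv_cong_open:
  assumes V: "open V" "x \<in> V" and W: "\<And>z. z \<in> V \<Longrightarrow> W z = W' z" and X: "\<And>z. z \<in> V \<Longrightarrow> X z = X' z"
    and Y: "\<And>z. z \<in> V \<Longrightarrow> Y z = Y' z" and Z: "\<And>z. z \<in> V \<Longrightarrow> Z z = Z' z"
  shows "nabla_curv \<theta> W X Y Z x = nabla_curv \<theta> W' X' Y' Z' x"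
proof -
  have c: "cov_deriv \<theta> W s z = cov_deriv \<theta> W' s' z" if "z \<in> V" "\<And>z. z \<in> V \<Longrightarrow> s z = s' z" for s s' z
    using that W by (intro cov_deriv_cong_open2[OF V(1)]) auto
  have "cov_deriv \<theta> W (curv \<theta> X Y Z) x = cov_deriv \<theta> W' (curv \<theta> X' Y' Z') x"
    by (rule c[OF V(2) curv_cong_open[OF V(1) _ X Y Z]])
  moreover have "curv \<theta> (cov_deriv \<theta> W X) Y Z x = curv \<theta> (cov_deriv \<theta> W' X') Y' Z' x"
    by (rule curv_cong_open[OF V c[OF _ X] Y Z])
  moreover have "curv \<theta> X (cov_deriv \<theta> W Y) Z x = curv \<theta> X' (cov_deriv \<theta> W' Y') Z' x"
    by (rule curv_cong_open[OF V X c[OF _ Y] Z])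
  moreover have "curv \<theta> X Y (cov_deriv \<theta> W Z) x = curv \<theta> X' Y' (cov_deriv \<theta> W' Z') x"
    by (rule curv_cong_open[OF V X Y c[OF _ Z]])
  ultimately show ?thesis by (simp add: nabla_curv_def)
qed

lemma vector_field_smooth: "vector_field M X \<Longrightarrow> i \<in> labels M \<Longrightarrow> smooth_on (cran M i) (vf_comp M X i)"
  by (simp add: vector_field_def)

lemma vector_field_in: "vector_field M X \<Longrightarrow> p \<in> points M \<Longrightarrow> X p \<in> tangent_space M p"
  by (simp add: vector_field_def)

lemma charts_at_points: "i \<in> charts_at M p \<Longrightarrow> p \<in> points M"
  by (auto simp: charts_at_def points_def)

section \<open>The tangent bundle\<close>

context riemannian_atlas
begin

abbreviation "N \<equiv> tangent_bundle M"

lemma labels_N [simp]: "labels N = labels M"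
  by (simp add: tangent_bundle_def)

lemma cmap_N [simp]: "cmap N i (p, y) = (cmap M i p, y i)"
  by (simp add: tangent_bundle_def)

lemma cdom_N: "(p, y) \<in> cdom N i \<longleftrightarrow> p \<in> cdom M i \<and> y \<in> tangent_space M p"
  by (simp add: tangent_bundle_def)

lemma charts_at_N: "y \<in> tangent_space M p \<Longrightarrow> charts_at N (p, y) = charts_at M p"
  by (simp add: charts_at_def cdom_N)

lemma points_N: "(p, y) \<in> points N \<longleftrightarrow> p \<in> points M \<and> y \<in> tangent_space M p"
  by (simp add: points_def cdom_N)

lemma tangent_space_zero: "(\<lambda>i. 0) \<in> tangent_space M p"
  by (simp add: tangent_space_def linear_0[OF linear_transition[OF atlas]])

lemma tangent_space_at:
  "y \<in> tangent_space M p \<Longrightarrow> i \<in> charts_at M p \<Longrightarrow> j \<in> charts_at M p \<Longrightarrow> y j = FD (tr i j) (cmap M i p) (y i)"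
  unfolding tangent_space_def by blast

lemma tangent_space_scale:
  assumes y: "y \<in> tangent_space M p" shows "(\<lambda>i. t *\<^sub>R y i) \<in> tangent_space M p"
  unfolding tangent_space_def
proof (clarify, intro conjI allI impI ballI)
  show "t *\<^sub>R y i = 0" if "i \<notin> charts_at M p" for i using tangent_space_outside[OF y that] by simp
  show "t *\<^sub>R y j = FD (tr i j) (cmap M i p) (t *\<^sub>R y i)" if i: "i \<in> charts_at M p" and j: "j \<in> charts_at M p" for i j
    unfolding tangent_space_at[OF y i j] by (rule linear_scale[OF linear_transition[OF atlas i j], symmetric])
qed

lemma inj_N:
  assumes i: "i \<in> labels M" shows "inj_on (cmap N i) (cdom N i)"
proof (rule inj_onI, clarify)
  fix p y p' y'
  assume d: "(p, y) \<in> cdom N i" "(p', y') \<in> cdom N i" and e: "cmap N i (p, y) = cmap N i (p', y')"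
  then have "p = p'" using inj_chart[OF i] by (auto simp: cdom_N inj_on_def)
  moreover from this have "y = y'"
    using d e tvec_of_component[of y M p i] tvec_of_component[of y' M p i] i by (auto simp: cdom_N charts_at_def)
  ultimately show "p = p' \<and> y = y'" by simp
qed

lemma cran_N:
  assumes i: "i \<in> labels M" shows "cran N i = cran M i \<times> UNIV"
proof -
  have "(cmap M i p, y) \<in> cran N i" if "p \<in> cdom M i" for p y
    using that i tvec_of_in[of i p y] tvec_of_self[of i p y]
    unfolding cran_def by (intro image_eqI[where x = "(p, tvec_of M i p y)"]) (auto simp: cdom_N charts_at_def)
  then show ?thesis by (auto simp: cran_def cdom_N)
qed

lemma open_cran_N: "i \<in> labels M \<Longrightarrow> open (cran N i)"
  by (simp add: cran_N open_Times open_cran)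

lemma chart_of_N: "i \<in> labels M \<Longrightarrow> chart_of N i"
  by (simp add: chart_of_def inj_N open_cran_N)

lemma cinv_N:
  assumes i: "i \<in> charts_at M p"
  shows "cinv N i (cmap M i p, y) = (p, tvec_of M i p y)"
  unfolding cinv_def
  using i tvec_of_in[OF i, of y] tvec_of_self[OF i, of y] charts_labels[OF i]
  by (intro inv_into_f_eq inj_N) (auto simp: cdom_N charts_at_def)

lemma transition_N:
  assumes "i \<in> charts_at M p" "j \<in> charts_at M p"
  shows "transition N i j (cmap M i p, y) = (cmap M j p, FD (tr i j) (cmap M i p) y)"
  by (simp add: transition_def cinv_N[OF assms(1)] tvec_of_at[OF assms(2)])

text \<open>The induced coordinate change is linear in the fibre, with the differential of the base
  change as its matrix. The second derivative of the base change is the term that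
  \<open>christoffel_transition\<close> compensates.\<close>

lemma FD_transition_N:
  assumes i: "i \<in> charts_at M p" and j: "j \<in> charts_at M p"
  shows "FD (transition N i j) (cmap M i p, y) V = (FD (tr i j) (cmap M i p) (fst V),
    FD (\<lambda>x. FD (tr i j) x y) (cmap M i p) (fst V) + FD (tr i j) (cmap M i p) (snd V))"
proof -
  note l = charts_labels[OF i] charts_labels[OF j]
  let ?O = "overlap i j \<times> (UNIV :: 'e set)"
  let ?q = "(cmap M i p, y)"
  have O: "open ?O" by (simp add: open_Times open_overlap[OF l])
  have q: "?q \<in> ?O" using charts_overlap[OF i j] by simp
  have "transition N i j z = (tr i j (fst z), FD (tr i j) (fst z) (snd z))" if "z \<in> ?O" for z
  proof -
    have "fst z \<in> overlap i j" using that by auto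
    then show ?thesis
      by (rule overlap_charts[OF l]) (metis prod.collapse transition_N transition_cmap)
  qed
  then have "FD (transition N i j) ?q = FD (\<lambda>z. (tr i j (fst z), FD (tr i j) (fst z) (snd z))) ?q"
    by (rule FD_cong_open[OF O q])
  moreover have lin: "linear (FD (tr i j) x)" if "x \<in> overlap i j" for x
    by (rule linear_FD[OF smooth_on_differentiable[OF smooth_transition[OF l] that]])
  note sm = smooth_on_FD[OF smooth_transition[OF l]]
  have d1: "((\<lambda>z. tr i j (fst z)) has_derivative (\<lambda>V. FD (tr i j) (cmap M i p) (fst V))) (at ?q)"
    using has_derivative_compose_fst[of "tr i j" ?q] transition_differentiable[OF i j] by simp
  have d2: "(\<lambda>z. FD (tr i j) (fst z) (snd z)) differentiable (at ?q)"
    by (rule smooth_on_differentiable[OF smooth_family_snd[where B = "\<lambda>x. FD (tr i j) x", OF open_overlap[OF l] lin sm] q])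
  have "FD (\<lambda>z. (tr i j (fst z), FD (tr i j) (fst z) (snd z))) ?q V =
      (FD (\<lambda>z. tr i j (fst z)) ?q V, FD (\<lambda>z. FD (tr i j) (fst z) (snd z)) ?q V)"
    by (rule FD_Pair[OF differentiableI[OF d1] d2])
  ultimately show ?thesis
    using FD_family_snd[where B = "\<lambda>x. FD (tr i j) x", OF open_overlap[OF l] lin sm q, of V]
    by (simp add: FD_unique[OF d1])
qed

lemma hpart_tvec_of_N:
  assumes i: "i \<in> charts_at M p" and y: "y \<in> tangent_space M p"
  shows "hpart (tvec_of N i (p, y) V) = tvec_of M i p (fst V)"
  by (auto simp: hpart_def tvec_of_def charts_at_N[OF y] FD_transition_N[OF i])

text \<open>The second derivatives of the transition map cancel, so the vertical part transforms
  like a tangent vector of M.\<close>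

lemma vpart_tvec_of_N:
  assumes i: "i \<in> charts_at M p" and y: "y \<in> tangent_space M p"
  shows "vpart M g (p, y) (tvec_of N i (p, y) V) =
    tvec_of M i p (snd V + christoffel M g i (cmap M i p) (y i) (fst V))"
proof
  fix j
  show "vpart M g (p, y) (tvec_of N i (p, y) V) j =
    tvec_of M i p (snd V + christoffel M g i (cmap M i p) (y i) (fst V)) j"
  proof (cases "j \<in> charts_at M p")
    case True
    then show ?thesis
      using christoffel_transition[OF i True, of "y i" "fst V"] tangent_space_at[OF y i True]
      by (simp add: vpart_def tvec_of_def charts_at_N[OF y] FD_transition_N[OF i True]
          linear_add[OF linear_transition[OF atlas i True]])
  qed (simp add: vpart_def tvec_of_def)
qed

text \<open>Horizontal and vertical parts of a vector given in an induced chart are again given by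
  \<open>tvec_of\<close>, so each summand of the lift becomes a chart expression of
  \<open>g\<close>.\<close>

lemma lifted_metric_N:
  assumes i: "i \<in> labels M" and "a > 0" "a * (a + c) - b\<^sup>2 > 0"
  shows "lifted_metric (cran M i) (metric_comp M g i) a b c (metric_comp N (lift_metric a b c M g) i)"
proof -
  show ?thesis
  proof (rule lifted_metric.intro[OF chart_metric_M[OF i] lifted_metric_axioms.intro[OF assms(2,3)]])
    fix x y V W assume x: "x \<in> cran M i"
    then obtain p where p: "i \<in> charts_at M p" "x = cmap M i p" using i by (auto simp: cran_def charts_at_def)
    note y = tvec_of_in[OF p(1), of y]
    show "metric_comp N (lift_metric a b c M g) i (x, y) V W =
      a * (metric_comp M g i x (fst V) (fst W)
        + metric_comp M g i x (snd V + levi_civita (metric_comp M g i) x y (fst V)) (snd W + levi_civita (metric_comp M g i) x y (fst W)))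
      + b * (metric_comp M g i x (fst V) (snd W + levi_civita (metric_comp M g i) x y (fst W))
        + metric_comp M g i x (snd V + levi_civita (metric_comp M g i) x y (fst V)) (fst W))
      + c * metric_comp M g i x (fst V) (fst W)"
      unfolding metric_comp_def[of N] p(2) cinv_N[OF p(1)]
      by (simp add: lift_metric_def sasaki_lift_def horizontal_lift_def vertical_lift_def
          hpart_tvec_of_N[OF p(1) y] vpart_tvec_of_N[OF p(1) y] tvec_of_self[OF p(1)]
          christoffel_levi_civita metric_comp_def[of M] cinv_cmap[OF atlas p(1)])
  qed
qed

lemma hlift_in:
  assumes X: "X p \<in> tangent_space M p" and y: "y \<in> tangent_space M p"
  shows "hlift M g X (p, y) \<in> tangent_space N (p, y)"
  unfolding tangent_space_def[of N] charts_at_N[OF y]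
proof (clarify, intro conjI allI impI ballI)
  show "hlift M g X (p, y) i = 0" if "i \<notin> charts_at M p" for i
    using that by (simp add: hlift_def)
  fix i j assume i: "i \<in> charts_at M p" and j: "j \<in> charts_at M p"
  show "hlift M g X (p, y) j = FD (transition N i j) (cmap N i (p, y)) (hlift M g X (p, y) i)"
    using i j christoffel_transition[OF i j, of "y i" "X p i"] tangent_space_at[OF y i j] tangent_space_at[OF X i j]
    by (simp add: hlift_def FD_transition_N[OF i j] linear_neg[OF linear_transition[OF atlas i j]])
qed

lemma vlift_in:
  assumes X: "X p \<in> tangent_space M p" and y: "y \<in> tangent_space M p"
  shows "vlift M X (p, y) \<in> tangent_space N (p, y)"
  unfolding tangent_space_def[of N] charts_at_N[OF y]
proof (clarify, intro conjI allI impI ballI)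
  show "vlift M X (p, y) i = 0" if "i \<notin> charts_at M p" for i
    using that by (simp add: vlift_def)
  fix i j assume i: "i \<in> charts_at M p" and j: "j \<in> charts_at M p"
  have "FD (\<lambda>x. FD (tr i j) x (y i)) (cmap M i p) 0 = 0"
    by (rule linear_0[OF linear_FD[OF smooth_on_differentiable[OF
            smooth_on_FD[OF smooth_transition] charts_overlap[OF i j]]]]) (use i j charts_labels in auto)
  then show "vlift M X (p, y) j = FD (transition N i j) (cmap N i (p, y)) (vlift M X (p, y) i)"
    using i j tangent_space_at[OF X i j] linear_0[OF linear_transition[OF atlas i j]]
    by (simp add: vlift_def FD_transition_N[OF i j])
qed

end

locale riemannian_lift = riemannian_atlas M g
  for M :: "('a, 'i, 'e::euclidean_space) atlas" and g :: "('a, 'i, 'e) tensor2" +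
  fixes a b c :: real
  assumes a_pos: "a > 0" and det_pos: "a * (a + c) - b\<^sup>2 > 0"
begin

abbreviation "G \<equiv> lift_metric a b c M g"

lemmas lifted_metric_chart = lifted_metric_N[OF _ a_pos det_pos]

lemma vf_comp_lifts:
  assumes i: "i \<in> labels M" and z: "z \<in> cran N i"
  shows "vf_comp N (hlift M g X) i z = lifted_metric.horiz (metric_comp M g i) (vf_comp M X i) z"
    and "vf_comp N (vlift M X) i z = lifted_metric.vert (vf_comp M X i) z"
proof -
  interpret lifted_metric "cran M i" "metric_comp M g i" a b c "metric_comp N G i"
    by (rule lifted_metric_chart[OF i])
  have "fst z \<in> cran M i" using z i by (auto simp: cran_N)
  then obtain p where "p \<in> cdom M i" "fst z = cmap M i p" by (auto simp: cran_def)
  then obtain p y where p: "i \<in> charts_at M p" "z = (cmap M i p, y)"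
    using i that[of p "snd z"] by (auto simp: charts_at_def prod_eq_iff)
  show "vf_comp N (hlift M g X) i z = horiz (vf_comp M X i) z"
    using p by (simp add: vf_comp_def cinv_N hlift_def tvec_of_self horiz_def cinv_cmap[OF atlas] christoffel_levi_civita)
  show "vf_comp N (vlift M X) i z = vert (vf_comp M X i) z"
    using p by (simp add: vf_comp_def cinv_N vlift_def vert_def cinv_cmap[OF atlas])
qed

lemma vector_field_lifts:
  assumes X: "vector_field M X"
  shows "vector_field N (hlift M g X)" "vector_field N (vlift M X)"
proof -
  have *: "smooth_on (cran N i) (vf_comp N (hlift M g X) i) \<and> smooth_on (cran N i) (vf_comp N (vlift M X) i)"
    if i: "i \<in> labels M" for i
  proof -
    interpret lifted_metric "cran M i" "metric_comp M g i" a b c "metric_comp N G i"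
      by (rule lifted_metric_chart[OF i])
    note s = vector_field_smooth[OF X i]
    show ?thesis
      using smooth_on_cong[OF open_cran_N[OF i] vf_comp_lifts(1)[OF i, where X = X]]
        smooth_on_cong[OF open_cran_N[OF i] vf_comp_lifts(2)[OF i, where X = X]]
        smooth_horiz[OF s] smooth_vert[OF s] by (simp add: cran_N[OF i])
  qed
  show "vector_field N (hlift M g X)"
    using * vector_field_in[OF X] by (auto simp: vector_field_def points_N intro: hlift_in)
  show "vector_field N (vlift M X)"
    using * vector_field_in[OF X] by (auto simp: vector_field_def points_N intro: vlift_in)
qed

section \<open>From weak symmetry of TM to flatness of M\<close>

text \<open>Serves to drop the \<open>A\<close> term, whose coefficient pairs the vanishing
  curvature of vertical lifts with a horizontal lift.\<close>

lemma G_zero_left: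
  assumes p: "p \<in> points M" and y: "y \<in> tangent_space M p" and X: "X p \<in> tangent_space M p"
  shows "G (p, y) (\<lambda>i. 0) (hlift M g X (p, y)) = 0"
proof -
  have "vpart M g (p, y) (\<lambda>i. 0) = (\<lambda>i. 0)"
  proof (rule ext)
    fix i
    have "christoffel M g i (cmap M i p) (y i) 0 = 0" if i: "i \<in> charts_at M p"
      by (rule christoffel_zero[OF atlas metric charts_labels[OF i] charts_cran[OF i]])
    then show "vpart M g (p, y) (\<lambda>i. 0) i = 0" by (simp add: vpart_def)
  qed
  moreover have "hpart (\<lambda>i::'i. 0::'e \<times> 'e) = (\<lambda>i. 0)" by (simp add: hpart_def)
  ultimately show ?thesis
    by (simp add: lift_metric_def sasaki_lift_def horizontal_lift_def vertical_lift_def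
        hpart_hlift[where X = X and p = p, OF X] vpart_hlift metric_zero[OF atlas metric p X])
qed

lemma weakly_symmetric_imp_flat:
  assumes ws: "weakly_symmetric N G"
  shows "flat M g"
  unfolding flat_def
proof (intro allI impI ballI ext)
  fix X Y Z p i
  assume X: "vector_field M X" and Y: "vector_field M Y" and Z: "vector_field M Z" and p: "p \<in> points M"
  show "curvature M g X Y Z p i = 0"
  proof (rule ccontr)
    assume nz: "curvature M g X Y Z p i \<noteq> 0"
    then have i: "i \<in> charts_at M p" using curvature_outside[of i M p] by blast
    note l = charts_labels[OF i]
    interpret L: lifted_metric "cran M i" "metric_comp M g i" a b c "metric_comp N G i"
      by (rule lifted_metric_chart[OF l])
    interpret CM: chart_of M g i by (rule chart_of_M[OF l])
    interpret CN: chart_of N G i by (rule chart_of_N[OF l])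
    define x where "x = cmap M i p"
    have x: "x \<in> cran M i" using charts_cran[OF i] by (simp add: x_def)
    note sX = vector_field_smooth[OF X l] and sY = vector_field_smooth[OF Y l] and sZ = vector_field_smooth[OF Z l]
    have at: "vf_comp M V i x = V p i" for V unfolding x_def by (rule vf_comp_cmap[OF inj_chart[OF l] i])
    have "L.R x (vf_comp M X i x) (vf_comp M Y i x) (vf_comp M Z i x) = curvature M g X Y Z p i"
      using L.LC.curv_eq_tensor[OF x sX sY sZ] CM.cp_curvature[OF x, of X Y Z] at by simp
    with nz have nz': "L.R x (vf_comp M X i x) (vf_comp M Y i x) (vf_comp M Z i x) \<noteq> 0" by simp
    obtain \<alpha>1 \<alpha>2 \<alpha>3 \<alpha>4 A where \<alpha>2: "one_form N \<alpha>2" and eq: "\<And>W X Y Z q. vector_field N W \<Longrightarrow> vector_field N X \<Longrightarrow>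
        vector_field N Y \<Longrightarrow> vector_field N Z \<Longrightarrow> q \<in> points N \<Longrightarrow> nabla_curvature N G W X Y Z q = (\<lambda>i.
              \<alpha>1 q (W q) *\<^sub>R curvature N G X Y Z q i + \<alpha>2 q (X q) *\<^sub>R curvature N G W Y Z q i
            + \<alpha>3 q (Y q) *\<^sub>R curvature N G X W Z q i + \<alpha>4 q (Z q) *\<^sub>R curvature N G X Y W q i
            + G q (curvature N G X Y Z q) (W q) *\<^sub>R A q i)"
      using ws unfolding weakly_symmetric_def by blast
    note Xp = vector_field_in[OF X p]
    \<comment> \<open>The ray through \<open>X p\<close> in the fibre over \<open>p\<close>, on
      which weak symmetry is evaluated.\<close>
    define Q where "Q t = (p, \<lambda>j. t *\<^sub>R X p j)" for t
    have Qt: "(\<lambda>j. t *\<^sub>R X p j) \<in> tangent_space M p" for t by (rule tangent_space_scale[OF Xp])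
    have Q_points: "Q t \<in> points N" for t by (simp add: Q_def points_N p Qt)
    have iQ: "j \<in> charts_at N (Q t) \<longleftrightarrow> j \<in> charts_at M p" for t j by (simp add: Q_def charts_at_N[OF Qt])
    have cQ: "cmap N i (Q t) = (x, t *\<^sub>R vf_comp M X i x)" for t
      by (simp add: Q_def at) (simp add: x_def)
    define \<phi> where "\<phi> t = \<alpha>2 (Q t) (vlift M X (Q t))" for t
    let ?h = "hlift M g Z" and ?X = "vlift M X" and ?Y = "vlift M Y"
    note vf = vector_field_lifts(1)[OF Z] vector_field_lifts(2)[OF X] vector_field_lifts(2)[OF Y]
    \<comment> \<open>The components in all charts are required, because the curvature enters
      \<open>G\<close> as a whole tangent vector.\<close>
    have curv0: "curvature N G ?X ?Y ?Y q = (\<lambda>j. 0)" if "q \<in> points N" for q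
    proof
      fix j
      show "curvature N G ?X ?Y ?Y q j = 0"
      proof (cases "j \<in> charts_at N q")
        case True
        then have jl: "j \<in> labels M" by (simp add: charts_at_def)
        interpret J: lifted_metric "cran M j" "metric_comp M g j" a b c "metric_comp N G j"
          by (rule lifted_metric_chart[OF jl])
        interpret CJ: chart_of N G j by (rule chart_of_N[OF jl])
        have z: "cmap N j q \<in> cran N j" using True by (auto simp: cran_def charts_at_def)
        have "curvature N G ?X ?Y ?Y q j = curv CJ.C (CJ.cp ?X) (CJ.cp ?Y) (CJ.cp ?Y) (cmap N j q)"
          using CJ.cp_curvature[OF z] vf_comp_cmap[OF inj_N[OF jl] True] by metis
        also have "\<dots> = curv CJ.C (J.vert (vf_comp M X j)) (J.vert (vf_comp M Y j)) (J.vert (vf_comp M Y j)) (cmap N j q)"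
          by (rule curv_cong_open[OF CJ.op z vf_comp_lifts(2)[OF jl] vf_comp_lifts(2)[OF jl] vf_comp_lifts(2)[OF jl]])
        also have "\<dots> = 0"
          using z vector_field_smooth[OF X jl] vector_field_smooth[OF Y jl]
          by (intro J.curv_vertical) (auto simp: cran_N[OF jl])
        finally show ?thesis .
      qed (rule curvature_outside)
    qed
    have "\<phi> t * t = 3" if t: "t \<noteq> 0" for t
    proof -
      let ?q = "cmap N i (Q t)"
      have ch: "i \<in> charts_at N (Q t)" using i iQ by simp
      have z: "?q \<in> cran N i" using ch by (auto simp: cran_def charts_at_def)
      note at_q = vf_comp_cmap[OF inj_N[OF l] ch]
      note H = vf_comp_lifts(1)[OF l] and V = vf_comp_lifts(2)[OF l]
      have c: "curvature N G B C D (Q t) i = curv CN.C B' C' D' ?q"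
        if "\<And>z. z \<in> cran N i \<Longrightarrow> CN.cp B z = B' z" "\<And>z. z \<in> cran N i \<Longrightarrow> CN.cp C z = C' z"
          "\<And>z. z \<in> cran N i \<Longrightarrow> CN.cp D z = D' z" for B C D B' C' D'
      proof -
        have "curvature N G B C D (Q t) i = CN.cp (curvature N G B C D) ?q" by (rule at_q[symmetric])
        also have "\<dots> = curv CN.C (CN.cp B) (CN.cp C) (CN.cp D) ?q" by (rule CN.cp_curvature[OF z])
        also have "\<dots> = curv CN.C B' C' D' ?q" by (rule curv_cong_open[OF CN.op z that])
        finally show ?thesis .
      qed
      have "nabla_curvature N G ?h ?X ?Y ?Y (Q t) i =
          nabla_curv CN.C (L.horiz (vf_comp M Z i)) (L.vert (vf_comp M X i)) (L.vert (vf_comp M Y i)) (L.vert (vf_comp M Y i)) ?q"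
      proof -
        have "nabla_curvature N G ?h ?X ?Y ?Y (Q t) i = CN.cp (nabla_curvature N G ?h ?X ?Y ?Y) ?q"
          by (rule at_q[symmetric])
        also have "\<dots> = nabla_curv CN.C (CN.cp ?h) (CN.cp ?X) (CN.cp ?Y) (CN.cp ?Y) ?q"
          by (rule CN.cp_nabla_curvature[OF z])
        finally show ?thesis by (simp only: nabla_curv_cong_open[OF CN.op z H V V V])
      qed
      moreover have "G (Q t) (\<lambda>i. 0) (?h (Q t)) = 0"
        unfolding Q_def by (rule G_zero_left[where X = Z, OF p Qt vector_field_in[OF Z p]])
      ultimately have e: "nabla_curv CN.C (L.horiz (CM.cp Z)) (L.vert (CM.cp X)) (L.vert (CM.cp Y)) (L.vert (CM.cp Y)) ?q =
          \<phi> t *\<^sub>R curvature N G ?h ?Y ?Y (Q t) i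
          + \<alpha>3 (Q t) (?Y (Q t)) *\<^sub>R curvature N G ?X ?h ?Y (Q t) i
          + \<alpha>4 (Q t) (?Y (Q t)) *\<^sub>R curvature N G ?X ?Y ?h (Q t) i"
        using fun_cong[OF eq[OF vf(1,2,3,3) Q_points], of t i] by (simp add: curv0[OF Q_points] \<phi>_def)
      have c1: "curvature N G ?h ?Y ?Y (Q t) i = curv CN.C (L.horiz (CM.cp Z)) (L.vert (CM.cp Y)) (L.vert (CM.cp Y)) ?q"
        by (rule c[OF H V V])
      have c2: "curvature N G ?X ?h ?Y (Q t) i = curv CN.C (L.vert (CM.cp X)) (L.horiz (CM.cp Z)) (L.vert (CM.cp Y)) ?q"
        by (rule c[OF V H V])
      have c3: "curvature N G ?X ?Y ?h (Q t) i = curv CN.C (L.vert (CM.cp X)) (L.vert (CM.cp Y)) (L.horiz (CM.cp Z)) ?q"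
        by (rule c[OF V V H])
      show ?thesis
        \<comment> \<open>The \<alpha>1 term is already gone by \<open>curv0\<close>, so its
          coefficient is instantiated with 0.\<close>
        using e[unfolded c1 c2 c3]
        by (intro L.weak_symmetry_factor[OF x sX sY sZ cQ refl _ t nz', where ?\<alpha>1.0 = 0
              and ?\<alpha>3.0 = "\<alpha>3 (Q t) (?Y (Q t))" and ?\<alpha>4.0 = "\<alpha>4 (Q t) (?Y (Q t))"]) simp
    qed
    \<comment> \<open>Smoothness of a 1-form is given for constant chart components. Along the ray
      the vertical lift has the constant component (0, \<open>X p i\<close>), so \<phi> is
      continuous even at 0.\<close>
    have cont: "isCont \<phi> 0"
    proof -
      let ?f = "\<lambda>z. \<alpha>2 (cinv N i z) (tvec_of N i (cinv N i z) (0, X p i))"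
      have "continuous_on (cran N i) ?f"
        using \<alpha>2 l by (auto simp: one_form_def intro: smooth_on_continuous)
      then have "continuous_on UNIV (\<lambda>t. ?f (cmap N i (Q t)))"
        by (rule continuous_on_compose2) (auto simp: cQ cran_N[OF l] x intro!: continuous_intros)
      moreover have "?f (cmap N i (Q t)) = \<phi> t" for t
      proof -
        have "cinv N i (cmap N i (Q t)) = Q t"
          using iQ[of i t] i inj_N[OF l] by (simp add: cinv_def charts_at_def)
        moreover have "?X (Q t) i = (0, X p i)" using i by (simp add: vlift_def Q_def)
        moreover have "?X (Q t) \<in> tangent_space N (Q t)" by (rule vector_field_in[OF vf(2) Q_points])
        ultimately show ?thesis using tvec_of_component[of "?X (Q t)" N "Q t" i] i iQ[of i t] by (simp add: \<phi>_def)
      qed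
      ultimately show ?thesis by (simp add: continuous_on_eq_continuous_at)
    qed
    have "((\<lambda>t. \<phi> t * t) \<longlongrightarrow> \<phi> 0 * 0) (at 0)"
      using cont by (intro tendsto_intros) (simp add: isCont_def)
    moreover have "\<forall>\<^sub>F t in at 0. \<phi> t * t = 3"
      using \<open>\<And>t. t \<noteq> 0 \<Longrightarrow> \<phi> t * t = 3\<close> by (auto simp: eventually_at_filter)
    ultimately have "((\<lambda>t. 3) \<longlongrightarrow> \<phi> 0 * 0) (at (0::real))" by (rule Lim_transform_eventually)
    then show False using tendsto_const_iff[of "at (0::real)" "3::real"] by simp
  qed
qed

end

section \<open>Extension of tangent vectors and flatness\<close>

lemma topspace_atlas_topology:
  assumes "smooth_atlas M" shows "topspace (atlas_topology M) = points M"
proof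
  have "openin (atlas_topology M) (points M)"
  proof (unfold openin_atlas_topology[OF assms], intro conjI ballI subset_refl)
    fix i assume i: "i \<in> labels M"
    then have "cdom M i \<inter> points M = cdom M i" by (auto simp: points_def)
    then show "open (cmap M i ` (cdom M i \<inter> points M))"
      using assms i by (simp add: smooth_atlas_def cran_def)
  qed
  then show "points M \<subseteq> topspace (atlas_topology M)" by (rule openin_subset)
  show "topspace (atlas_topology M) \<subseteq> points M"
    using openin_topspace[of "atlas_topology M"] by (simp only: openin_atlas_topology[OF assms])
qed

lemma compactin_chart_image:
  assumes M: "smooth_atlas M" and i: "i \<in> labels M" and K: "compact K" "K \<subseteq> cran M i"
  shows "compactin (atlas_topology M) (cinv M i ` K)"
proof (rule image_compactin)
  have inj: "inj_on (cmap M i) (cdom M i)" using M i by (simp add: smooth_atlas_def)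
  have cinv_in: "cinv M i x \<in> cdom M i" if "x \<in> cran M i" for x
    using that inj by (auto simp: cran_def cinv_def)
  show "compactin (top_of_set (cran M i)) K" using K by (simp add: compactin_subtopology)
  show "continuous_map (top_of_set (cran M i)) (atlas_topology M) (cinv M i)"
    unfolding continuous_map_def
  proof (intro conjI allI impI)
    show "cinv M i \<in> topspace (top_of_set (cran M i)) \<rightarrow> topspace (atlas_topology M)"
      using cinv_in i by (auto simp: topspace_atlas_topology[OF M] points_def)
    fix S assume "openin (atlas_topology M) S"
    then have "open (cmap M i ` (cdom M i \<inter> S))"
      using i by (simp add: openin_atlas_topology[OF M])
    moreover have "{x \<in> topspace (top_of_set (cran M i)). cinv M i x \<in> S} = cmap M i ` (cdom M i \<inter> S)"
      using inj by (auto simp: cran_def cinv_def)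
    ultimately show "openin (top_of_set (cran M i)) {x \<in> topspace (top_of_set (cran M i)). cinv M i x \<in> S}"
      by (simp add: open_subset cran_def image_mono)
  qed
qed

context riemannian_atlas
begin

text \<open>A constant chart field is multiplied by a bump function and extended by zero. The factor
  \<open>k\<close> is the value of the bump at \<open>p\<close>; one \<open>k\<close> serves all
  \<open>u\<close>, and multilinearity removes it later.\<close>

lemma extend_tangent_vector:
  assumes hausdorff: "Hausdorff_space (atlas_topology M)" and i: "i \<in> charts_at M p"
  obtains k where "k \<noteq> 0" "\<And>u. \<exists>X. vector_field M X \<and> X p i = k *\<^sub>R u"
proof -
  note l = charts_labels[OF i]
  obtain \<psi> :: "'e \<Rightarrow> real" and r where \<psi>: "r > 0" "cball (cmap M i p) r \<subseteq> cran M i" "smooth_on UNIV \<psi>" "\<psi> (cmap M i p) \<noteq> 0"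
    "\<And>z. z \<notin> cball (cmap M i p) r \<Longrightarrow> \<psi> z = 0"
    by (rule smooth_bump_exists[OF open_cran[OF l] charts_cran[OF i]]) (rule that)
  define K where "K = cinv M i ` cball (cmap M i p) r"
  have "compactin (atlas_topology M) K"
    unfolding K_def by (rule compactin_chart_image[OF atlas l compact_cball \<psi>(2)])
  \<comment> \<open>The Hausdorff property enters here: a compact set containing the support is
    closed, so the zero extension is smooth on its open complement.\<close>
  then have "closedin (atlas_topology M) K" by (rule compactin_imp_closedin[OF hausdorff])
  then have openK: "openin (atlas_topology M) (points M - K)"
    by (simp add: closedin_def topspace_atlas_topology[OF atlas])
  have outside: "\<psi> (cmap M i q) = 0" if "i \<in> charts_at M q" "q \<notin> K" for q
  proof (rule \<psi>(5), rule notI)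
    assume "cmap M i q \<in> cball (cmap M i p) r"
    then have "cinv M i (cmap M i q) \<in> K" unfolding K_def by (rule imageI)
    then show False using that by (simp add: cinv_cmap[OF atlas])
  qed
  have K_dom: "K \<subseteq> cdom M i"
    using \<psi>(2) inj_chart[OF l] by (fastforce simp: K_def cran_def cinv_def)
  have "\<exists>X. vector_field M X \<and> X p i = \<psi> (cmap M i p) *\<^sub>R u" for u
  proof -
    define X where "X q = (if i \<in> charts_at M q then tvec_of M i q (\<psi> (cmap M i q) *\<^sub>R u) else (\<lambda>_. 0))" for q
    have "smooth_on (cran M j) (vf_comp M X j)" if j: "j \<in> labels M" for j
    proof -
      let ?O = "overlap j i" and ?P = "cmap M j ` (cdom M j \<inter> (points M - K))"
      \<comment> \<open>Two open pieces: where chart \<open>i\<close> is available, and where the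
        field is zero.\<close>
      have "cran M j = ?O \<union> ?P"
        using K_dom j by (auto simp: cran_def points_def)
      moreover have "smooth_on ?O (vf_comp M X j)"
      proof (subst smooth_on_cong[OF open_overlap[OF j l]])
        show "vf_comp M X j x = FD (tr i j) (tr j i x) (\<psi> (tr j i x) *\<^sub>R u)" if "x \<in> ?O" for x
          by (rule overlap_charts[OF j l that])
            (simp add: vf_comp_def cinv_cmap[OF atlas] X_def tvec_of_at transition_cmap)
        have im: "tr j i x \<in> overlap i j" if "x \<in> ?O" for x
          by (rule overlap_charts[OF j l that]) (simp add: transition_cmap charts_overlap)
        note sm = smooth_transition[OF j l]
        show "smooth_on ?O (\<lambda>x. FD (tr i j) (tr j i x) (\<psi> (tr j i x) *\<^sub>R u))"
        proof (rule smooth_on_family[where A = "\<lambda>x. FD (tr i j) (tr j i x)", OF open_overlap[OF j l]])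
          show "linear (FD (tr i j) (tr j i x))" if "x \<in> ?O" for x
            by (rule linear_FD[OF smooth_on_differentiable[OF smooth_transition[OF l j] im[OF that]]])
          show "smooth_on ?O (\<lambda>x. FD (tr i j) (tr j i x) w)" for w
            using im by (intro smooth_on_compose[OF open_overlap[OF j l] _ smooth_on_FD[OF smooth_transition[OF l j]] sm]) auto
          show "smooth_on ?O (\<lambda>x. \<psi> (tr j i x) *\<^sub>R u)"
            by (intro smooth_on_scaleR open_overlap[OF j l] smooth_on_const smooth_on_compose[OF _ _ \<psi>(3) sm]) auto
        qed
      qed
      moreover have P: "open ?P" using openK j by (simp add: openin_atlas_topology[OF atlas])
      moreover have "smooth_on ?P (vf_comp M X j)"
      proof (subst smooth_on_cong[OF P])
        fix x assume "x \<in> ?P"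
        then obtain q where q: "q \<in> cdom M j" "q \<notin> K" "x = cmap M j q" by blast
        then have "j \<in> charts_at M q" using j by (simp add: charts_at_def)
        then have "vf_comp M X j x = X q j" using q(3) by (simp add: vf_comp_def cinv_cmap[OF atlas])
        also have "\<dots> = 0"
          using outside[OF _ q(2)] linear_0[OF linear_transition[OF atlas]] by (simp add: X_def tvec_of_def)
        finally show "vf_comp M X j x = 0" .
      qed simp
      ultimately show ?thesis using smooth_on_Un[OF open_overlap[OF j l] P] by simp
    qed
    moreover have "X q \<in> tangent_space M q" for q
      using tvec_of_in tangent_space_zero by (simp add: X_def)
    ultimately have "vector_field M X" by (simp add: vector_field_def)
    moreover have "X p i = \<psi> (cmap M i p) *\<^sub>R u" using i by (simp add: X_def tvec_of_self)
    ultimately show ?thesis by blast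
  qed
  then show ?thesis using \<psi>(4) that by blast
qed

text \<open>\<open>flat\<close> tests only global fields; extension realises any three vectors at a
  point up to the common factor \<open>k\<close>.\<close>

lemma flat_imp_curv_tensor_zero:
  assumes hausdorff: "Hausdorff_space (atlas_topology M)" and flat: "flat M g"
    and i: "i \<in> labels M" and x: "x \<in> cran M i"
  shows "curv_tensor (levi_civita (metric_comp M g i)) x u v w = 0"
proof -
  interpret chart_metric "cran M i" "metric_comp M g i" by (rule chart_metric_M[OF i])
  interpret C: chart_of M g i by (rule chart_of_M[OF i])
  obtain p where p: "i \<in> charts_at M p" "x = cmap M i p" using x i by (auto simp: cran_def charts_at_def)
  obtain k where k: "k \<noteq> 0" "\<And>u. \<exists>X. vector_field M X \<and> X p i = k *\<^sub>R u"
    using extend_tangent_vector[OF hausdorff p(1)] by blast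
  obtain X Y Z where X: "vector_field M X" "X p i = k *\<^sub>R u" and Y: "vector_field M Y" "Y p i = k *\<^sub>R v"
    and Z: "vector_field M Z" "Z p i = k *\<^sub>R w" using k(2) by meson
  have at: "vf_comp M V i x = V p i" for V unfolding p(2) by (rule vf_comp_cmap[OF inj_chart[OF i] p(1)])
  have "R x (k *\<^sub>R u) (k *\<^sub>R v) (k *\<^sub>R w) = curv \<Gamma> (C.cp X) (C.cp Y) (C.cp Z) x"
    using LC.curv_eq_tensor[OF x vector_field_smooth[OF X(1) i] vector_field_smooth[OF Y(1) i] vector_field_smooth[OF Z(1) i]]
    by (simp add: at X(2) Y(2) Z(2))
  also have "\<dots> = curvature M g X Y Z p i"
    using C.cp_curvature[OF x, of X Y Z] at[of "curvature M g X Y Z"] by simp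
  also have "\<dots> = 0"
    using flat X(1) Y(1) Z(1) charts_at_points[OF p(1)] by (simp add: flat_def)
  finally show ?thesis
    using k(1) by (simp add: linear_scale[OF LC.linear_curv_tensor(1)[OF x]]
        linear_scale[OF LC.linear_curv_tensor(2)[OF x]] linear_scale[OF LC.linear_curv_tensor(3)[OF x]])
qed

end

context riemannian_lift
begin

lemma curv_lift_zero:
  assumes hausdorff: "Hausdorff_space (atlas_topology M)" and flat: "flat M g"
    and i: "i \<in> labels M" and z: "z \<in> cran N i"
    and "smooth_on (cran N i) X" "smooth_on (cran N i) Y" "smooth_on (cran N i) Z"
  shows "curv (levi_civita (metric_comp N G i)) X Y Z z = 0"
proof -
  interpret lifted_metric "cran M i" "metric_comp M g i" a b c "metric_comp N G i"
    by (rule lifted_metric_chart[OF i])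
  show ?thesis
    using assms flat_imp_curv_tensor_zero[OF hausdorff flat i]
    by (intro flat_lift) (auto simp: cran_N[OF i])
qed

lemma flat_imp_flat_lift:
  assumes hausdorff: "Hausdorff_space (atlas_topology M)" and flat: "flat M g"
  shows "flat N G"
  unfolding flat_def
proof (intro allI impI ballI ext)
  fix X Y Z q i
  assume X: "vector_field N X" and Y: "vector_field N Y" and Z: "vector_field N Z"
  show "curvature N G X Y Z q i = 0"
  proof (cases "i \<in> charts_at N q")
    case True
    then have i: "i \<in> labels M" and z: "cmap N i q \<in> cran N i" by (auto simp: charts_at_def cran_def)
    interpret C: chart_of N G i by (rule chart_of_N[OF i])
    have "curvature N G X Y Z q i = C.cp (curvature N G X Y Z) (cmap N i q)"
      by (rule vf_comp_cmap[OF inj_N[OF i] True, symmetric])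
    also have "\<dots> = curv C.C (C.cp X) (C.cp Y) (C.cp Z) (cmap N i q)" by (rule C.cp_curvature[OF z])
    also have "\<dots> = 0"
      using vector_field_smooth[OF X] vector_field_smooth[OF Y] vector_field_smooth[OF Z] i
      by (intro curv_lift_zero[OF hausdorff flat i z]) auto
    finally show ?thesis .
  qed (rule curvature_outside)
qed

text \<open>Each of the four terms contains a curvature of fields that are smooth on the chart; the
  covariant derivatives among the arguments are covered because \<open>curv_lift_zero\<close> is
  stated for local fields.\<close>

lemma flat_imp_nabla_curvature_lift_zero:
  assumes hausdorff: "Hausdorff_space (atlas_topology M)" and flat: "flat M g"
    and W: "vector_field N W" and X: "vector_field N X" and Y: "vector_field N Y" and Z: "vector_field N Z"
  shows "nabla_curvature N G W X Y Z q i = 0"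
proof (cases "i \<in> charts_at N q")
  case True
  then have i: "i \<in> labels M" and z: "cmap N i q \<in> cran N i" by (auto simp: charts_at_def cran_def)
  interpret C: chart_of N G i by (rule chart_of_N[OF i])
  interpret lifted_metric "cran M i" "metric_comp M g i" a b c "metric_comp N G i"
    by (rule lifted_metric_chart[OF i])
  have s: "smooth_on (cran N i) (C.cp V)" if "vector_field N V" for V
    using vector_field_smooth[OF that] i by simp
  have sn: "smooth_on (cran N i) (cov_deriv C.C (C.cp W) (C.cp V))" if "vector_field N V" for V
    using T.LC.smooth_cov_deriv[of "C.cp W" "C.cp V"] s[OF W] s[OF that] by (simp add: cran_N[OF i])
  note zero = curv_lift_zero[OF hausdorff flat i]
  have "cov_deriv C.C (C.cp W) (curv C.C (C.cp X) (C.cp Y) (C.cp Z)) (cmap N i q) =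
      cov_deriv C.C (C.cp W) (\<lambda>z. 0) (cmap N i q)"
    by (rule cov_deriv_cong_open[OF C.op z zero[OF _ s[OF X] s[OF Y] s[OF Z]]])
  also have "\<dots> = 0"
    using z by (simp add: cov_deriv_def bilinear_rzero[OF T.\<Gamma>_bil] cran_N[OF i])
  finally have "nabla_curv C.C (C.cp W) (C.cp X) (C.cp Y) (C.cp Z) (cmap N i q) = 0"
    by (simp add: nabla_curv_def zero[OF z sn[OF X] s[OF Y] s[OF Z]] zero[OF z s[OF X] sn[OF Y] s[OF Z]]
        zero[OF z s[OF X] s[OF Y] sn[OF Z]])
  then show ?thesis
    using C.cp_nabla_curvature[OF z, of W X Y Z] vf_comp_cmap[OF inj_N[OF i] True, of "nabla_curvature N G W X Y Z"] by simp
qed (rule nabla_curvature_outside)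

lemma flat_imp_weakly_symmetric:
  assumes hausdorff: "Hausdorff_space (atlas_topology M)" and flat: "flat M g"
  shows "weakly_symmetric N G"
  unfolding weakly_symmetric_def
proof (intro exI conjI allI impI ballI ext)
  let ?\<alpha> = "\<lambda>q \<xi>. 0 :: real" and ?A = "\<lambda>q i. 0 :: 'e \<times> 'e"
  show "one_form N ?\<alpha>" "one_form N ?\<alpha>" "one_form N ?\<alpha>" "one_form N ?\<alpha>"
    by (simp_all add: one_form_def module_hom_zero)
  have "?A q \<in> tangent_space N q" if "q \<in> points N" for q
  proof -
    obtain p y where q: "q = (p, y)" by (cases q)
    have "y \<in> tangent_space M p" using that by (simp add: q points_N)
    \<comment> \<open>The zero vector is recognised as tangent to TM by viewing it as the vertical
      lift of zero.\<close>
    then have "vlift M (\<lambda>p i. 0) (p, y) \<in> tangent_space N (p, y)" by (rule vlift_in[where X = "\<lambda>p i. 0", OF tangent_space_zero])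
    moreover have "vlift M (\<lambda>p i. 0) (p, y) = (\<lambda>i. 0)" by (auto simp: vlift_def zero_prod_def)
    ultimately show ?thesis by (simp add: q)
  qed
  then show "vector_field N ?A" by (simp add: vector_field_def vf_comp_def[abs_def])
  fix W X Y Z q i
  assume "vector_field N W" "vector_field N X" "vector_field N Y" "vector_field N Z"
  then show "nabla_curvature N G W X Y Z q i = 0 *\<^sub>R curvature N G X Y Z q i + 0 *\<^sub>R curvature N G W Y Z q i
      + 0 *\<^sub>R curvature N G X W Z q i + 0 *\<^sub>R curvature N G X Y W q i + G q (curvature N G X Y Z q) (W q) *\<^sub>R 0"
    by (simp add: flat_imp_nabla_curvature_lift_zero[OF hausdorff flat])
qed

end

theorem theorem2:
  fixes M :: "('a, 'i, 'e::euclidean_space) atlas"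
    and g :: "('a, 'i, 'e) tensor2"
    and a b c :: real
  assumes "riemannian_manifold M g"
    and "DIM('e) \<ge> 3"
    and "a > 0"
    and "a * (a + c) - b\<^sup>2 > 0"
  shows "(weakly_symmetric (tangent_bundle M) (lift_metric a b c M g) \<longleftrightarrow> flat M g) \<and>
         (flat M g \<longrightarrow> flat (tangent_bundle M) (lift_metric a b c M g))"
proof -
  interpret riemannian_lift M g a b c
    using assms by unfold_locales (simp_all add: riemannian_manifold_def smooth_manifold_def)
  \<comment> \<open>Used for both consequences of flatness, through the extension of tangent
    vectors.\<close>
  have "Hausdorff_space (atlas_topology M)"
    using assms(1) by (simp add: riemannian_manifold_def smooth_manifold_def)
  then show ?thesis
    using weakly_symmetric_imp_flat flat_imp_weakly_symmetric flat_imp_flat_lift by blast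
qed

end
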